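(* Let $S$ be a set with $n=\ell+3\ge4$ elements and let $\delta$ be a dihedral structure on $S$. The affine variety $\mathfrak{M}^\delta_{0,S}$ is smooth, and the divisors $D_{ij}=\{u_{ij}=0\}\subset\mathfrak{M}^\delta_{0,S}$, for $\{i,j\}\in\chi_{S,\delta}$, are smooth and normal crossing.
   Context: A dihedral structure on $S$ is an identification of $S$ with the set of edges of an unoriented $n$-gon modulo dihedral symmetries; write $S=\{1,\ldots,n\}$ in the corresponding order, with indices mod $n$, and let "vertex $i$" of the $n$-gon lie between edges $i$ and $i+1$. $\chi_{S,\delta}$ is the set of chords, i.e. unordered pairs $\{i,j\}$ with $i,i+1,j,j+1$ distinct mod $n$ (the chord joins vertices $i$ and $j$). Two chords cross if they have no common endpoint and their endpoints interlace on the polygon. Two subsets $A,B\subset\chi_{S,\delta}$ cross completely if $A$ is exactly the set of chords crossing every chord in $B$, and $B$ is exactly the set of chords crossing every chord in $A$. The dihedral extension of the moduli space $\mathfrak{M}_{0,S}$ of genus $0$ curves with points marked by $S$ is the affine scheme $$\mathfrak{M}^\delta_{0,S}=\mathrm{Spec}\ \mathbb{Z}[u_{ij}:\{i,j\}\in\chi_{S,\delta}]\big/\big(\textstyle\prod_{a\in A}u_a+\prod_{b\in B}u_b-1\ :\ A,B\text{ cross completely}\big).$$ $\mathfrak{M}_{0,S}$ is its open subscheme where all $u_{ij}\ne0$, the embedding being given by the cross-ratios $u_{ij}=\frac{(z_i-z_{j+1})(z_{i+1}-z_j)}{(z_i-z_j)(z_{i+1}-z_{j+1})}$.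
   Formalization: Only relations where A joins two opposite ones of four consecutive arcs of vertices and B the other two are imposed; other completely crossing pairs (empty set with all chords; for n≥8 e.g. octagon diameters {04,26},{15,37}), whose relations fail for the cross-ratios, are dropped. *)

theory Defs
  imports
    "HOL-Library.Poly_Mapping"
    "HOL-Algebra.QuotRing"
    "Jordan_Normal_Form.Determinant"
begin

section \<open>Dihedral structures and chords\<close>

text \<open>
  The edges of the \<open>n\<close>-gon are the residues mod \<open>n\<close>; an identification of \<open>S\<close> with them is an
  \<open>n\<close>-periodic enumeration of \<open>S\<close> by the integers, \<open>n = card S\<close>.
\<close>

definition edge_labelling :: "'s set \<Rightarrow> (int \<Rightarrow> 's) \<Rightarrow> bool" where
  "edge_labelling S e \<longleftrightarrow>
     range e = S \<and> (\<forall>i j. e i = e j \<longleftrightarrow> i mod int (card S) = j mod int (card S))"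

text \<open>A dihedral structure is a class of such identifications modulo rotations and reflections.\<close>

definition dihedral_class :: "(int \<Rightarrow> 's) \<Rightarrow> (int \<Rightarrow> 's) set" where
  "dihedral_class e = {\<lambda>i. e (k + i) | k. True} \<union> {\<lambda>i. e (k - i) | k. True}"

definition dihedral_structure :: "'s set \<Rightarrow> (int \<Rightarrow> 's) set \<Rightarrow> bool" where
  "dihedral_structure S \<delta> \<longleftrightarrow> (\<exists>e. edge_labelling S e \<and> \<delta> = dihedral_class e)"

text \<open>
  Vertex \<open>i\<close> is encoded by the two edges that it lies between, and a chord by its two end points,
  so that a chord is an object attached to \<open>\<delta>\<close> and not to a choice of labelling.
\<close>

definition vertex :: "(int \<Rightarrow> 's) \<Rightarrow> int \<Rightarrow> 's set" where
  "vertex e i = {e i, e (i + 1)}"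

definition chord :: "(int \<Rightarrow> 's) \<Rightarrow> int \<Rightarrow> int \<Rightarrow> 's set set" where
  "chord e i j = {vertex e i, vertex e j}"

definition chords :: "(int \<Rightarrow> 's) set \<Rightarrow> 's set set set" where
  "chords \<delta> = {chord e i j | e i j. e \<in> \<delta> \<and> distinct [e i, e (i + 1), e j, e (j + 1)]}"

definition chords_cross :: "'s set \<Rightarrow> (int \<Rightarrow> 's) set \<Rightarrow> 's set set \<Rightarrow> 's set set \<Rightarrow> bool" where
  "chords_cross S \<delta> a b \<longleftrightarrow>
     (\<exists>e\<in>\<delta>. \<exists>i j k l. i < j \<and> j < k \<and> k < l \<and> l < i + int (card S) \<and>
        a = chord e i k \<and> b = chord e j l)"

definition cross_completely ::
    "'s set \<Rightarrow> (int \<Rightarrow> 's) set \<Rightarrow> 's set set set \<Rightarrow> 's set set set \<Rightarrow> bool" where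
  "cross_completely S \<delta> A B \<longleftrightarrow>
     A \<subseteq> chords \<delta> \<and> B \<subseteq> chords \<delta> \<and>
     A = {a \<in> chords \<delta>. \<forall>b\<in>B. chords_cross S \<delta> a b} \<and>
     B = {b \<in> chords \<delta>. \<forall>a\<in>A. chords_cross S \<delta> a b}"

text \<open>
  The polygon vertices are cut into four consecutive nonempty arcs; \<open>A\<close> joins one opposite pair of arcs
  and \<open>B\<close> the other one. The relation \<open>\<Prod>\<^sub>A u + \<Prod>\<^sub>B u = 1\<close> then is the identity between
  the two complementary cross-ratios of the four edges that separate the arcs.

  Complete crossing alone also admits pairs for which this relation fails for the cross-ratios:
  the pair of the empty set and the set of all chords (the relation would say
  \<open>\<Prod> u = 0\<close>), and, for \<open>n \<ge> 8\<close>, sporadic pairs such as the diameters \<open>{04, 26}\<close> and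
  \<open>{15, 37}\<close> of an octagon. They have to be excluded for the open part where all \<open>u\<close> are nonzero to
  be the moduli space of \<open>n\<close>-pointed curves.
\<close>

definition join_opposite_arcs ::
    "'s set \<Rightarrow> (int \<Rightarrow> 's) set \<Rightarrow> 's set set set \<Rightarrow> 's set set set \<Rightarrow> bool" where
  "join_opposite_arcs S \<delta> A B \<longleftrightarrow>
     (\<exists>e\<in>\<delta>. \<exists>i j k l. i < j \<and> j < k \<and> k < l \<and> l < i + int (card S) \<and>
        A = {chord e p q | p q. p \<in> {i..<j} \<and> q \<in> {k..<l}} \<and>
        B = {chord e p q | p q. p \<in> {j..<k} \<and> q \<in> {l..<i + int (card S)}})"


section \<open>Integer polynomial rings\<close>

type_synonym 'v int_mpoly = "('v \<Rightarrow>\<^sub>0 nat) \<Rightarrow>\<^sub>0 int"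

definition mvar :: "'v \<Rightarrow> 'v int_mpoly" where
  "mvar v = Poly_Mapping.single (Poly_Mapping.single v 1) 1"

definition mvars :: "'v int_mpoly \<Rightarrow> 'v set" where
  "mvars p = (\<Union>m\<in>Poly_Mapping.keys p. Poly_Mapping.keys m)"

definition mpderiv :: "'v \<Rightarrow> 'v int_mpoly \<Rightarrow> 'v int_mpoly" where
  "mpderiv v p = (\<Sum>m\<in>Poly_Mapping.keys p.
     Poly_Mapping.single (m - Poly_Mapping.single v 1)
       (int (Poly_Mapping.lookup m v) * Poly_Mapping.lookup p m))"

definition int_poly_ring :: "'v set \<Rightarrow> 'v int_mpoly ring" where
  "int_poly_ring V = \<lparr>carrier = {p. mvars p \<subseteq> V}, monoid.mult = (*), one = 1, zero = 0, add = (+)\<rparr>"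


section \<open>The dihedral extension and its boundary divisors\<close>

definition dihedral_ideal :: "'s set \<Rightarrow> (int \<Rightarrow> 's) set \<Rightarrow> 's set set int_mpoly set" where
  "dihedral_ideal S \<delta> = Idl\<^bsub>int_poly_ring (chords \<delta>)\<^esub>
     {(\<Prod>a\<in>A. mvar a) + (\<Prod>b\<in>B. mvar b) - 1 | A B.
        cross_completely S \<delta> A B \<and> join_opposite_arcs S \<delta> A B}"

text \<open>Affine schemes are represented by their coordinate rings, closed subschemes by ideals.\<close>

definition dihedral_ring :: "'s set \<Rightarrow> (int \<Rightarrow> 's) set \<Rightarrow> 's set set int_mpoly set ring" where
  "dihedral_ring S \<delta> = int_poly_ring (chords \<delta>) Quot dihedral_ideal S \<delta>"

definition dihedral_coord ::
    "'s set \<Rightarrow> (int \<Rightarrow> 's) set \<Rightarrow> 's set set \<Rightarrow> 's set set int_mpoly set" where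
  "dihedral_coord S \<delta> c = dihedral_ideal S \<delta> +>\<^bsub>int_poly_ring (chords \<delta>)\<^esub> mvar c"

definition boundary_divisor ::
    "'s set \<Rightarrow> (int \<Rightarrow> 's) set \<Rightarrow> 's set set \<Rightarrow> 's set set int_mpoly set set" where
  "boundary_divisor S \<delta> c = PIdl\<^bsub>dihedral_ring S \<delta>\<^esub> (dihedral_coord S \<delta> c)"


section \<open>Smoothness and normal crossings over the integers\<close>

text \<open>\<open>\<phi>\<close> identifies \<open>B\<close> with the localisation of \<open>A\<close> at the powers of \<open>f\<close>.\<close>

definition localization_away ::
    "('a, 'm) ring_scheme \<Rightarrow> 'a \<Rightarrow> ('b, 'k) ring_scheme \<Rightarrow> ('a \<Rightarrow> 'b) \<Rightarrow> bool" where
  "localization_away A f B \<phi> \<longleftrightarrow>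
     \<phi> \<in> Ring.ring_hom A B \<and> \<phi> f \<in> Units B \<and>
     (\<forall>b\<in>carrier B. \<exists>a\<in>carrier A. \<exists>k::nat. b \<otimes>\<^bsub>B\<^esub> (\<phi> f [^]\<^bsub>B\<^esub> k) = \<phi> a) \<and>
     (\<forall>a\<in>carrier A. \<phi> a = \<zero>\<^bsub>B\<^esub> \<longrightarrow> (\<exists>k::nat. (f [^]\<^bsub>A\<^esub> k) \<otimes>\<^bsub>A\<^esub> a = \<zero>\<^bsub>A\<^esub>))"

definition chart_ideal :: "nat \<Rightarrow> nat \<Rightarrow> (nat \<Rightarrow> nat int_mpoly) \<Rightarrow> nat int_mpoly set" where
  "chart_ideal d r g = Idl\<^bsub>int_poly_ring {..<d + r}\<^esub> (g ` {..<r})"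

definition chart_ring :: "nat \<Rightarrow> nat \<Rightarrow> (nat \<Rightarrow> nat int_mpoly) \<Rightarrow> nat int_mpoly set ring" where
  "chart_ring d r g = int_poly_ring {..<d + r} Quot chart_ideal d r g"

definition chart_class ::
    "nat \<Rightarrow> nat \<Rightarrow> (nat \<Rightarrow> nat int_mpoly) \<Rightarrow> nat int_mpoly \<Rightarrow> nat int_mpoly set" where
  "chart_class d r g p = chart_ideal d r g +>\<^bsub>int_poly_ring {..<d + r}\<^esub> p"

text \<open>
  A standard smooth chart of relative dimension \<open>d\<close> of \<open>Spec A\<close> at the point \<open>P\<close>: an isomorphism of
  a basic open neighbourhood of \<open>P\<close> with
  \<open>Spec (\<int>[x\<^sub>0, \<dots>, x\<^bsub>d+r-1\<^esub>] / (g\<^sub>0, \<dots>, g\<^bsub>r-1\<^esub>))\<close> such that the Jacobian determinant of the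
  \<open>g\<^sub>i\<close> with respect to the last \<open>r\<close> variables is invertible. The first \<open>d\<close> variables are then
  (etale) local coordinates.
\<close>

definition smooth_chart_at ::
    "('a, 'm) ring_scheme \<Rightarrow> 'a set \<Rightarrow> nat \<Rightarrow> nat \<Rightarrow> (nat \<Rightarrow> nat int_mpoly) \<Rightarrow>
     ('a \<Rightarrow> nat int_mpoly set) \<Rightarrow> bool" where
  "smooth_chart_at A P d r g \<phi> \<longleftrightarrow>
     (\<forall>i<r. g i \<in> carrier (int_poly_ring {..<d + r})) \<and>
     (\<exists>f \<in> carrier A - P. localization_away A f (chart_ring d r g) \<phi>) \<and>
     chart_class d r g (det (mat r r (\<lambda>(i, j). mpderiv (d + j) (g i)))) \<in> Units (chart_ring d r g)"

definition smooth_over_int :: "('a, 'm) ring_scheme \<Rightarrow> bool" where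
  "smooth_over_int A \<longleftrightarrow>
     (\<forall>P. primeideal P A \<longrightarrow> (\<exists>d r g \<phi>. smooth_chart_at A P d r g \<phi>))"

text \<open>
  The closed subschemes \<open>V(D c)\<close>, \<open>c \<in> I\<close>, of \<open>Spec A\<close> cross normally: every point has a chart in
  which those \<open>V(D c)\<close> that pass through the point are distinct coordinate hyperplanes
  \<open>x\<^bsub>k c\<^esub> = 0\<close>.
\<close>

definition normal_crossing :: "('a, 'm) ring_scheme \<Rightarrow> 'i set \<Rightarrow> ('i \<Rightarrow> 'a set) \<Rightarrow> bool" where
  "normal_crossing A I D \<longleftrightarrow>
     (\<forall>P. primeideal P A \<longrightarrow>
        (\<exists>d r g \<phi> k. smooth_chart_at A P d r g \<phi> \<and>
           inj_on k {c \<in> I. D c \<subseteq> P} \<and>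
           (\<forall>c\<in>I. D c \<subseteq> P \<longrightarrow> k c < d \<and>
              Idl\<^bsub>chart_ring d r g\<^esub> (\<phi> ` D c) =
              PIdl\<^bsub>chart_ring d r g\<^esub> (chart_class d r g (mvar (k c))))))"

end

theory Submission
  imports Defs "HOL-Computational_Algebra.Fraction_Field"
begin

text \<open>
  Place one marked point at infinity, so that the others are \<open>z\<^sub>1, \<dots>, z\<^sub>N\<close> on a line and a chord becomes
  an interval of marked points. Two crossing chords occur in the two products of a common relation; hence
  the chords whose coordinates vanish at a given point do not cross and belong to a triangulation \<open>T\<close>.

  Let \<open>x\<^sub>c\<close>, for \<open>c \<in> T\<close>, be the length of the interval \<open>c\<close> divided by that of the next larger interval
  of \<open>T\<close>. All differences \<open>z\<^sub>j - z\<^sub>i\<close> are monomials in the \<open>x\<^sub>c\<close> times polynomials \<open>P\<^sub>i\<^sub>j\<close> with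
  \<open>P\<^sub>i\<^sub>j(0) = 1\<close>, and the cross-ratio \<open>u\<^sub>c\<close> is a product of such polynomials and their inverses, times \<open>x\<^sub>c\<close> if
  \<open>c \<in> T\<close>. Conversely \<open>x\<^sub>c\<close> is the product of the \<open>u\<^sub>d\<close> over the intervals \<open>d\<close> that contain \<open>c\<close> but not the
  next larger interval of \<open>T\<close>. The relations with a cut at infinity say that lengths add up; they show that
  \<open>P\<^sub>i\<^sub>j\<close> equals a product of \<open>u\<^sub>d\<close> with \<open>d \<notin> T\<close>, so both constructions are inverse to each other.
  Therefore the open set where all \<open>u\<^sub>d\<close> with \<open>d \<notin> T\<close> are invertible is the open subset of affine space
  where all \<open>P\<^sub>i\<^sub>j\<close> are invertible, and there \<open>u\<^sub>c = 0\<close> is the coordinate hyperplane \<open>x\<^sub>c = 0\<close>.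
\<close>

section \<open>Evaluation of integer polynomials\<close>

text \<open>The obstacle is that the coordinate ring is given by generators and relations only: it
  is not known in advance to be a domain, so nothing may be cancelled in it. The two directions are
  therefore proved in different places. The cross-ratios as functions of the \<open>x\<close> are
  studied in the fraction field of \<int>[x], where distances can be divided freely. The way back,
  from the \<open>u\<close> to the \<open>x\<close>, is studied modulo the ideal, with congruences
  and with identities of monomials that hold exactly; every denominator comes with a cofactor
  showing that it divides a power of the product of the \<open>u c\<close> with \<open>c\<close>
  outside the triangulation. An element that vanishes in the field is then killed by such a power,
  which is the injectivity required of a localisation.

  Triangulations are encoded by heights of the vertices because nesting, the triangle above a chord
  and the leading monomial of a distance can then be read off by comparing numbers. The chart
  adjoins an inverse \<open>y\<close> of the product \<open>F\<close> of all P_ij by the single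
  equation \<open>y * F - 1\<close>; its derivative in \<open>y\<close> is \<open>F\<close>, so the
  Jacobian condition is immediate.\<close>

definition is_hom :: "('a::comm_ring_1 \<Rightarrow> 'b::comm_ring_1) \<Rightarrow> bool" where
  "is_hom h \<longleftrightarrow> h 1 = 1 \<and> (\<forall>x y. h (x + y) = h x + h y) \<and> (\<forall>x y. h (x * y) = h x * h y)"

lemma is_hom_simps:
  assumes "is_hom h"
  shows "h 1 = 1" "h (x + y) = h x + h y" "h (x * y) = h x * h y" "h 0 = 0" "h (- x) = - h x"
    "h (x - y) = h x - h y" "h (x ^ k) = h x ^ k" "h (sum g A) = (\<Sum>a\<in>A. h (g a))"
    "h (prod g A) = (\<Prod>a\<in>A. h (g a))" "h (of_int c) = of_int c" "h (of_nat k) = of_nat k"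
proof -
  have add: "h (x + y) = h x + h y" for x y using assms by (simp add: is_hom_def)
  have mul: "h (x * y) = h x * h y" for x y using assms by (simp add: is_hom_def)
  show one: "h 1 = 1" using assms by (simp add: is_hom_def)
  show zero: "h 0 = 0" using add[of 0 0] by simp
  have neg: "h (- x) = - h x" for x
    using add[of x "- x"] zero by (simp add: eq_neg_iff_add_eq_0 add.commute)
  show "h (x + y) = h x + h y" "h (x * y) = h x * h y" "h (- x) = - h x"
    by (fact add mul neg)+
  show "h (x - y) = h x - h y"
    using add[of x "- y"] neg[of y] by simp
  show "h (x ^ k) = h x ^ k" by (induction k) (auto simp: one mul)
  show "h (sum g A) = (\<Sum>a\<in>A. h (g a))"
    by (induction A rule: infinite_finite_induct) (auto simp: zero add)
  show "h (prod g A) = (\<Prod>a\<in>A. h (g a))"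
    by (induction A rule: infinite_finite_induct) (auto simp: one mul)
  have nat: "h (of_nat k) = of_nat k" for k by (induction k) (auto simp: zero one add)
  show "h (of_nat k) = of_nat k" by (fact nat)
  show "h (of_int c) = of_int c"
    by (cases c rule: int_cases2) (auto simp: nat neg)
qed

lemma is_hom_comp: "is_hom g \<Longrightarrow> is_hom h \<Longrightarrow> is_hom (\<lambda>x. g (h x))"
  by (simp add: is_hom_def)

definition monom_eval :: "('v \<Rightarrow> 'a::comm_ring_1) \<Rightarrow> ('v \<Rightarrow>\<^sub>0 nat) \<Rightarrow> 'a" where
  "monom_eval h m = (\<Prod>v\<in>Poly_Mapping.keys m. h v ^ Poly_Mapping.lookup m v)"

definition meval :: "('v \<Rightarrow> 'a::comm_ring_1) \<Rightarrow> 'v int_mpoly \<Rightarrow> 'a" where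
  "meval h p = (\<Sum>m\<in>Poly_Mapping.keys p. of_int (Poly_Mapping.lookup p m) * monom_eval h m)"

lemma monom_eval_superset:
  assumes "finite V" "Poly_Mapping.keys m \<subseteq> V"
  shows "monom_eval h m = (\<Prod>v\<in>V. h v ^ Poly_Mapping.lookup m v)"
  unfolding monom_eval_def
  by (rule prod.mono_neutral_left[OF assms]) (auto simp: in_keys_iff)

lemma meval_superset:
  assumes "finite M" "Poly_Mapping.keys p \<subseteq> M"
  shows "meval h p = (\<Sum>m\<in>M. of_int (Poly_Mapping.lookup p m) * monom_eval h m)"
  unfolding meval_def
  by (rule sum.mono_neutral_left[OF assms]) (auto simp: in_keys_iff)

lemma monom_eval_add: "monom_eval h (m + m') = monom_eval h m * monom_eval h m'"
proof -
  let ?V = "Poly_Mapping.keys m \<union> Poly_Mapping.keys m'"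
  have V: "finite ?V" by simp
  have "Poly_Mapping.keys (m + m') \<subseteq> ?V" by (rule keys_add)
  then show ?thesis
    using monom_eval_superset[OF V, of _ h]
    by (simp add: lookup_add power_add prod.distrib)
qed

lemma monom_eval_zero [simp]: "monom_eval h 0 = 1"
  by (simp add: monom_eval_def)

lemma meval_add: "meval h (p + q) = meval h p + meval h q"
proof -
  let ?M = "Poly_Mapping.keys p \<union> Poly_Mapping.keys q"
  have M: "finite ?M" by simp
  have "Poly_Mapping.keys (p + q) \<subseteq> ?M" by (rule keys_add)
  then show ?thesis
    using meval_superset[OF M, of _ h]
    by (simp add: lookup_add distrib_right sum.distrib)
qed

lemma meval_single: "meval h (Poly_Mapping.single m c) = of_int c * monom_eval h m"
  using meval_superset[of "{m}" "Poly_Mapping.single m c" h] by simp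

lemma meval_zero: "meval h 0 = 0"
  by (simp add: meval_def)

lemma meval_sum: "meval h (sum g A) = (\<Sum>a\<in>A. meval h (g a))"
  by (induction A rule: infinite_finite_induct) (auto simp: meval_zero meval_add)

lemma poly_mapping_sum_single:
  "(\<Sum>m\<in>Poly_Mapping.keys p. Poly_Mapping.single m (Poly_Mapping.lookup p m)) = p"
proof (rule poly_mapping_eqI)
  fix m
  have "Poly_Mapping.lookup (\<Sum>m\<in>Poly_Mapping.keys p. Poly_Mapping.single m (Poly_Mapping.lookup p m)) m
     = (\<Sum>k\<in>Poly_Mapping.keys p. if k = m then Poly_Mapping.lookup p m else 0)"
    by (auto simp: lookup_sum lookup_single when_def intro!: sum.cong)
  then show "Poly_Mapping.lookup (\<Sum>m\<in>Poly_Mapping.keys p. Poly_Mapping.single m (Poly_Mapping.lookup p m)) m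
     = Poly_Mapping.lookup p m"
    by (simp add: in_keys_iff)
qed

lemma meval_mult: "meval h (p * q) = meval h p * meval h q"
proof -
  let ?s = "\<lambda>p m. Poly_Mapping.single m (Poly_Mapping.lookup p m)"
  have "p * q = (\<Sum>m\<in>Poly_Mapping.keys p. ?s p m) * (\<Sum>m\<in>Poly_Mapping.keys q. ?s q m)"
    by (simp only: poly_mapping_sum_single)
  also have "\<dots> = (\<Sum>m\<in>Poly_Mapping.keys p. \<Sum>n\<in>Poly_Mapping.keys q.
      Poly_Mapping.single (m + n) (Poly_Mapping.lookup p m * Poly_Mapping.lookup q n))"
    by (simp add: sum_product mult_single)
  finally have "meval h (p * q) = (\<Sum>m\<in>Poly_Mapping.keys p. \<Sum>n\<in>Poly_Mapping.keys q.
      of_int (Poly_Mapping.lookup p m * Poly_Mapping.lookup q n) * monom_eval h (m + n))"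
    by (simp only: meval_sum meval_single)
  also have "\<dots> = meval h p * meval h q"
    by (simp add: meval_def sum_product monom_eval_add ac_simps)
  finally show ?thesis .
qed

lemma meval_one: "meval h 1 = 1"
  using meval_single[of h 0 1] by simp

lemma is_hom_meval: "is_hom (meval h)"
  by (simp add: is_hom_def meval_add meval_mult meval_one)

lemmas meval_simps = is_hom_simps[OF is_hom_meval]

lemma meval_mvar [simp]: "meval h (mvar v) = h v"
  by (simp add: mvar_def meval_single monom_eval_def)

lemma meval_cong: "(\<And>v. v \<in> mvars p \<Longrightarrow> h v = h' v) \<Longrightarrow> meval h p = meval h' p"
  unfolding meval_def monom_eval_def mvars_def
  by (intro sum.cong prod.cong arg_cong2[where f = "(*)"] arg_cong2[where f = "(^)"]) auto

lemma is_hom_meval_comp: "is_hom g \<Longrightarrow> g (meval h p) = meval (\<lambda>v. g (h v)) p"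
  by (simp add: meval_def monom_eval_def is_hom_simps)

lemma single_eq_monom_eval:
  fixes m :: "'v \<Rightarrow>\<^sub>0 nat"
  shows "Poly_Mapping.single m (c::int) = of_int c * monom_eval mvar m"
proof -
  have pow: "mvar v ^ k = Poly_Mapping.single (Poly_Mapping.single v k) (1::int)" for v :: 'v and k
    by (induction k) (auto simp: mvar_def mult_single single_add[symmetric])
  have *: "(\<Prod>v\<in>A. Poly_Mapping.single (g v) (1::int)) = Poly_Mapping.single (sum g A) 1"
    for g :: "'v \<Rightarrow> 'v \<Rightarrow>\<^sub>0 nat" and A
    by (induction A rule: infinite_finite_induct) (auto simp: mult_single)
  have "monom_eval mvar m = Poly_Mapping.single m (1::int)"
    by (simp add: monom_eval_def pow * poly_mapping_sum_single)
  moreover have "(of_int c :: 'v int_mpoly) = Poly_Mapping.single 0 c"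
    using single_of_int[of c, where ?'b = int and ?'a = "'v \<Rightarrow>\<^sub>0 nat"] by simp
  ultimately show ?thesis by (simp add: mult_single)
qed

lemma meval_mvar_id: "meval mvar p = p"
  by (simp add: meval_def single_eq_monom_eval[symmetric] poly_mapping_sum_single)

section \<open>Polynomials in a given set of variables\<close>

lemma mvars_add: "mvars (p + q) \<subseteq> mvars p \<union> mvars q"
  using keys_add[of p q] by (fastforce simp: mvars_def)

lemma mvars_uminus: "mvars (- p) = mvars p"
  by (simp add: mvars_def)

lemma mvars_mult: "mvars (p * q) \<subseteq> mvars p \<union> mvars q"
proof
  fix v assume "v \<in> mvars (p * q)"
  then obtain m where m: "m \<in> Poly_Mapping.keys (p * q)" "v \<in> Poly_Mapping.keys m"
    by (auto simp: mvars_def)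
  then obtain a b where ab: "m = a + b" "a \<in> Poly_Mapping.keys p" "b \<in> Poly_Mapping.keys q"
    using keys_mult[of p q] by blast
  then have "v \<in> Poly_Mapping.keys a \<union> Poly_Mapping.keys b" using m(2) keys_add[of a b] by blast
  then show "v \<in> mvars p \<union> mvars q" using ab by (auto simp: mvars_def)
qed

lemma mvars_mvar [simp]: "mvars (mvar v) = {v}"
  by (simp add: mvars_def mvar_def)

lemma mvars_one [simp]: "mvars (1 :: 'v int_mpoly) = {}"
  by (simp add: mvars_def)

lemma mvars_zero [simp]: "mvars (0 :: 'v int_mpoly) = {}"
  by (simp add: mvars_def)

definition mpolys :: "'v set \<Rightarrow> 'v int_mpoly set" where
  "mpolys V = {p. mvars p \<subseteq> V}"

lemma mpolys_0 [simp, intro]: "0 \<in> mpolys V"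
  and mpolys_1 [simp, intro]: "1 \<in> mpolys V"
  and mpolys_mvar: "v \<in> V \<Longrightarrow> mvar v \<in> mpolys V"
  and mpolys_add: "p \<in> mpolys V \<Longrightarrow> q \<in> mpolys V \<Longrightarrow> p + q \<in> mpolys V"
  and mpolys_uminus: "p \<in> mpolys V \<Longrightarrow> - p \<in> mpolys V"
  and mpolys_mult: "p \<in> mpolys V \<Longrightarrow> q \<in> mpolys V \<Longrightarrow> p * q \<in> mpolys V"
  using mvars_add[of p q] mvars_mult[of p q]
  by (auto simp: mpolys_def mvars_uminus)

lemma mpolys_diff: "p \<in> mpolys V \<Longrightarrow> q \<in> mpolys V \<Longrightarrow> p - q \<in> mpolys V"
  using mpolys_add[of p V "- q"] mpolys_uminus[of q V] by simp

lemma mpolys_sum: "(\<And>a. a \<in> A \<Longrightarrow> g a \<in> mpolys V) \<Longrightarrow> sum g A \<in> mpolys V"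
  by (induction A rule: infinite_finite_induct) (auto intro: mpolys_add)

lemma mpolys_prod: "(\<And>a. a \<in> A \<Longrightarrow> g a \<in> mpolys V) \<Longrightarrow> prod g A \<in> mpolys V"
  by (induction A rule: infinite_finite_induct) (auto intro: mpolys_mult)

lemma mpolys_power: "p \<in> mpolys V \<Longrightarrow> p ^ k \<in> mpolys V"
  by (induction k) (auto intro: mpolys_mult)

lemma mpolys_of_nat: "of_nat k \<in> mpolys V"
  by (induction k) (auto intro: mpolys_add)

lemma mpolys_of_int: "of_int c \<in> mpolys V"
  by (cases c rule: int_cases2) (auto intro: mpolys_of_nat mpolys_uminus)

lemma mpolys_mono: "V \<subseteq> W \<Longrightarrow> mpolys V \<subseteq> mpolys W"
  by (auto simp: mpolys_def)

lemmas mpolys_intros = mpolys_0 mpolys_1 mpolys_mvar mpolys_add mpolys_diff mpolys_uminus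
  mpolys_mult mpolys_sum mpolys_prod mpolys_power mpolys_of_int

lemma meval_in_mpolys:
  assumes "p \<in> mpolys V" "\<And>v. v \<in> V \<Longrightarrow> h v \<in> mpolys W"
  shows "meval h p \<in> mpolys W"
proof -
  have "h v \<in> mpolys W" if "m \<in> Poly_Mapping.keys p" "v \<in> Poly_Mapping.keys m" for m v
    using assms that by (auto simp: mpolys_def mvars_def)
  then show ?thesis
    unfolding meval_def monom_eval_def by (intro mpolys_intros)
qed

text \<open>Denominators are cleared, and a variable is set to zero, by following the construction
  of a polynomial. The steps keep the membership of both operands, since witnesses built from them
  must again be polynomials in \<open>V\<close>.\<close>

lemma mpolys_induct [consumes 1, case_names int var add mult]:
  fixes p :: "'v int_mpoly"
  assumes "p \<in> mpolys V"
    and int: "\<And>c. P (of_int c)" and var: "\<And>v. v \<in> V \<Longrightarrow> P (mvar v)"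
    and add: "\<And>p q. p \<in> mpolys V \<Longrightarrow> q \<in> mpolys V \<Longrightarrow> P p \<Longrightarrow> P q \<Longrightarrow> P (p + q)"
    and mult: "\<And>p q. p \<in> mpolys V \<Longrightarrow> q \<in> mpolys V \<Longrightarrow> P p \<Longrightarrow> P q \<Longrightarrow> P (p * q)"
  shows "P p"
proof -
  let ?Q = "\<lambda>p. p \<in> mpolys V \<and> P p"
  have Q1: "?Q 1" using int[of 1] by auto
  have Q0: "?Q 0" using int[of 0] by auto
  have sum: "?Q (sum g A)" if "\<And>a. a \<in> A \<Longrightarrow> ?Q (g a)" for g :: "('v \<Rightarrow>\<^sub>0 nat) \<Rightarrow> 'v int_mpoly" and A
    using that by (induction A rule: infinite_finite_induct) (auto simp: Q0 intro: add mpolys_add)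
  have prod: "?Q (prod g A)" if "\<And>a. a \<in> A \<Longrightarrow> ?Q (g a)" for g :: "'v \<Rightarrow> 'v int_mpoly" and A
    using that by (induction A rule: infinite_finite_induct) (auto simp: Q1 intro: mult mpolys_mult)
  have pow: "?Q (q ^ k)" if "?Q q" for q k
    using that by (induction k) (auto simp: Q1 intro: mult mpolys_mult)
  have "?Q (of_int (Poly_Mapping.lookup p m) * monom_eval mvar m)" if "m \<in> Poly_Mapping.keys p" for m
  proof -
    have "?Q (mvar v)" if "v \<in> Poly_Mapping.keys m" for v
    proof -
      have "v \<in> V" using assms(1) that \<open>m \<in> _\<close> by (auto simp: mpolys_def mvars_def)
      then show ?thesis by (auto intro: var mpolys_mvar)
    qed
    then have "?Q (monom_eval mvar m)" unfolding monom_eval_def by (intro prod pow)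
    then show ?thesis using int mult mpolys_of_int mpolys_mult by blast
  qed
  then have "?Q (meval mvar p)" unfolding meval_def by (intro sum)
  then show ?thesis by (simp add: meval_mvar_id)
qed

section \<open>Formal partial derivatives\<close>

lemma mpderiv_superset:
  assumes "finite M" "Poly_Mapping.keys p \<subseteq> M"
  shows "mpderiv v p = (\<Sum>m\<in>M. Poly_Mapping.single (m - Poly_Mapping.single v 1)
       (int (Poly_Mapping.lookup m v) * Poly_Mapping.lookup p m))"
  unfolding mpderiv_def
  by (rule sum.mono_neutral_left[OF assms]) (auto simp: in_keys_iff)

lemma mpderiv_add: "mpderiv v (p + q) = mpderiv v p + mpderiv v q"
proof -
  let ?M = "Poly_Mapping.keys p \<union> Poly_Mapping.keys q"
  have M: "finite ?M" by simp
  have "Poly_Mapping.keys (p + q) \<subseteq> ?M" by (rule keys_add)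
  then show ?thesis
    using mpderiv_superset[OF M, of _ v]
    by (simp add: lookup_add distrib_left single_add sum.distrib)
qed

lemma mpderiv_single: "mpderiv v (Poly_Mapping.single m c) =
    Poly_Mapping.single (m - Poly_Mapping.single v 1) (int (Poly_Mapping.lookup m v) * c)"
  using mpderiv_superset[of "{m}" "Poly_Mapping.single m c" v] by simp

lemma mpderiv_sum: "mpderiv v (sum g A) = (\<Sum>a\<in>A. mpderiv v (g a))"
  by (induction A rule: infinite_finite_induct) (simp_all add: mpderiv_add, simp_all add: mpderiv_def)

text \<open>The one-by-one Jacobian of the equation which makes \<open>v\<close> an inverse of
  \<open>F\<close>.\<close>

lemma mpderiv_mvar_mult:
  assumes "v \<notin> mvars F"
  shows "mpderiv v (mvar v * F - 1) = F"
proof -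
  have *: "mpderiv v (mvar v * Poly_Mapping.single m (Poly_Mapping.lookup F m))
    = Poly_Mapping.single m (Poly_Mapping.lookup F m)" if "m \<in> Poly_Mapping.keys F" for m
  proof -
    have "v \<notin> Poly_Mapping.keys m" using assms that by (auto simp: mvars_def)
    then have "Poly_Mapping.lookup m v = 0" by (simp add: in_keys_iff)
    then show ?thesis
      by (simp add: mvar_def mult_single mpderiv_single lookup_add)
  qed
  have 1: "mpderiv v (mvar v * F) = F"
  proof -
    have "mpderiv v (mvar v * (\<Sum>m\<in>Poly_Mapping.keys F. Poly_Mapping.single m (Poly_Mapping.lookup F m)))
      = (\<Sum>m\<in>Poly_Mapping.keys F. Poly_Mapping.single m (Poly_Mapping.lookup F m))"
      by (simp add: sum_distrib_left mpderiv_sum *)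
    then show ?thesis by (simp only: poly_mapping_sum_single)
  qed
  have "mpderiv v (-1) = 0"
    using mpderiv_single[of v 0 "-1"] by (simp add: single_uminus)
  then show ?thesis using 1 mpderiv_add[of v "mvar v * F" "-1"] by simp
qed

section \<open>Heights and triangulations of a polygon\<close>

text \<open>
  The vertices \<open>0, \<dots>, N\<close> carry distinct heights, the side \<open>(0, N)\<close> being the highest. The chords that
  lie above all vertices between their ends form a triangulation \<open>T\<close>. An interior vertex \<open>m\<close> is the
  lowest vertex of exactly one triangle \<open>(lo m, m, hi m)\<close>; \<open>cov c m\<close> says that the chord \<open>c\<close> spans
  the side \<open>(lo m, hi m)\<close>, and \<open>low c\<close> is the lowest vertex of the triangle above \<open>c \<in> T\<close>.
\<close>

locale heights =
  fixes N :: nat and pr :: "nat \<Rightarrow> nat"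
  assumes N3: "3 \<le> N"
    and inj: "inj_on pr {..N}"
    and left_high: "\<And>m. 0 < m \<Longrightarrow> m < N \<Longrightarrow> pr m < pr 0"
    and right_high: "\<And>m. 0 < m \<Longrightarrow> m < N \<Longrightarrow> pr m < pr N"
begin

definition Ch :: "(nat \<times> nat) set" where
  "Ch = {c. fst c + 2 \<le> snd c \<and> snd c \<le> N \<and> c \<noteq> (0, N)}"

definition T :: "(nat \<times> nat) set" where
  "T = {c \<in> Ch. \<forall>m. fst c < m \<and> m < snd c \<longrightarrow> pr m < pr (fst c) \<and> pr m < pr (snd c)}"

definition ins :: "nat \<Rightarrow> nat \<times> nat \<Rightarrow> bool" where
  "ins m c \<longleftrightarrow> fst c < m \<and> m < snd c"

definition lo :: "nat \<Rightarrow> nat" where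
  "lo m = (GREATEST s. s < m \<and> pr m < pr s)"

definition hi :: "nat \<Rightarrow> nat" where
  "hi m = (LEAST s. m < s \<and> s \<le> N \<and> pr m < pr s)"

definition top :: "nat \<Rightarrow> nat \<Rightarrow> nat" where
  "top i j = (ARG_MAX pr t. i \<le> t \<and> t < j)"

definition cov :: "nat \<times> nat \<Rightarrow> nat \<Rightarrow> bool" where
  "cov c t \<longleftrightarrow> (\<exists>s. fst c \<le> s \<and> s < t \<and> pr t < pr s) \<and> (\<exists>s. t < s \<and> s \<le> snd c \<and> pr t < pr s)"

definition low :: "nat \<times> nat \<Rightarrow> nat" where
  "low c = (if pr (fst c) < pr (snd c) then fst c else snd c)"

lemma finite_Ch [simp]: "finite Ch"
  by (rule finite_subset[of _ "{..N} \<times> {..N}"]) (auto simp: Ch_def)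

lemma T_subset_Ch: "T \<subseteq> Ch"
  by (auto simp: T_def)

lemma finite_T [simp]: "finite T"
  by (rule finite_subset[OF T_subset_Ch]) simp

lemma pr_eq_iff: "s \<le> N \<Longrightarrow> t \<le> N \<Longrightarrow> pr s = pr t \<longleftrightarrow> s = t"
  using inj by (auto simp: inj_on_def)

lemma pr_neq: "s \<le> N \<Longrightarrow> t \<le> N \<Longrightarrow> s \<noteq> t \<Longrightarrow> pr s < pr t \<or> pr t < pr s"
  using pr_eq_iff[of s t] by auto

lemma lo_hi:
  assumes "0 < m" "m < N"
  shows "lo m < m" "pr m < pr (lo m)" "m < hi m" "hi m \<le> N" "pr m < pr (hi m)"
    "\<And>s. lo m < s \<Longrightarrow> s < hi m \<Longrightarrow> pr s \<le> pr m"
    "\<And>s. lo m < s \<Longrightarrow> s < hi m \<Longrightarrow> s \<noteq> m \<Longrightarrow> pr s < pr m"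
proof -
  \<comment> \<open>The end vertices \<open>0\<close> and \<open>N\<close> are higher than every
    inner vertex, so the searches to both sides succeed.\<close>
  have lo: "lo m < m \<and> pr m < pr (lo m)"
    unfolding lo_def by (rule GreatestI_nat[of _ 0 m]) (use assms left_high in auto)
  have hi: "m < hi m \<and> hi m \<le> N \<and> pr m < pr (hi m)"
    unfolding hi_def by (rule LeastI[of _ N]) (use assms right_high in auto)
  show "lo m < m" "pr m < pr (lo m)" "m < hi m" "hi m \<le> N" "pr m < pr (hi m)"
    using lo hi by auto
  show le: "pr s \<le> pr m" if s: "lo m < s" "s < hi m" for s
  proof (rule ccontr)
    assume c: "\<not> pr s \<le> pr m"
    consider "s < m" | "s = m" | "m < s" by linarith
    then show False
    proof cases
      case 1
      then have "s \<le> lo m"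
        unfolding lo_def using c by (intro Greatest_le_nat[of _ s m]) auto
      then show False using s by simp
    next
      case 3
      then have "hi m \<le> s"
        unfolding hi_def using c s hi by (intro Least_le) auto
      then show False using s by simp
    qed (use c in auto)
  qed
  show "pr s < pr m" if s: "lo m < s" "s < hi m" "s \<noteq> m" for s
    using le[OF s(1,2)] pr_neq[of s m] s hi assms by fastforce
qed

lemma lo_hi_unique:
  assumes "a < m" "m < b" "b \<le> N" "pr m < pr a" "pr m < pr b"
    and "\<And>s. a < s \<Longrightarrow> s < b \<Longrightarrow> pr s \<le> pr m"
  shows "lo m = a" "hi m = b"
proof -
  have m: "0 < m" "m < N" using assms by auto
  note lh = lo_hi[OF m]
  have "\<not> a < lo m" using assms(6)[of "lo m"] lh(1,2) assms(2) by auto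
  moreover have "\<not> lo m < a" using lh(6)[of a] lh(1,3) assms(1,2,4) by auto
  ultimately show "lo m = a" by simp
  have "\<not> hi m < b" using assms(6)[of "hi m"] lh(3,5) assms(1) by auto
  moreover have "\<not> b < hi m" using lh(6)[of b] lh(1,3) assms(1,2,5) by auto
  ultimately show "hi m = b" by simp
qed

lemma node_in_T:
  assumes "0 < m" "m < N" "(lo m, hi m) \<noteq> (0, N)"
  shows "(lo m, hi m) \<in> T"
proof -
  note lh = lo_hi[OF assms(1,2)]
  show ?thesis using lh assms(3) lh(6)[THEN le_less_trans]
    by (auto simp: T_def Ch_def)
qed

lemma top:
  assumes "i < j"
  shows "i \<le> top i j" "top i j < j" "\<And>m. i \<le> m \<Longrightarrow> m < j \<Longrightarrow> pr m \<le> pr (top i j)"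
proof -
  have fin: "finite {i..<j}" "{i..<j} \<noteq> {}" using assms by auto
  define b where "b = Suc (Max (pr ` {i..<j}))"
  have "\<forall>y. i \<le> y \<and> y < j \<longrightarrow> pr y < b"
    using fin by (auto simp: b_def less_Suc_eq_le)
  then have *: "(i \<le> top i j \<and> top i j < j) \<and> (\<forall>y. i \<le> y \<and> y < j \<longrightarrow> pr y \<le> pr (top i j))"
    unfolding top_def using arg_max_nat_lemma[of "\<lambda>t. i \<le> t \<and> t < j" i pr b] assms by blast
  then show "i \<le> top i j" "top i j < j" "\<And>m. i \<le> m \<Longrightarrow> m < j \<Longrightarrow> pr m \<le> pr (top i j)"
    by blast+
qed

lemma top_eqI:
  assumes "i \<le> t" "t < j" "j \<le> Suc N" "\<And>m. i \<le> m \<Longrightarrow> m < j \<Longrightarrow> m \<noteq> t \<Longrightarrow> pr m < pr t"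
  shows "top i j = t"
  using top[of i j] assms by (metis leD le_less_trans)

text \<open>The ends of a chord of \<open>T\<close> are higher than everything between them, so they
  witness \<open>cov\<close> as soon as \<open>t\<close> lies inside.\<close>

lemma cov_T:
  assumes "c \<in> T"
  shows "cov c t \<longleftrightarrow> ins t c"
  using assms by (fastforce simp: cov_def ins_def T_def)

lemma cov_imp_ins: "cov c t \<Longrightarrow> ins t c"
  by (auto simp: cov_def ins_def)

lemma not_ins_ends [simp]: "\<not> ins 0 c" "c \<in> Ch \<Longrightarrow> \<not> ins N c" "c \<in> T \<Longrightarrow> \<not> ins N c"
  by (auto simp: ins_def Ch_def T_def)

lemma cov_iff:
  assumes "0 < m" "m < N" "c \<in> Ch"
  shows "cov c m \<longleftrightarrow> fst c \<le> lo m \<and> hi m \<le> snd c"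
proof
  note lh = lo_hi[OF assms(1,2)]
  assume "cov c m"
  then obtain s s' where "fst c \<le> s" "s < m" "pr m < pr s" "m < s'" "s' \<le> snd c" "pr m < pr s'"
    by (auto simp: cov_def)
  moreover have "s \<le> lo m" using lh(6)[of s] calculation(2,3) lh(3) by (meson leI le_less_trans less_le_not_le less_trans)
  moreover have "hi m \<le> s'" using lh(6)[of s'] calculation(4,6) lh(1) by (meson leI le_less_trans less_le_not_le less_trans)
  ultimately show "fst c \<le> lo m \<and> hi m \<le> snd c" by auto
next
  assume "fst c \<le> lo m \<and> hi m \<le> snd c"
  then show "cov c m" using lo_hi[OF assms(1,2)] by (auto simp: cov_def)
qed

text \<open>The ends of \<open>c\<close> are higher than the highest vertex of the range, so neither
  of them lies in the range, and \<open>c\<close> contains all of it or nothing.\<close>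

lemma top_ins:
  assumes c: "c \<in> T" and "ins (top i j) c" "i \<le> m" "m < j"
  shows "ins m c"
proof -
  have ij: "i < j" using assms by simp
  note t = top[OF ij]
  have "c \<in> Ch" using c T_subset_Ch by auto
  have e: "pr (top i j) < pr (fst c)" "pr (top i j) < pr (snd c)"
    using c assms(2) by (auto simp: T_def ins_def)
  have "\<not> (i \<le> fst c \<and> fst c < j)" "\<not> (i \<le> snd c \<and> snd c < j)"
    using t(3) e by (meson leD)+
  then show ?thesis using assms(2-4) t(1,2) by (auto simp: ins_def)
qed

text \<open>
  The interval between the vertices \<open>p < q\<close> contains the marked points \<open>p + 1, \<dots>, q\<close>. \<open>Df x i j\<close> is the distance of
  the marked points \<open>i < j\<close> for which every chord \<open>c \<in> T\<close> has \<open>x c\<close> times the length of the side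
  above it; the three pieces \<open>x (lo m, m)\<close>, \<open>Sf x m\<close>, \<open>x (m, hi m)\<close> of that side therefore add up to
  \<open>1\<close>. \<open>Pf x i j\<close> is what remains of \<open>Df x i j\<close> after division by its monomial factor \<open>Wf x (top i j)\<close>.
  Both \<open>0\<close> and \<open>Suc N\<close> stand for the marked point at infinity, whence the value \<open>1\<close>.
\<close>

definition xx :: "(nat \<times> nat \<Rightarrow> 'a) \<Rightarrow> nat \<Rightarrow> nat \<Rightarrow> 'a::comm_ring_1" where
  "xx x p q = (if p + 2 \<le> q then x (p, q) else 0)"

definition Sf :: "(nat \<times> nat \<Rightarrow> 'a) \<Rightarrow> nat \<Rightarrow> 'a::comm_ring_1" where
  "Sf x m = 1 - xx x (lo m) m - xx x m (hi m)"

definition Pf :: "(nat \<times> nat \<Rightarrow> 'a) \<Rightarrow> nat \<Rightarrow> nat \<Rightarrow> 'a::comm_ring_1" where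
  "Pf x i j = (if i = 0 \<or> j = Suc N then 1 else
     (\<Sum>m\<in>{i..<j}. Sf x m * (\<Prod>c\<in>{c\<in>T. ins m c \<and> \<not> ins (top i j) c}. x c)))"

definition Df :: "(nat \<times> nat \<Rightarrow> 'a) \<Rightarrow> nat \<Rightarrow> nat \<Rightarrow> 'a::comm_ring_1" where
  "Df x i j = (if i = 0 \<or> j = Suc N then 1 else
     (\<Sum>m\<in>{i..<j}. Sf x m * (\<Prod>c\<in>{c\<in>T. ins m c}. x c)))"

definition Wf :: "(nat \<times> nat \<Rightarrow> 'a) \<Rightarrow> nat \<Rightarrow> 'a::comm_ring_1" where
  "Wf x t = (\<Prod>c\<in>{c\<in>T. ins t c}. x c)"

lemma Wf_ends [simp]: "Wf x 0 = 1" "Wf x N = 1"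
proof -
  have "{c\<in>T. ins N c} = {}" by auto
  then show "Wf x N = 1" by (simp only: Wf_def prod.empty)
qed (simp add: Wf_def)

text \<open>By \<open>top_ins\<close> the chords of \<open>T\<close> around the highest vertex lie
  around every vertex of the range, so their product is a factor of every summand. When a point is
  at infinity, the highest vertex is \<open>0\<close> or \<open>N\<close> and the monomial is
  empty.\<close>

lemma Df_eq_Wf_Pf:
  assumes "i < j" "j \<le> Suc N" "0 < i \<or> j \<le> N"
  shows "Df x i j = Wf x (top i j) * Pf x i j"
proof (cases "i = 0 \<or> j = Suc N")
  case True
  then have "top i j = 0 \<or> top i j = N"
  proof
    assume "i = 0"
    then show ?thesis using assms left_high by (intro disjI1 top_eqI) auto
  next
    assume "j = Suc N"
    then show ?thesis using assms right_high by (intro disjI2 top_eqI) auto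
  qed
  then have "Wf x (top i j) = 1" by (metis Wf_ends)
  then show ?thesis using True by (auto simp: Df_def Pf_def)
next
  case False
  have "(\<Prod>c\<in>{c\<in>T. ins m c}. x c) =
    (\<Prod>c\<in>{c\<in>T. ins (top i j) c}. x c) * (\<Prod>c\<in>{c\<in>T. ins m c \<and> \<not> ins (top i j) c}. x c)"
    if "m \<in> {i..<j}" for m
  proof -
    have "{c\<in>T. ins m c} = {c\<in>T. ins (top i j) c} \<union> {c\<in>T. ins m c \<and> \<not> ins (top i j) c}"
      using top_ins that by auto
    then show ?thesis by (simp only:) (rule prod.union_disjoint, auto)
  qed
  then show ?thesis
    using False by (simp add: Df_def Pf_def Wf_def sum_distrib_left ac_simps)
qed

lemma Df_add:
  assumes "0 < i" "i \<le> j" "j \<le> k" "k \<le> N"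
  shows "Df x i k = Df x i j + Df x j k"
proof -
  have "{i..<k} = {i..<j} \<union> {j..<k}" using assms by auto
  then show ?thesis using assms by (simp add: Df_def sum.union_disjoint ivl_disj_int)
qed

lemma Df_self [simp]: "0 < i \<Longrightarrow> i \<le> N \<Longrightarrow> Df x i i = 0"
  by (simp add: Df_def)

end

section \<open>Cross-ratios\<close>

text \<open>Each row telescopes, and then the product of the rows does: elementary cross-ratios
  multiply over a rectangle to the cross-ratio of its corners.\<close>

lemma prod_telescope2:
  fixes g :: "nat \<Rightarrow> nat \<Rightarrow> 'a::field"
  assumes "i \<le> j" "k \<le> l" and nz: "\<And>p q. i \<le> p \<Longrightarrow> p \<le> j \<Longrightarrow> k \<le> q \<Longrightarrow> q \<le> l \<Longrightarrow> g p q \<noteq> 0"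
  shows "(\<Prod>p\<in>{i..<j}. \<Prod>q\<in>{k..<l}. g (Suc p) q * g p (Suc q) / (g p q * g (Suc p) (Suc q)))
    = g j k * g i l / (g i k * g j l)"
proof -
  have inner: "(\<Prod>q\<in>{k..<l'}. g (Suc p) q * g p (Suc q) / (g p q * g (Suc p) (Suc q)))
      = g (Suc p) k * g p l' / (g p k * g (Suc p) l')"
    if "i \<le> p" "p < j" "k \<le> l'" "l' \<le> l" for p l'
    using that(3,4)
  proof (induction l' rule: dec_induct)
    case base
    then show ?case using nz[of p k] nz[of "Suc p" k] that by simp
  next
    case (step n)
    then show ?case using nz[of p n] nz[of "Suc p" n] nz[of p "Suc n"] nz[of "Suc p" "Suc n"]
        nz[of p k] nz[of "Suc p" k] that by (simp add: field_simps)
  qed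
  have "(\<Prod>p\<in>{i..<j'}. g (Suc p) k * g p l / (g p k * g (Suc p) l)) = g j' k * g i l / (g i k * g j' l)"
    if "i \<le> j'" "j' \<le> j" for j'
    using that
  proof (induction j' rule: dec_induct)
    case base
    then show ?case using nz[of i k] nz[of i l] assms by simp
  next
    case (step n)
    then show ?case using nz[of n k] nz[of "Suc n" k] nz[of n l] nz[of "Suc n" l] nz[of i k] assms
      by (simp add: field_simps)
  qed
  from this[of j] show ?thesis using assms inner[of _ l] by simp
qed

context heights
begin

section \<open>Lengths of the sides of a triangulation\<close>

lemma ins_T_iff:
  assumes "0 < m" "m < N" "d \<in> T"
  shows "ins m d \<longleftrightarrow> fst d \<le> lo m \<and> hi m \<le> snd d"
proof -
  have "d \<in> Ch" using assms(3) T_subset_Ch by auto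
  from cov_iff[OF assms(1,2) this] show ?thesis using cov_T[OF assms(3), of m] by simp
qed

text \<open>A chord that covers \<open>low c\<close> reaches a higher vertex on each side of it. In
  the direction of \<open>c\<close> the inner vertices of \<open>c\<close> are lower than
  \<open>low c\<close>, so it reaches at least the other end of \<open>c\<close>.\<close>

lemma cov_low_imp:
  assumes c: "c \<in> T" and d: "d \<in> Ch" and cov: "cov d (low c)"
  shows "fst d \<le> fst c \<and> snd c \<le> snd d"
proof -
  have cCh: "c \<in> Ch" using c T_subset_Ch by auto
  obtain s s' where s: "fst d \<le> s" "s < low c" "pr (low c) < pr s"
    "low c < s'" "s' \<le> snd d" "pr (low c) < pr s'"
    using cov by (auto simp: cov_def)
  show ?thesis
  proof (cases "pr (fst c) < pr (snd c)")
    case True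
    then have l: "low c = fst c" by (simp add: low_def)
    have "\<not> s' < snd c" using c s l by (auto simp: T_def dest!: spec[of _ s'])
    then show ?thesis using s l by auto
  next
    case False
    then have l: "low c = snd c" by (simp add: low_def)
    have "\<not> fst c < s" using c s l by (auto simp: T_def dest!: spec[of _ s])
    then show ?thesis using s l by auto
  qed
qed

lemma low_gap:
  assumes "c \<in> T" shows "0 < low c" "low c < N" "low c = fst c \<or> low c = snd c"
    "pr (low c) < pr (fst c) \<or> low c = fst c" "pr (low c) < pr (snd c) \<or> low c = snd c"
proof -
  obtain p q where c: "c = (p, q)" by force
  have *: "p + 2 \<le> q" "q \<le> N" "p \<noteq> 0 \<or> q \<noteq> N"
    using assms T_subset_Ch by (auto simp: c Ch_def)
  have neq: "pr p < pr q \<or> pr q < pr p" using pr_neq[of p q] * by auto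
  show "low c = fst c \<or> low c = snd c"
    "pr (low c) < pr (fst c) \<or> low c = fst c" "pr (low c) < pr (snd c) \<or> low c = snd c"
    using neq by (auto simp: low_def c)
  show "0 < low c"
  proof (rule ccontr)
    assume "\<not> 0 < low c"
    then have "p = 0" "pr p < pr q" using * by (auto simp: low_def c split: if_splits)
    then show False using left_high[of q] * by auto
  qed
  show "low c < N"
  proof (rule ccontr)
    assume "\<not> low c < N"
    then have "q = N" "\<not> pr p < pr q" using * by (auto simp: low_def c split: if_splits)
    then show False using right_high[of p] * by auto
  qed
qed

text \<open>The triangles with lowest vertices \<open>m\<close> and \<open>low c\<close> lie on the
  two sides of \<open>c\<close>, so passing from one to the other loses only \<open>c\<close>.
  Indeed, a longer chord of \<open>T\<close> that shares the end \<open>low c\<close> with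
  \<open>c\<close> would have the other, higher end of \<open>c\<close> strictly inside and would
  have to lie above it.\<close>

lemma ins_node_iff:
  assumes c: "c \<in> T" and d: "d \<in> T" and m: "0 < m" "m < N" "lo m = fst c" "hi m = snd c"
  shows "ins m d \<longleftrightarrow> d = c \<or> ins (low c) d"
proof -
  have dCh: "d \<in> Ch" using d T_subset_Ch by auto
  have *: "ins m d \<longleftrightarrow> fst d \<le> fst c \<and> snd c \<le> snd d"
    using ins_T_iff[OF m(1,2) d] m by simp
  show ?thesis
  proof
    assume "ins m d"
    with * have le: "fst d \<le> fst c" "snd c \<le> snd d" by auto
    show "d = c \<or> ins (low c) d"
    proof (rule disjCI)
      assume ni: "\<not> ins (low c) d"
      have c12: "fst c < snd c" using c by (auto simp: T_def Ch_def)
      show "d = c"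
      proof (cases "low c = fst c")
        case True
        then have eq: "fst d = fst c" using ni le c12 by (auto simp: ins_def)
        have "pr (snd c) \<le> pr (fst c) \<Longrightarrow> False"
          using True low_gap(5)[OF c] c12 by auto
        moreover have "snd c < snd d \<Longrightarrow> pr (snd c) < pr (fst c)"
          using d c12 eq by (auto simp: T_def)
        ultimately have "snd d = snd c" using le by force
        then show ?thesis using eq by (simp add: prod_eq_iff)
      next
        case False
        then have l: "low c = snd c" using low_gap(3)[OF c] by simp
        then have eq: "snd d = snd c" using ni le c12 by (auto simp: ins_def)
        have "pr (fst c) \<le> pr (snd c) \<Longrightarrow> False"
          using l low_gap(4)[OF c] c12 by auto
        moreover have "fst d < fst c \<Longrightarrow> pr (fst c) < pr (snd c)"
          using d c12 eq by (auto simp: T_def)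
        ultimately have "fst d = fst c" using le by force
        then show ?thesis using eq by (simp add: prod_eq_iff)
      qed
    qed
  next
    assume "d = c \<or> ins (low c) d"
    then show "ins m d"
      using * cov_low_imp[OF c dCh] cov_T[OF d, of "low c"] by auto
  qed
qed

lemma not_ins_low [simp]: "c \<in> T \<Longrightarrow> \<not> ins (low c) c"
  using low_gap(3)[of c] by (auto simp: ins_def)

lemma Wf_node:
  assumes "c \<in> T" "0 < m" "m < N" "lo m = fst c" "hi m = snd c"
  shows "Wf x m = x c * Wf x (low c)"
proof -
  have "{d\<in>T. ins m d} = insert c {d\<in>T. ins (low c) d}"
    using ins_node_iff[OF assms(1) _ assms(2-5)] assms(1) by blast
  then show ?thesis using assms(1) by (simp add: Wf_def)
qed

text \<open>Induction on the width: the highest inner vertex \<open>m\<close> cuts the interval into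
  two shorter ones and the gap at \<open>m\<close>, and \<open>Sf x m\<close> is what these two
  leave of \<open>1\<close>. For the side \<open>(0, N)\<close> the monomial is empty, so lengths
  are normalised by \<open>Df x 1 N = 1\<close>.\<close>

lemma Df_node:
  assumes "p + 2 \<le> q" "q \<le> N" "\<And>m. p < m \<Longrightarrow> m < q \<Longrightarrow> pr m < pr p \<and> pr m < pr q"
  shows "Df x (Suc p) q = Wf x (top (Suc p) q)"
  using assms
proof (induction "q - p" arbitrary: p q rule: less_induct)
  case (less p q)
  define m where "m = top (Suc p) q"
  have m: "p < m" "m < q" and mx: "\<And>s. p < s \<Longrightarrow> s < q \<Longrightarrow> pr s \<le> pr m"
    using top[of "Suc p" q] less.prems by (auto simp: m_def)
  have mlt: "pr s < pr m" if "p < s" "s < q" "s \<noteq> m" for s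
    using mx[of s] pr_eq_iff[of s m] that m less.prems(2) by simp
  have lh: "lo m = p" "hi m = q"
    using lo_hi_unique[OF m less.prems(2) _ _ mx] less.prems(3)[OF m] by auto
  have side: "Df x (Suc a) b = x (a, b) * Wf x m"
    if ab: "a + 2 \<le> b" "b \<le> N" "b - a < q - p" "low (a, b) = m" "(a, b) \<noteq> (0, N)"
      and below: "\<And>s. a < s \<Longrightarrow> s < b \<Longrightarrow> pr s < pr a \<and> pr s < pr b" for a b
  proof -
    define t where "t = top (Suc a) b"
    have t: "a < t" "t < b" and tx: "\<And>s. a < s \<Longrightarrow> s < b \<Longrightarrow> pr s \<le> pr t"
      using top[of "Suc a" b] ab(1) by (auto simp: t_def)
    have "lo t = a" "hi t = b"
      using lo_hi_unique[OF t ab(2) _ _ tx] below[OF t] by auto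
    moreover have "(a, b) \<in> T" using ab(1,2,5) below by (simp add: T_def Ch_def)
    ultimately have "Wf x t = x (a, b) * Wf x (low (a, b))"
      using t ab(2) by (intro Wf_node) auto
    moreover have "Df x (Suc a) b = Wf x t"
      unfolding t_def using ab(1,2,3) below by (intro less.hyps) auto
    ultimately show ?thesis by (simp add: ab(4))
  qed
  have L: "Df x (Suc p) m = xx x p m * Wf x m"
  proof (cases "p + 2 \<le> m")
    case True
    have "Df x (Suc p) m = x (p, m) * Wf x m"
    proof (rule side)
      show "low (p, m) = m" using less.prems(3)[OF m] by (simp add: low_def)
      show "pr s < pr p \<and> pr s < pr m" if "p < s" "s < m" for s
        using that m less.prems(3)[of s] mlt[of s] by simp
    qed (use True m less.prems(2) in auto)
    then show ?thesis using True by (simp add: xx_def)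
  next
    case False
    \<comment> \<open>The interval \<open>(p, m)\<close> holds a single marked point and has length
      \<open>0\<close>, the default value of \<open>xx\<close>.\<close>
    then have "m = Suc p" using m by auto
    then show ?thesis using m less.prems(2) by (simp add: xx_def)
  qed
  have R: "Df x (Suc m) q = xx x m q * Wf x m"
  proof (cases "m + 2 \<le> q")
    case True
    have "Df x (Suc m) q = x (m, q) * Wf x m"
    proof (rule side)
      show "low (m, q) = m" using less.prems(3)[OF m] by (simp add: low_def)
      show "pr s < pr m \<and> pr s < pr q" if "m < s" "s < q" for s
        using that m less.prems(3)[of s] mlt[of s] by simp
    qed (use True m less.prems(2) in auto)
    then show ?thesis using True by (simp add: xx_def)
  next
    case False
    then have "q = Suc m" using m by auto
    then show ?thesis using m less.prems(2) by (simp add: xx_def)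
  qed
  have "Df x (Suc p) q = Df x (Suc p) m + (Df x m (Suc m) + Df x (Suc m) q)"
    using Df_add[of "Suc p" m q x] Df_add[of m "Suc m" q x] m less.prems(2) by simp
  also have "Df x m (Suc m) = Sf x m * Wf x m"
    using m less.prems(2) by (simp add: Df_def Wf_def)
  also have "Df x (Suc p) m + (Sf x m * Wf x m + Df x (Suc m) q) = Wf x m"
    unfolding L R Sf_def lh by (simp only: left_diff_distrib) simp
  finally show ?case by (simp add: m_def)
qed

text \<open>Only the order of the heights of \<open>p\<close>, \<open>q\<close> and the highest
  vertex \<open>t\<close> between them matters. If \<open>t\<close> exceeds one of the ends, the
  four maxima agree in pairs; otherwise \<open>(p, q)\<close> belongs to \<open>T\<close>, and in
  the place of \<open>t\<close> its lower end appears.\<close>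

lemma top_split:
  assumes "(p, q) \<in> Ch"
  obtains (crossed) "(p, q) \<notin> T"
      "top p q = top (Suc p) q \<and> top (Suc p) (Suc q) = top p (Suc q)
        \<or> top p q = top p (Suc q) \<and> top (Suc p) (Suc q) = top (Suc p) q"
    | (node) "(p, q) \<in> T" "lo (top (Suc p) q) = p" "hi (top (Suc p) q) = q"
      "top p q = low (p, q) \<and> top (Suc p) (Suc q) = top p (Suc q)
        \<or> top p q = top p (Suc q) \<and> top (Suc p) (Suc q) = low (p, q)"
proof -
  have pq: "p + 2 \<le> q" "q \<le> N" using assms by (auto simp: Ch_def)
  define t where "t = top (Suc p) q"
  have t: "p < t" "t < q" and tm: "\<And>m. p < m \<Longrightarrow> m < q \<Longrightarrow> pr m \<le> pr t"
    using top[of "Suc p" q] pq by (auto simp: t_def)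
  have tm': "pr m < pr t" if "p < m" "m < q" "m \<noteq> t" for m
    using tm[of m] pr_eq_iff[of m t] that t pq by simp
  have neq: "pr p < pr t \<or> pr t < pr p" "pr q < pr t \<or> pr t < pr q" "pr p < pr q \<or> pr q < pr p"
    using pr_neq[of p t] pr_neq[of q t] pr_neq[of p q] t pq by auto
  have dis: "m = p \<or> m = q \<or> m = t \<or> pr m < pr t" if "p \<le> m" "m \<le> q" for m
    using tm'[of m] that by linarith
  have t1: "top p q = (if pr p < pr t then t else p)"
  proof (rule top_eqI)
    fix m assume m: "p \<le> m" "m < q" "m \<noteq> (if pr p < pr t then t else p)"
    show "pr m < pr (if pr p < pr t then t else p)"
      using dis[of m] m neq by (auto split: if_splits)
  qed (use t pq in auto)
  have t2: "top (Suc p) (Suc q) = (if pr q < pr t then t else q)"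
  proof (rule top_eqI)
    fix m assume m: "Suc p \<le> m" "m < Suc q" "m \<noteq> (if pr q < pr t then t else q)"
    show "pr m < pr (if pr q < pr t then t else q)"
      using dis[of m] m neq by (auto split: if_splits)
  qed (use t pq in auto)
  have t4: "top p (Suc q) = (if pr p < pr t \<and> pr q < pr t then t else if pr p < pr q then q else p)"
    (is "_ = ?t")
  proof (rule top_eqI)
    fix m assume m: "p \<le> m" "m < Suc q" "m \<noteq> ?t"
    show "pr m < pr ?t"
      using dis[of m] m neq by (auto split: if_splits)
  qed (use t pq in auto)
  show thesis
  proof (cases "pr t < pr p \<and> pr t < pr q")
    case True
    have "(p, q) \<in> T" using True assms tm by (auto simp: T_def intro: le_less_trans)
    moreover have "lo t = p" "hi t = q" using lo_hi_unique[OF t pq(2) _ _ tm] True by auto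
    ultimately show thesis
      using True t1 t2 t4 node unfolding t_def[symmetric] low_def by auto
  next
    case False
    then have "(p, q) \<notin> T" using t by (auto simp: T_def)
    then show thesis using False neq t1 t2 t4 crossed unfolding t_def[symmetric] by auto
  qed
qed

lemma Df_ends [simp]: "Df x 0 j = 1" "Df x i (Suc N) = 1"
  by (simp_all add: Df_def)

text \<open>The cross-ratio after cancellation of all monomials, see \<open>Uf_cross_ratio\<close>.
  In this form every factor except \<open>x c\<close> is a value of \<open>Pf\<close> or an inverse
  of one.\<close>

definition Uf :: "(nat \<times> nat \<Rightarrow> 'a::field) \<Rightarrow> nat \<times> nat \<Rightarrow> 'a" where
  "Uf x c = (if c \<in> T then x c else 1) * Pf x (Suc (fst c)) (snd c) * Pf x (fst c) (Suc (snd c))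
     / (Pf x (fst c) (snd c) * Pf x (Suc (fst c)) (Suc (snd c)))"

text \<open>The leading monomials of numerator and denominator of a cross-ratio cancel, except for
  one factor \<open>x (p, q)\<close> when the chord belongs to \<open>T\<close>. This is why exactly
  the coordinates of \<open>T\<close> can vanish on the chart.\<close>

lemma Wf_split:
  assumes "(p, q) \<in> Ch"
  shows "Wf x (top (Suc p) q) * Wf x (top p (Suc q))
    = (if (p, q) \<in> T then x (p, q) else 1) * (Wf x (top p q) * Wf x (top (Suc p) (Suc q)))"
  using assms
proof (cases rule: top_split)
  case node
  have "p + 2 \<le> q" "q \<le> N" using assms by (auto simp: Ch_def)
  then have "Wf x (top (Suc p) q) = x (p, q) * Wf x (low (p, q))"
    using node top[of "Suc p" q] by (intro Wf_node) auto
  then show ?thesis using node by auto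
qed (auto simp: mult.commute)

end

section \<open>Cross-ratios of points with nonzero distances\<close>

locale heights_field = heights +
  fixes x :: "nat \<times> nat \<Rightarrow> 'a::field"
  assumes x_nz: "\<And>c. c \<in> T \<Longrightarrow> x c \<noteq> 0"
    and P_nz: "\<And>i j. 0 < i \<Longrightarrow> i < j \<Longrightarrow> j \<le> N \<Longrightarrow> Pf x i j \<noteq> 0"
begin

lemma Pf_nz: "i < j \<Longrightarrow> j \<le> Suc N \<Longrightarrow> Pf x i j \<noteq> 0"
  using P_nz[of i j] by (cases "i = 0 \<or> j = Suc N") (auto simp: Pf_def)

lemma Wf_nz: "Wf x t \<noteq> 0"
  by (auto simp: Wf_def x_nz)

lemma Df_nz: "i < j \<Longrightarrow> j \<le> Suc N \<Longrightarrow> Df x i j \<noteq> 0"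
  using Df_eq_Wf_Pf[of i j x] Wf_nz Pf_nz[of i j] by (cases "0 < i \<or> j \<le> N") (auto simp: Df_def)

lemma Uf_cross_ratio:
  assumes "(p, q) \<in> Ch"
  shows "Uf x (p, q) = Df x (Suc p) q * Df x p (Suc q) / (Df x p q * Df x (Suc p) (Suc q))"
proof -
  have pq: "p + 2 \<le> q" "q \<le> N" "0 < p \<or> Suc q \<le> N" using assms by (auto simp: Ch_def)
  let ?w = "Wf x (top p q) * Wf x (top (Suc p) (Suc q))"
  have w: "?w \<noteq> 0" by (simp add: Wf_nz)
  have "Df x (Suc p) q * Df x p (Suc q)
      = (Wf x (top (Suc p) q) * Wf x (top p (Suc q))) * (Pf x (Suc p) q * Pf x p (Suc q))"
    using pq Df_eq_Wf_Pf[of "Suc p" q x] Df_eq_Wf_Pf[of p "Suc q" x] by (simp add: mult_ac)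
  also have "\<dots> = ?w * ((if (p, q) \<in> T then x (p, q) else 1) * (Pf x (Suc p) q * Pf x p (Suc q)))"
    unfolding Wf_split[OF assms] by (simp only: ac_simps)
  finally have 1: "Df x (Suc p) q * Df x p (Suc q) = \<dots>" .
  have 2: "Df x p q * Df x (Suc p) (Suc q) = ?w * (Pf x p q * Pf x (Suc p) (Suc q))"
    using pq Df_eq_Wf_Pf[of p q x] Df_eq_Wf_Pf[of "Suc p" "Suc q" x] by (simp add: mult_ac)
  show ?thesis unfolding 1 2 using w by (simp add: Uf_def)
qed

text \<open>The last assumption keeps the pair \<open>(0, N)\<close>, which is not a chord, out of a
  nonempty rectangle.\<close>

lemma prod_Uf:
  assumes "i \<le> j" "k \<le> l" "l \<le> Suc N" "j < k" "i = j \<or> k = l \<or> 0 < i \<or> l \<le> N"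
  shows "(\<Prod>p\<in>{i..<j}. \<Prod>q\<in>{k..<l}. Uf x (p, q)) = Df x j k * Df x i l / (Df x i k * Df x j l)"
proof (cases "i = j \<or> k = l")
  case True
  then show ?thesis using assms Df_nz[of j k] Df_nz[of j l] Df_nz[of i k] by auto
next
  case False
  have "(\<Prod>p\<in>{i..<j}. \<Prod>q\<in>{k..<l}. Uf x (p, q)) =
    (\<Prod>p\<in>{i..<j}. \<Prod>q\<in>{k..<l}.
       Df x (Suc p) q * Df x p (Suc q) / (Df x p q * Df x (Suc p) (Suc q)))"
    using assms False by (intro prod.cong refl Uf_cross_ratio) (auto simp: Ch_def)
  also have "\<dots> = Df x j k * Df x i l / (Df x i k * Df x j l)"
    using assms Df_nz by (intro prod_telescope2) auto
  finally show ?thesis .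
qed

text \<open>The products are the two complementary cross-ratios of the points
  \<open>i, j, k, l\<close>; without denominators the relation is the Pluecker identity for points
  on a line. For \<open>i = 0\<close>, the point at infinity, it degenerates to additivity of
  distances.\<close>

lemma Uf_relation:
  assumes "i < j" "j < k" "k < l" "l \<le> N"
  shows "(\<Prod>p\<in>{i..<j}. \<Prod>q\<in>{k..<l}. Uf x (p, q))
    + (\<Prod>p\<in>{j..<k}. \<Prod>q\<in>{l..<Suc N}. Uf x (p, q)) * (\<Prod>p\<in>{0..<i}. \<Prod>q\<in>{j..<k}. Uf x (p, q)) = 1"
proof -
  have 1: "(\<Prod>p\<in>{i..<j}. \<Prod>q\<in>{k..<l}. Uf x (p, q)) = Df x j k * Df x i l / (Df x i k * Df x j l)"
    using assms by (intro prod_Uf) auto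
  have 2: "(\<Prod>p\<in>{j..<k}. \<Prod>q\<in>{l..<Suc N}. Uf x (p, q)) = Df x k l / Df x j l"
    using assms prod_Uf[of j k l "Suc N"] by simp
  have 3: "(\<Prod>p\<in>{0..<i}. \<Prod>q\<in>{j..<k}. Uf x (p, q)) = Df x i j / Df x i k"
    using assms prod_Uf[of 0 i j k] by simp
  have nz: "Df x i k \<noteq> 0" "Df x j l \<noteq> 0" using Df_nz assms by auto
  have "Df x j k * Df x i l + Df x k l * Df x i j = Df x i k * Df x j l"
  proof (cases "i = 0")
    case True
    then show ?thesis using assms Df_add[of j k l x] by simp
  next
    case False
    then show ?thesis
      using assms Df_add[of i j l x] Df_add[of i j k x] Df_add[of j k l x] by (simp add: algebra_simps)
  qed
  then show ?thesis unfolding 1 2 3 using nz by (simp add: field_simps)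
qed

end

context heights
begin

text \<open>The length of \<open>c\<close> relative to the side above it, expressed by cross-ratios; see \<open>xi_Uf\<close>.\<close>

definition xi :: "(nat \<times> nat \<Rightarrow> 'a::comm_ring_1) \<Rightarrow> nat \<times> nat \<Rightarrow> 'a" where
  "xi u c = (\<Prod>d\<in>{d\<in>Ch. fst d \<le> fst c \<and> snd c \<le> snd d \<and> \<not> cov d (low c)}. u d)"

end

context heights_field
begin

text \<open>The rectangle of all pairs around the interval lacks its corner \<open>(0, N)\<close>.
  Two smaller rectangles are telescoped instead, and the distance \<open>Df x (Suc p) N\<close>
  cancels between them.\<close>

lemma prod_Uf_above:
  assumes "p + 2 \<le> q" "q \<le> N"
  shows "(\<Prod>d\<in>{d\<in>Ch. fst d \<le> p \<and> q \<le> snd d}. Uf x d) = Df x (Suc p) q / Df x 1 N"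
proof -
  have "{d\<in>Ch. fst d \<le> p \<and> q \<le> snd d} = ({0..<Suc p} \<times> {q..<N}) \<union> ({1..<Suc p} \<times> {N..<Suc N})"
    using assms by (auto simp: Ch_def)
  moreover have "({0..<Suc p} \<times> {q..<N}) \<inter> ({1..<Suc p} \<times> {N..<Suc N}) = {}" by auto
  moreover have rect: "prod (Uf x) (A \<times> B) = (\<Prod>p\<in>A. \<Prod>q\<in>B. Uf x (p, q))" for A B :: "nat set"
    using prod.cartesian_product[of "\<lambda>p q. Uf x (p, q)" B A] by (simp add: case_prod_eta)
  ultimately have "(\<Prod>d\<in>{d\<in>Ch. fst d \<le> p \<and> q \<le> snd d}. Uf x d)
    = (\<Prod>p\<in>{0..<Suc p}. \<Prod>q\<in>{q..<N}. Uf x (p, q)) * (\<Prod>p\<in>{1..<Suc p}. \<Prod>q\<in>{N..<Suc N}. Uf x (p, q))"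
    by (simp only: rect prod.union_disjoint finite_cartesian_product finite_atLeastLessThan)
  also have "(\<Prod>p\<in>{0..<Suc p}. \<Prod>q\<in>{q..<N}. Uf x (p, q)) = Df x (Suc p) q / Df x (Suc p) N"
    by (subst prod_Uf) (use assms in simp_all)
  also have "(\<Prod>p\<in>{1..<Suc p}. \<Prod>q\<in>{N..<Suc N}. Uf x (p, q)) = Df x (Suc p) N / Df x 1 N"
    by (subst prod_Uf) (use assms in simp_all)
  finally show ?thesis using Df_nz[of "Suc p" N] assms by simp
qed

text \<open>\<open>xi\<close> is a quotient of two products as in \<open>prod_Uf_above\<close>, one
  for \<open>c\<close> and one for the side above it, hence the ratio of their lengths. By
  \<open>Df_node\<close> both lengths are monomials, and by \<open>Wf_node\<close> these differ by
  the factor \<open>x c\<close>.\<close>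

lemma xi_Uf:
  assumes c: "c \<in> T"
  shows "xi (Uf x) c = x c"
proof -
  obtain p q where pq: "c = (p, q)" by force
  have cCh: "c \<in> Ch" using c T_subset_Ch by auto
  have le: "p + 2 \<le> q" "q \<le> N" using cCh by (auto simp: pq Ch_def)
  define s where "s = low c"
  have s: "0 < s" "s < N" using low_gap[OF c] by (auto simp: s_def)
  note lh = lo_hi[OF s]
  let ?A = "{d\<in>Ch. fst d \<le> p \<and> q \<le> snd d}"
  let ?B = "{d\<in>Ch. fst d \<le> lo s \<and> hi s \<le> snd d}"
  have A: "?A = {d\<in>Ch. fst d \<le> p \<and> q \<le> snd d \<and> \<not> cov d s} \<union> ?B"
    using cov_low_imp[OF c] cov_iff[OF s] by (auto simp: s_def pq)
  have "prod (Uf x) ?A = xi (Uf x) c * prod (Uf x) ?B"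
    unfolding A xi_def pq fst_conv snd_conv s_def[symmetric, unfolded pq]
    using cov_iff[OF s] by (intro prod.union_disjoint) auto
  moreover have "prod (Uf x) ?A = Df x (Suc p) q / Df x 1 N"
    using le by (intro prod_Uf_above)
  moreover have "prod (Uf x) ?B = Df x (Suc (lo s)) (hi s) / Df x 1 N"
    using lh by (intro prod_Uf_above) auto
  ultimately have *: "Df x (Suc p) q = xi (Uf x) c * Df x (Suc (lo s)) (hi s)"
    using Df_nz[of 1 N] N3 by (simp add: field_simps)
  define m where "m = top (Suc p) q"
  have m: "0 < m" "m < N" "lo m = fst c" "hi m = snd c"
    using cCh[unfolded pq] top[of "Suc p" q] le c by (auto simp: m_def pq elim!: top_split)
  have 1: "Df x (Suc p) q = Wf x m"
    unfolding m_def using le c by (intro Df_node) (auto simp: T_def pq)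
  have "top (Suc (lo s)) (hi s) = s"
    using lh by (intro top_eqI) auto
  moreover have "Df x (Suc (lo s)) (hi s) = Wf x (top (Suc (lo s)) (hi s))"
    using lh by (intro Df_node) (auto intro: le_less_trans)
  ultimately have 2: "Df x (Suc (lo s)) (hi s) = Wf x s" by simp
  have "x c * Wf x s = xi (Uf x) c * Wf x s"
    using *[unfolded 1 2] Wf_node[OF c m, of x] by (simp add: s_def[symmetric])
  then show ?thesis using Wf_nz by simp
qed

end

section \<open>The coordinates as monomials in the cross-ratios\<close>

text \<open>Ideals of a whole type, so that congruences are calculated without membership
  conditions; \<open>class_ideal_retract\<close> links them to ideals of
  \<open>int_poly_ring V\<close>.\<close>

locale class_ideal =
  fixes J :: "'a::comm_ring_1 set"
  assumes zero: "0 \<in> J"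
    and add: "a \<in> J \<Longrightarrow> b \<in> J \<Longrightarrow> a + b \<in> J"
    and mult: "a \<in> J \<Longrightarrow> r * a \<in> J"
begin

definition eqJ :: "'a \<Rightarrow> 'a \<Rightarrow> bool" (infix \<open>\<doteq>\<close> 50) where
  "a \<doteq> b \<longleftrightarrow> a - b \<in> J"

lemma uminus: "a \<in> J \<Longrightarrow> - a \<in> J"
  using mult[of a "-1"] by simp

lemma eqJ_refl [simp, intro]: "a \<doteq> a"
  by (simp add: eqJ_def zero)

lemma eqJ_sym: "a \<doteq> b \<Longrightarrow> b \<doteq> a"
  using uminus[of "a - b"] by (simp add: eqJ_def)

lemma eqJ_trans [trans]: "a \<doteq> b \<Longrightarrow> b \<doteq> c \<Longrightarrow> a \<doteq> c"
  using add[of "a - b" "b - c"] by (simp add: eqJ_def)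

lemma eqJ_add: "a \<doteq> b \<Longrightarrow> c \<doteq> d \<Longrightarrow> a + c \<doteq> b + d"
  using add[of "a - b" "c - d"] by (simp add: eqJ_def algebra_simps)

lemma eqJ_uminus: "a \<doteq> b \<Longrightarrow> - a \<doteq> - b"
  using uminus[of "a - b"] by (simp add: eqJ_def algebra_simps)

lemma eqJ_diff: "a \<doteq> b \<Longrightarrow> c \<doteq> d \<Longrightarrow> a - c \<doteq> b - d"
  using eqJ_add[of a b "- c" "- d"] eqJ_uminus[of c d] by simp

lemma eqJ_mult: "a \<doteq> b \<Longrightarrow> c \<doteq> d \<Longrightarrow> a * c \<doteq> b * d"
  using add[OF mult[of "a - b" c] mult[of "c - d" b]] by (simp add: eqJ_def algebra_simps)

lemma eqJ_sum: "(\<And>x. x \<in> A \<Longrightarrow> f x \<doteq> g x) \<Longrightarrow> sum f A \<doteq> sum g A"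
  by (induction A rule: infinite_finite_induct) (auto intro: eqJ_add)

end

text \<open>The relations with a cut at infinity: the distances of \<open>i, j\<close> and of
  \<open>j, k\<close>, divided by that of \<open>i, k\<close>, add up to \<open>1\<close>.\<close>

locale heights_rel = heights + class_ideal J for J :: "'a::comm_ring_1 set" +
  fixes u :: "nat \<times> nat \<Rightarrow> 'a"
  assumes rel: "\<And>i j k. 0 < i \<Longrightarrow> i < j \<Longrightarrow> j < k \<Longrightarrow> k \<le> N \<Longrightarrow>
      (\<Prod>p\<in>{0..<i}. \<Prod>q\<in>{j..<k}. u (p, q)) + (\<Prod>p\<in>{i..<j}. \<Prod>q\<in>{k..<Suc N}. u (p, q)) - 1 \<in> J"
begin

text \<open>The distance of \<open>i\<close> and \<open>j\<close> relative to the side \<open>(lo t, hi t)\<close>.\<close>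

definition Dv :: "nat \<Rightarrow> nat \<Rightarrow> nat \<Rightarrow> 'a" where
  "Dv t i j = (if i < j then \<Prod>d\<in>{d\<in>Ch. fst d < i \<and> j \<le> snd d \<and> \<not> cov d t}. u d else 0)"

lemma prod_rect: "(\<Prod>p\<in>A. \<Prod>q\<in>B. u (p, q)) = prod u (A \<times> B)"
  using prod.cartesian_product[of "\<lambda>p q. u (p, q)" B A] by (simp add: case_prod_eta)

text \<open>Shrinking the range \<open>i, k\<close> to \<open>i, j\<close> or to \<open>j, k\<close>
  adds one rectangle of chords, and these rectangles are the two sides of a relation. None of the
  added chords covers \<open>t\<close>, because one of its ends lies strictly between
  \<open>lo t\<close> and \<open>hi t\<close>.\<close>

lemma Dv_add:
  assumes t: "0 < t" "t < N" and ijk: "lo t < i" "i \<le> j" "j \<le> k" "k \<le> hi t"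
  shows "Dv t i k \<doteq> Dv t i j + Dv t j k"
proof (cases "i < j \<and> j < k")
  case True
  note lh = lo_hi[OF t]
  have kN: "k \<le> N" using ijk lh by simp
  let ?C = "{d\<in>Ch. fst d < i \<and> k \<le> snd d \<and> \<not> cov d t}"
  have 1: "{d\<in>Ch. fst d < i \<and> j \<le> snd d \<and> \<not> cov d t} = ?C \<union> ({0..<i} \<times> {j..<k})"
    using True kN cov_iff[OF t] ijk by (auto simp: Ch_def)
  have 2: "{d\<in>Ch. fst d < j \<and> k \<le> snd d \<and> \<not> cov d t} = ?C \<union> ({i..<j} \<times> {k..<Suc N})"
    using True kN cov_iff[OF t] ijk by (auto simp: Ch_def)
  have "Dv t i j = Dv t i k * prod u ({0..<i} \<times> {j..<k})"
    using True unfolding Dv_def 1 by (simp, intro prod.union_disjoint) auto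
  moreover have "Dv t j k = Dv t i k * prod u ({i..<j} \<times> {k..<Suc N})"
    using True unfolding Dv_def 2 by (simp, intro prod.union_disjoint) auto
  ultimately have "Dv t i j + Dv t j k
      = Dv t i k * (prod u ({0..<i} \<times> {j..<k}) + prod u ({i..<j} \<times> {k..<Suc N}))"
    by (simp only: distrib_left)
  moreover have "prod u ({0..<i} \<times> {j..<k}) + prod u ({i..<j} \<times> {k..<Suc N}) \<doteq> 1"
    using rel[of i j k] True ijk kN unfolding prod_rect eqJ_def by auto
  ultimately have "Dv t i j + Dv t j k \<doteq> Dv t i k * 1"
    by (metis eqJ_mult eqJ_refl)
  then show ?thesis by (simp add: eqJ_sym)
next
  case False
  then have "i = j \<or> j = k" using ijk by auto
  then show ?thesis by (auto simp: Dv_def)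
qed

lemma Dv_node:
  assumes t: "0 < t" "t < N"
  shows "Dv t (Suc (lo t)) (hi t) = 1"
proof -
  have "{d\<in>Ch. fst d < Suc (lo t) \<and> hi t \<le> snd d \<and> \<not> cov d t} = {}"
    using cov_iff[OF t] by auto
  moreover have "Suc (lo t) < hi t" using lo_hi[OF t] by auto
  ultimately show ?thesis by (simp only: Dv_def prod.empty if_True)
qed

lemma xx_left:
  assumes m: "0 < m" "m < N"
  shows "xx (xi u) (lo m) m = Dv m (Suc (lo m)) m"
proof (cases "lo m + 2 \<le> m")
  case True
  note lh = lo_hi[OF m]
  have "low (lo m, m) = m" using lh by (simp add: low_def)
  then show ?thesis using True by (auto simp: xx_def Dv_def xi_def less_Suc_eq_le intro!: prod.cong)
next
  case False
  then have "m \<le> Suc (lo m)" by simp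
  then show ?thesis by (simp add: xx_def Dv_def)
qed

lemma xx_right:
  assumes m: "0 < m" "m < N"
  shows "xx (xi u) m (hi m) = Dv m (Suc m) (hi m)"
proof (cases "m + 2 \<le> hi m")
  case True
  note lh = lo_hi[OF m]
  have "low (m, hi m) = m" using lh by (simp add: low_def)
  then show ?thesis using True by (auto simp: xx_def Dv_def xi_def less_Suc_eq_le intro!: prod.cong)
next
  case False
  then have "hi m \<le> Suc m" by simp
  then show ?thesis by (simp add: xx_def Dv_def)
qed

text \<open>The side \<open>(lo m, hi m)\<close> has relative length \<open>1\<close> and is cut
  into three pieces, of which \<open>xi\<close> measures the two outer ones. Thus \<open>Sf\<close>,
  a difference by definition, becomes a monomial modulo \<open>J\<close>.\<close>

lemma Sf_xi:
  assumes m: "0 < m" "m < N"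
  shows "Sf (xi u) m \<doteq> Dv m m (Suc m)"
proof -
  note lh = lo_hi[OF m]
  have "1 \<doteq> Dv m (Suc (lo m)) m + Dv m m (hi m)"
    using Dv_add[OF m, of "Suc (lo m)" m "hi m"] lh by (simp add: Dv_node[OF m])
  also have "\<dots> \<doteq> Dv m (Suc (lo m)) m + (Dv m m (Suc m) + Dv m (Suc m) (hi m))"
    using Dv_add[OF m, of m "Suc m" "hi m"] lh by (intro eqJ_add) auto
  finally have "1 - (Dv m (Suc (lo m)) m + Dv m (Suc m) (hi m))
    \<doteq> Dv m (Suc (lo m)) m + (Dv m m (Suc m) + Dv m (Suc m) (hi m)) - (Dv m (Suc (lo m)) m + Dv m (Suc m) (hi m))"
    by (intro eqJ_diff) auto
  then show ?thesis by (simp add: Sf_def xx_left[OF m] xx_right[OF m] algebra_simps)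
qed

end

context heights
begin

section \<open>Products along a path of the tree of triangles\<close>

text \<open>For inner vertices: \<open>t\<close> is \<open>m\<close> or an ancestor of
  \<open>m\<close> in the tree of triangles, in which the parent of \<open>m\<close> is
  \<open>low (lo m, hi m)\<close>.\<close>

definition anc :: "nat \<Rightarrow> nat \<Rightarrow> bool" where
  "anc t m \<longleftrightarrow> (\<forall>r. m \<le> r \<and> r \<le> t \<or> t \<le> r \<and> r \<le> m \<longrightarrow> pr r \<le> pr t)"

lemma cov_anc:
  assumes "anc t m" "cov d t" shows "cov d m"
proof -
  obtain s s' where s: "fst d \<le> s" "s < t" "pr t < pr s" and s': "t < s'" "s' \<le> snd d" "pr t < pr s'"
    using assms(2) by (auto simp: cov_def)
  have m: "pr m \<le> pr t" using assms(1) by (auto simp: anc_def)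
  have "s < m" using assms(1) s by (auto simp: anc_def dest!: spec[of _ s])
  moreover have "m < s'" using assms(1) s' by (auto simp: anc_def dest!: spec[of _ s'])
  ultimately show ?thesis using s s' m unfolding cov_def by (meson le_less_trans)
qed

lemma cov_top_imp:
  assumes "i < j" "cov d (top i j)"
  shows "fst d < i \<and> j \<le> snd d"
proof -
  note t = top[OF assms(1)]
  obtain s s' where s: "fst d \<le> s" "s < top i j" "pr (top i j) < pr s"
    and s': "top i j < s'" "s' \<le> snd d" "pr (top i j) < pr s'"
    using assms(2) by (auto simp: cov_def)
  have "\<not> i \<le> s" using t(2) t(3)[of s] s by auto
  moreover have "\<not> s' < j" using t(1) t(3)[of s'] s' by auto
  ultimately show ?thesis using s s' by auto
qed

text \<open>Induction up the tree. The factor \<open>xi u c\<close> of the chord above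
  \<open>m\<close> collects the chords that cover \<open>m\<close> but not its parent; these layers
  are disjoint and exhaust what covers \<open>m\<close> but not \<open>t\<close>.\<close>

lemma prod_xi_anc:
  assumes "0 < m" "m < N" "0 < t" "t < N" "anc t m"
  shows "(\<Prod>c\<in>{c\<in>T. ins m c \<and> \<not> ins t c}. xi u c) = (\<Prod>d\<in>{d\<in>Ch. cov d m \<and> \<not> cov d t}. u d)"
  using assms
proof (induction "pr t - pr m" arbitrary: m rule: less_induct)
  case (less m)
  note m = less.prems(1,2) and t = less.prems(3,4) and anc = less.prems(5)
  show ?case
  proof (cases "m = t")
    case True
    then show ?thesis by simp
  next
    case False
    note lh = lo_hi[OF m]
    have ancD: "pr r \<le> pr t" if "m \<le> r \<and> r \<le> t \<or> t \<le> r \<and> r \<le> m" for r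
      using anc that by (auto simp: anc_def)
    have mt: "pr m < pr t" using ancD[of m] pr_eq_iff[of m t] m t False by linarith
    define c where "c = (lo m, hi m)"
    have out: "\<not> ins t c" using lh(6)[of t] mt by (auto simp: ins_def c_def)
    then have out': "t \<le> lo m \<or> hi m \<le> t" by (auto simp: ins_def c_def)
    have c: "c \<in> T" using node_in_T[OF m] out' t by (auto simp: c_def)
    have cm: "lo m = fst c" "hi m = snd c" by (simp_all add: c_def)
    define s where "s = low c"
    note lg = low_gap[OF c, folded s_def]
    have sm: "pr m < pr s" using lg(3) lh by (auto simp: c_def)
    \<comment> \<open>The vertex \<open>t\<close> lies beyond one end of \<open>c\<close>, and that
      end lies between \<open>m\<close> and \<open>t\<close>, hence not above \<open>t\<close>. If
      the parent \<open>s\<close> is the opposite end, it is lower still.\<close>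
    have anc': "anc t s"
      unfolding anc_def
    proof (intro allI impI)
      fix r assume r: "s \<le> r \<and> r \<le> t \<or> t \<le> r \<and> r \<le> s"
      show "pr r \<le> pr t"
      proof (cases "lo m < r \<and> r < hi m")
        case True
        then show ?thesis using lh(6)[of r] mt by auto
      next
        case False
        show ?thesis
        proof (cases "hi m \<le> t")
          case True
          then have hit: "pr (hi m) \<le> pr t" using ancD[of "hi m"] lh by auto
          have "s = lo m \<Longrightarrow> pr s < pr (hi m)" using lg(5) lh by (auto simp: c_def)
          moreover have "r = t \<or> r = lo m \<and> s = lo m \<or> hi m \<le> r \<and> r \<le> t"
            using r False True lg(3) lh(1,3) by (auto simp: c_def)
          ultimately show ?thesis using hit ancD[of r] lh(3) by auto
        next
          case hit: False
          then have lot: "t \<le> lo m" using out' by auto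
          then have "pr (lo m) \<le> pr t" using ancD[of "lo m"] lh by auto
          moreover have "s = hi m \<Longrightarrow> pr s < pr (lo m)" using lg(4) lh by (auto simp: c_def)
          moreover have "r = t \<or> r = hi m \<and> s = hi m \<or> t \<le> r \<and> r \<le> lo m"
            using r False lot lg(3) lh(1,3) by (auto simp: c_def)
          ultimately show ?thesis using ancD[of r] lh(1) by auto
        qed
      qed
    qed
    have IH: "(\<Prod>c\<in>{c\<in>T. ins s c \<and> \<not> ins t c}. xi u c) = (\<Prod>d\<in>{d\<in>Ch. cov d s \<and> \<not> cov d t}. u d)"
      using sm mt lg t anc' by (intro less.hyps) auto
    have A: "{c\<in>T. ins m c \<and> \<not> ins t c} = insert c {c\<in>T. ins s c \<and> \<not> ins t c}"
      using ins_node_iff[OF c _ m cm] c out by (auto simp: s_def)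
    have B: "{d\<in>Ch. cov d m \<and> \<not> cov d t} = {d\<in>Ch. fst d \<le> fst c \<and> snd c \<le> snd d \<and> \<not> cov d s}
        \<union> {d\<in>Ch. cov d s \<and> \<not> cov d t}"
      using cov_iff[OF m] cov_low_imp[OF c] cov_anc[OF anc'] cm by (auto simp: s_def)
    show ?thesis
      unfolding A B
      by (subst prod.insert, use c s_def in auto, subst prod.union_disjoint)
        (auto simp: IH[folded s_def, unfolded s_def] xi_def[of u c] s_def)
  qed
qed

lemma anc_top:
  assumes "i \<le> m" "m < j"
  shows "anc (top i j) m"
  using top[of i j] assms by (auto simp: anc_def)

text \<open>For \<open>i < j\<close> this is \<open>Dv (top i j) i j\<close>, the monomial to which
  \<open>Pf\<close> is congruent by \<open>Pf_xi\<close>.\<close>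

definition Mon :: "(nat \<times> nat \<Rightarrow> 'a::comm_ring_1) \<Rightarrow> nat \<Rightarrow> nat \<Rightarrow> 'a" where
  "Mon u i j = (\<Prod>d\<in>{d\<in>Ch. fst d < i \<and> j \<le> snd d \<and> \<not> cov d (top i j)}. u d)"

text \<open>The exponent of one coordinate \<open>y = u d\<close>, \<open>d = (a, b)\<close>, on
  both sides of \<open>Mon_relation\<close>. \<open>C1\<close>, \<open>C2\<close>,
  \<open>C3\<close>, \<open>C4\<close> say that \<open>d\<close> covers the highest vertex belonging
  to one of the four monomials; they coincide in pairs as in \<open>top_split\<close>.\<close>

lemma indicator_crossed:
  fixes y :: "'a::comm_ring_1" and a b p q :: nat
  assumes "C1 \<Longrightarrow> a < p \<and> q \<le> b" "C3 \<Longrightarrow> a \<le> p \<and> q \<le> b"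
    "C4 \<Longrightarrow> a < p \<and> q < b" "C2 \<Longrightarrow> a \<le> p \<and> q < b"
    and "C1 = C3 \<and> C2 = C4 \<or> C1 = C4 \<and> C2 = C3"
  shows "(if a = p \<and> b = q then y else 1) * ((if a < p \<and> q \<le> b \<and> \<not> C1 then y else 1)
      * (if a \<le> p \<and> q < b \<and> \<not> C2 then y else 1))
    = (if a \<le> p \<and> q \<le> b \<and> \<not> C3 then y else 1) * (if a < p \<and> q < b \<and> \<not> C4 then y else 1)"
proof -
  consider "a < p \<and> q < b" | "a < p \<and> b = q" | "a = p \<and> q < b" | "a = p \<and> b = q" | "p < a \<or> b < q"
    by linarith
  then show ?thesis
    by cases (use assms in \<open>cases C1; cases C2; cases C3; cases C4; force\<close>)+
qed

text \<open>The same count for a chord \<open>(p, q)\<close> of \<open>T\<close>: \<open>C\<close>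
  says that \<open>d\<close> covers \<open>low (p, q)\<close>, and the additional factor comes from
  \<open>xi\<close>.\<close>

lemma indicator_node:
  fixes y :: "'a::comm_ring_1" and a b p q :: nat
  assumes "C1 \<Longrightarrow> a < p \<and> q \<le> b" "C3 \<longleftrightarrow> a \<le> p \<and> q \<le> b"
    "C4 \<Longrightarrow> a < p \<and> q < b" "C2 \<Longrightarrow> a \<le> p \<and> q < b"
    and "C1 = C \<and> C2 = C4 \<or> C1 = C4 \<and> C2 = C"
  shows "(if a = p \<and> b = q then y else 1) * ((if a < p \<and> q \<le> b \<and> \<not> C1 then y else 1)
      * (if a \<le> p \<and> q < b \<and> \<not> C2 then y else 1))
    = (if a \<le> p \<and> q \<le> b \<and> \<not> C then y else 1)
      * ((if a \<le> p \<and> q \<le> b \<and> \<not> C3 then y else 1) * (if a < p \<and> q < b \<and> \<not> C4 then y else 1))"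
proof -
  consider "a < p \<and> q < b" | "a < p \<and> b = q" | "a = p \<and> q < b" | "a = p \<and> b = q" | "p < a \<or> b < q"
    by linarith
  then show ?thesis
    by cases (use assms in \<open>cases C1; cases C2; cases C; cases C4; force\<close>)+
qed

text \<open>The formal analogue of the cross-ratio formula. It holds exactly and not only modulo
  \<open>J\<close>: written as products over all of \<open>Ch\<close>, both sides have the same
  exponent at every chord.\<close>

lemma Mon_relation:
  assumes c: "(p, q) \<in> Ch"
  shows "u (p, q) * (Mon u p q * Mon u (Suc p) (Suc q))
    = (if (p, q) \<in> T then xi u (p, q) else 1) * (Mon u (Suc p) q * Mon u p (Suc q))"
proof -
  have pq: "p + 2 \<le> q" "q \<le> N" using c by (auto simp: Ch_def)
  define e where "e b d = (if b then u d else 1)" for b d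
  have M: "Mon u i j = (\<Prod>d\<in>Ch. e (fst d < i \<and> j \<le> snd d \<and> \<not> cov d (top i j)) d)" for i j
    unfolding Mon_def e_def by (simp add: prod.inter_filter)
  have X: "xi u (p, q) = (\<Prod>d\<in>Ch. e (fst d \<le> p \<and> q \<le> snd d \<and> \<not> cov d (low (p, q))) d)"
    unfolding xi_def e_def by (simp add: prod.inter_filter)
  have U: "u (p, q) = (\<Prod>d\<in>Ch. e (d = (p, q)) d)"
    using c by (simp add: e_def)
  have imp: "cov d (top p q) \<Longrightarrow> fst d < p \<and> q \<le> snd d"
    "cov d (top (Suc p) q) \<Longrightarrow> fst d \<le> p \<and> q \<le> snd d"
    "cov d (top p (Suc q)) \<Longrightarrow> fst d < p \<and> Suc q \<le> snd d"
    "cov d (top (Suc p) (Suc q)) \<Longrightarrow> fst d \<le> p \<and> Suc q \<le> snd d" for d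
    using cov_top_imp[of p q d] cov_top_imp[of "Suc p" q d] cov_top_imp[of p "Suc q" d]
      cov_top_imp[of "Suc p" "Suc q" d] pq by auto
  from c show ?thesis
  proof (cases rule: top_split)
    case crossed
    have "e (d = (p, q)) d * (e (fst d < p \<and> q \<le> snd d \<and> \<not> cov d (top p q)) d
        * e (fst d < Suc p \<and> Suc q \<le> snd d \<and> \<not> cov d (top (Suc p) (Suc q))) d)
      = e (fst d < Suc p \<and> q \<le> snd d \<and> \<not> cov d (top (Suc p) q)) d
        * e (fst d < p \<and> Suc q \<le> snd d \<and> \<not> cov d (top p (Suc q))) d" for d
      unfolding e_def prod_eq_iff fst_conv snd_conv less_Suc_eq_le Suc_le_eq
      by (rule indicator_crossed[OF imp(1)[of d] imp(2)[of d] imp(3)[of d, unfolded Suc_le_eq]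
            imp(4)[of d, unfolded Suc_le_eq]]) (use crossed(2) in \<open>elim disjE conjE; simp only: simp_thms\<close>)+
    then show ?thesis using crossed(1) by (simp add: U M prod.distrib[symmetric])
  next
    case node
    define m where "m = top (Suc p) q"
    have m: "0 < m" "m < N" using top[of "Suc p" q] pq by (auto simp: m_def)
    have "e (d = (p, q)) d * (e (fst d < p \<and> q \<le> snd d \<and> \<not> cov d (top p q)) d
        * e (fst d < Suc p \<and> Suc q \<le> snd d \<and> \<not> cov d (top (Suc p) (Suc q))) d)
      = e (fst d \<le> p \<and> q \<le> snd d \<and> \<not> cov d (low (p, q))) d *
       (e (fst d < Suc p \<and> q \<le> snd d \<and> \<not> cov d (top (Suc p) q)) d
        * e (fst d < p \<and> Suc q \<le> snd d \<and> \<not> cov d (top p (Suc q))) d)" if "d \<in> Ch" for d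
    proof -
      have t3: "cov d (top (Suc p) q) \<longleftrightarrow> fst d \<le> p \<and> q \<le> snd d"
        using cov_iff[OF m that] node(2,3) by (simp add: m_def)
      show ?thesis
        unfolding e_def prod_eq_iff fst_conv snd_conv less_Suc_eq_le Suc_le_eq
        by (rule indicator_node[OF imp(1)[of d] t3 imp(3)[of d, unfolded Suc_le_eq]
              imp(4)[of d, unfolded Suc_le_eq]]) (use node(4) in \<open>elim disjE conjE; simp only: simp_thms\<close>)+
    qed
    then show ?thesis using node(1) by (simp add: U M X prod.distrib[symmetric])
  qed
qed

end

context heights_rel
begin

text \<open>A summand is the gap at \<open>m\<close> measured in its own triangle;
  \<open>prod_xi_anc\<close> converts it to the scale of the triangle of \<open>top i j\<close>. On
  this common scale the gaps add up by \<open>Dv_add\<close>.\<close>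

lemma Pf_xi:
  assumes "i < j" "j \<le> Suc N"
  shows "Pf (xi u) i j \<doteq> Mon u i j"
proof (cases "i = 0 \<or> j = Suc N")
  case True
  then have "{d\<in>Ch. fst d < i \<and> j \<le> snd d \<and> \<not> cov d (top i j)} = {}" by (auto simp: Ch_def)
  then show ?thesis using True by (simp only: Mon_def prod.empty Pf_def if_True eqJ_refl)
next
  case False
  define t where "t = top i j"
  note tp = top[OF assms(1), folded t_def]
  have t: "0 < t" "t < N" using tp False assms by auto
  note lh = lo_hi[OF t]
  \<comment> \<open>The vertices \<open>lo t\<close> and \<open>hi t\<close> are higher than
    \<open>t\<close>, the highest vertex of the range, hence outside the range.\<close>
  have lohi: "lo t < i" "j \<le> hi t"
    using tp(3)[of "lo t"] tp(3)[of "hi t"] lh tp(1,2) by (force simp: not_le[symmetric])+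
  have 1: "Pf (xi u) i j = (\<Sum>m\<in>{i..<j}. Sf (xi u) m * (\<Prod>d\<in>{d\<in>Ch. cov d m \<and> \<not> cov d t}. u d))"
    using False assms t anc_top[of i _ j] prod_xi_anc[of _ t u]
    by (auto simp: Pf_def t_def intro!: sum.cong)
  have 2: "(\<Sum>m\<in>{i..<j}. Sf (xi u) m * (\<Prod>d\<in>{d\<in>Ch. cov d m \<and> \<not> cov d t}. u d)) \<doteq> (\<Sum>m\<in>{i..<j}. Dv m m (Suc m) * (\<Prod>d\<in>{d\<in>Ch. cov d m \<and> \<not> cov d t}. u d))"
  proof (rule eqJ_sum)
    fix m assume "m \<in> {i..<j}"
    then have "0 < m" "m < N" using False assms by auto
    then show "Sf (xi u) m * (\<Prod>d\<in>{d\<in>Ch. cov d m \<and> \<not> cov d t}. u d)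
        \<doteq> Dv m m (Suc m) * (\<Prod>d\<in>{d\<in>Ch. cov d m \<and> \<not> cov d t}. u d)"
      by (rule eqJ_mult[OF Sf_xi eqJ_refl])
  qed
  have 3: "(\<Sum>m\<in>{i..<j}. Dv m m (Suc m) * (\<Prod>d\<in>{d\<in>Ch. cov d m \<and> \<not> cov d t}. u d)) = (\<Sum>m\<in>{i..<j}. Dv t m (Suc m))"
  proof (intro sum.cong refl)
    fix m assume m: "m \<in> {i..<j}"
    have a: "anc t m" using anc_top m by (auto simp: t_def)
    have "{d\<in>Ch. fst d < m \<and> Suc m \<le> snd d \<and> \<not> cov d t}
      = {d\<in>Ch. fst d < m \<and> Suc m \<le> snd d \<and> \<not> cov d m} \<union> {d\<in>Ch. cov d m \<and> \<not> cov d t}"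
      (is "?L = ?R")
    proof (rule Set.set_eqI)
      fix d
      show "d \<in> ?L \<longleftrightarrow> d \<in> ?R"
        using cov_anc[OF a, of d] cov_imp_ins[of d m] unfolding ins_def Suc_le_eq mem_Collect_eq Un_iff
        by argo
    qed
    then show "Dv m m (Suc m) * (\<Prod>d\<in>{d\<in>Ch. cov d m \<and> \<not> cov d t}. u d) = Dv t m (Suc m)"
      unfolding Dv_def by (simp only: if_True lessI) (intro prod.union_disjoint[symmetric], auto)
  qed
  have 4: "(\<Sum>m\<in>{i..<j}. Dv t m (Suc m)) \<doteq> Dv t i j"
  proof -
    have "(\<Sum>m\<in>{i..<j'}. Dv t m (Suc m)) \<doteq> Dv t i j'" if "i \<le> j'" "j' \<le> j" for j'
      using that
    proof (induction j' rule: dec_induct)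
      case base
      then show ?case by (simp add: Dv_def)
    next
      case (step n)
      have "(\<Sum>m\<in>{i..<Suc n}. Dv t m (Suc m)) = (\<Sum>m\<in>{i..<n}. Dv t m (Suc m)) + Dv t n (Suc n)"
        using step by simp
      also have "\<dots> \<doteq> Dv t i n + Dv t n (Suc n)"
        by (rule eqJ_add[OF step.IH eqJ_refl]) (use step in auto)
      also have "\<dots> \<doteq> Dv t i (Suc n)"
        by (rule eqJ_sym[OF Dv_add[OF t]]) (use step lohi in auto)
      finally show ?case .
    qed
    then show ?thesis using assms by simp
  qed
  have 5: "Dv t i j = Mon u i j"
    using assms by (simp add: Dv_def Mon_def t_def)
  show ?thesis
    using eqJ_trans[OF 2[unfolded 3] 4] by (simp only: 1 5)
qed

text \<open>This presents \<open>u (p, q)\<close> as a fraction in the \<open>xi u\<close> without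
  any division, so that the \<open>xi u\<close> generate the coordinate ring once the
  \<open>Pf\<close> are inverted.\<close>

lemma u_Pf_relation:
  assumes c: "(p, q) \<in> Ch"
  shows "u (p, q) * (Pf (xi u) p q * Pf (xi u) (Suc p) (Suc q))
    \<doteq> (if (p, q) \<in> T then xi u (p, q) else 1) * (Pf (xi u) (Suc p) q * Pf (xi u) p (Suc q))"
proof -
  have pq: "p + 2 \<le> q" "q \<le> N" using c by (auto simp: Ch_def)
  have "u (p, q) * (Pf (xi u) p q * Pf (xi u) (Suc p) (Suc q))
      \<doteq> u (p, q) * (Mon u p q * Mon u (Suc p) (Suc q))"
    by (rule eqJ_mult[OF eqJ_refl eqJ_mult[OF Pf_xi Pf_xi]]) (use pq in auto)
  also have "\<dots> = (if (p, q) \<in> T then xi u (p, q) else 1) * (Mon u (Suc p) q * Mon u p (Suc q))"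
    by (rule Mon_relation[OF c])
  also have "\<dots> \<doteq> (if (p, q) \<in> T then xi u (p, q) else 1) * (Pf (xi u) (Suc p) q * Pf (xi u) p (Suc q))"
    by (rule eqJ_mult[OF eqJ_refl eqJ_mult[OF eqJ_sym[OF Pf_xi] eqJ_sym[OF Pf_xi]]]) (use pq in auto)
  finally show ?thesis .
qed

end

section \<open>Quotients and localisations\<close>

lemma int_poly_ring_simps [simp]:
  "carrier (int_poly_ring V) = mpolys V" "monoid.mult (int_poly_ring V) = (*)" "monoid.one (int_poly_ring V) = 1"
  "ring.zero (int_poly_ring V) = 0" "ring.add (int_poly_ring V) = (+)"
  by (simp_all add: int_poly_ring_def mpolys_def)

lemma cring_int_poly_ring: "cring (int_poly_ring V)"
proof (rule cringI)
  show "abelian_group (int_poly_ring V)"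
  proof (rule abelian_groupI)
    fix x assume "x \<in> carrier (int_poly_ring V)"
    then show "\<exists>y\<in>carrier (int_poly_ring V). y \<oplus>\<^bsub>int_poly_ring V\<^esub> x = \<zero>\<^bsub>int_poly_ring V\<^esub>"
      by (intro bexI[of _ "- x"]) (auto intro: mpolys_uminus)
  qed (auto simp: add.assoc add.commute intro: mpolys_add)
  show "comm_monoid (int_poly_ring V)"
    by (rule comm_monoidI) (auto simp: mult.assoc mult.commute intro: mpolys_mult)
qed (simp_all add: distrib_right)

lemma ring_int_poly_ring: "ring (int_poly_ring V)"
  by (rule cring.axioms(1)[OF cring_int_poly_ring])

lemma int_poly_ring_a_inv: "p \<in> mpolys V \<Longrightarrow> \<ominus>\<^bsub>int_poly_ring V\<^esub> p = - p"
proof -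
  assume p: "p \<in> mpolys V"
  interpret cring "int_poly_ring V" by (rule cring_int_poly_ring)
  show ?thesis using minus_equality[of "- p" p] p by (simp add: mpolys_uminus)
qed

lemma int_poly_ring_minus:
  "p \<in> mpolys V \<Longrightarrow> q \<in> mpolys V \<Longrightarrow> p \<ominus>\<^bsub>int_poly_ring V\<^esub> q = p - q"
  by (simp add: a_minus_def int_poly_ring_a_inv)

lemma int_poly_ring_pow: "p [^]\<^bsub>int_poly_ring V\<^esub> (k::nat) = p ^ k"
  by (induction k) (auto simp: nat_pow_def)

lemma ring_hom_cringI':
  assumes "cring R" "cring S" "h \<in> Ring.ring_hom R S"
  shows "ring_hom_cring R S h" "ring_hom_ring R S h"
  using assms by (auto intro!: ring_hom_cring.intro ring_hom_cring_axioms.intro ring_hom_ringI2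
      dest: cring.axioms(1))

lemma ring_hom_pow:
  assumes "cring R" "cring S" "h \<in> Ring.ring_hom R S" "x \<in> carrier R"
  shows "h (x [^]\<^bsub>R\<^esub> (k::nat)) = h x [^]\<^bsub>S\<^esub> k"
  by (rule ring_hom_ring.hom_nat_pow[OF ring_hom_cringI'(2)[OF assms(1-3)] assms(4)])

lemma ring_hom_a_minus:
  assumes "cring R" "cring S" "h \<in> Ring.ring_hom R S" "x \<in> carrier R" "y \<in> carrier R"
  shows "h (x \<ominus>\<^bsub>R\<^esub> y) = h x \<ominus>\<^bsub>S\<^esub> h y"
proof -
  interpret ring_hom_cring R S h by (rule ring_hom_cringI'(1)[OF assms(1-3)])
  show ?thesis using assms(4,5) by (simp add: a_minus_def)
qed

lemma carrier_Quot: "carrier (R Quot I) = {I +>\<^bsub>R\<^esub> a | a. a \<in> carrier R}"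
  by (auto simp: FactRing_def A_RCOSETS_def')

lemma Quot_ops:
  assumes "ideal I R" "a \<in> carrier R" "b \<in> carrier R"
  shows "(I +>\<^bsub>R\<^esub> a) \<otimes>\<^bsub>R Quot I\<^esub> (I +>\<^bsub>R\<^esub> b) = I +>\<^bsub>R\<^esub> (a \<otimes>\<^bsub>R\<^esub> b)"
    "(I +>\<^bsub>R\<^esub> a) \<oplus>\<^bsub>R Quot I\<^esub> (I +>\<^bsub>R\<^esub> b) = I +>\<^bsub>R\<^esub> (a \<oplus>\<^bsub>R\<^esub> b)"
  using ring_hom_memE[OF ideal.rcos_ring_hom[OF assms(1)]] assms(2,3) by auto

lemma Quot_one: "\<one>\<^bsub>R Quot I\<^esub> = I +>\<^bsub>R\<^esub> \<one>\<^bsub>R\<^esub>"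
  by (simp add: FactRing_def)

lemma Quot_pow:
  assumes "cring R" "ideal I R" "a \<in> carrier R"
  shows "(I +>\<^bsub>R\<^esub> a) [^]\<^bsub>R Quot I\<^esub> (k::nat) = I +>\<^bsub>R\<^esub> (a [^]\<^bsub>R\<^esub> k)"
  using ring_hom_pow[OF assms(1) ideal.quotient_is_cring[OF assms(2,1)] ideal.rcos_ring_hom[OF assms(2)] assms(3)]
  by simp

lemma Quot_eq_iff:
  assumes "cring R" "ideal I R" "a \<in> carrier R" "b \<in> carrier R"
  shows "I +>\<^bsub>R\<^esub> a = I +>\<^bsub>R\<^esub> b \<longleftrightarrow> a \<ominus>\<^bsub>R\<^esub> b \<in> I"
  using ring.quotient_eq_iff_same_a_r_cos[OF cring.axioms(1)[OF assms(1)] assms(2-4)] by simp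

lemma Quot_eq_zero_iff:
  assumes "cring R" "ideal I R" "a \<in> carrier R"
  shows "I +>\<^bsub>R\<^esub> a = \<zero>\<^bsub>R Quot I\<^esub> \<longleftrightarrow> a \<in> I"
proof -
  interpret cring R by fact
  have "\<zero>\<^bsub>R Quot I\<^esub> = I" by (simp add: FactRing_def)
  then show ?thesis
    using a_rcos_zero[OF assms(2), of a] ideal.rcos_const_imp_mem[OF assms(2,3)] by auto
qed

text \<open>Only meaningful when \<open>h\<close> is constant on \<open>X\<close>.\<close>

definition lift_coset :: "('a \<Rightarrow> 'b) \<Rightarrow> 'a set \<Rightarrow> 'b" where
  "lift_coset h X = h (SOME x. x \<in> X)"

lemma lift_coset:
  assumes "cring R" "ideal I R" "cring S" "h \<in> Ring.ring_hom R S"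
    and ker: "\<And>a. a \<in> I \<Longrightarrow> h a = \<zero>\<^bsub>S\<^esub>" and a: "a \<in> carrier R"
  shows "lift_coset h (I +>\<^bsub>R\<^esub> a) = h a"
proof -
  interpret h: ring_hom_cring R S h by (rule ring_hom_cringI'(1)[OF assms(1,3,4)])
  interpret ideal I R by fact
  define x where "x = (SOME x. x \<in> I +>\<^bsub>R\<^esub> a)"
  have "a \<in> I +>\<^bsub>R\<^esub> a" using a by (rule a_rcos_self)
  then have "x \<in> I +>\<^bsub>R\<^esub> a" unfolding x_def by (rule someI)
  then obtain i where i: "i \<in> I" "x = i \<oplus>\<^bsub>R\<^esub> a"
    by (auto simp: a_r_coset_def r_coset_def)
  then have "h x = h a" using a ker[OF i(1)] by simp
  then show ?thesis by (simp add: lift_coset_def x_def)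
qed

lemma lift_coset_hom:
  assumes "cring R" "ideal I R" "cring S" "h \<in> Ring.ring_hom R S"
    and ker: "\<And>a. a \<in> I \<Longrightarrow> h a = \<zero>\<^bsub>S\<^esub>"
  shows "lift_coset h \<in> Ring.ring_hom (R Quot I) S"
proof -
  interpret h: ring_hom_cring R S h by (rule ring_hom_cringI'(1)[OF assms(1,3,4)])
  note lc = lift_coset[OF assms]
  show ?thesis
  proof (rule ring_hom_memI)
    fix x y assume "x \<in> carrier (R Quot I)" "y \<in> carrier (R Quot I)"
    then obtain a b where "x = I +>\<^bsub>R\<^esub> a" "y = I +>\<^bsub>R\<^esub> b" "a \<in> carrier R" "b \<in> carrier R"
      by (auto simp: carrier_Quot)
    then show "lift_coset h (x \<otimes>\<^bsub>R Quot I\<^esub> y) = lift_coset h x \<otimes>\<^bsub>S\<^esub> lift_coset h y"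
      "lift_coset h (x \<oplus>\<^bsub>R Quot I\<^esub> y) = lift_coset h x \<oplus>\<^bsub>S\<^esub> lift_coset h y"
      by (simp_all add: Quot_ops[OF assms(2)] lc)
  next
    fix x assume "x \<in> carrier (R Quot I)"
    then show "lift_coset h x \<in> carrier S" by (auto simp: carrier_Quot lc)
  next
    show "lift_coset h \<one>\<^bsub>R Quot I\<^esub> = \<one>\<^bsub>S\<^esub>" by (simp add: Quot_one lc)
  qed
qed

section \<open>Localisations of quotients\<close>

lemma localization_away_lift:
  assumes R: "cring R" and I: "ideal I R" and S: "cring S" and h: "h \<in> Ring.ring_hom R S"
    and ker: "\<And>a. a \<in> I \<Longrightarrow> h a = \<zero>\<^bsub>S\<^esub>" and f: "f \<in> carrier R" "h f \<in> Units S"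
    and frac: "\<And>b. b \<in> carrier S \<Longrightarrow> \<exists>a\<in>carrier R. \<exists>k::nat. b \<otimes>\<^bsub>S\<^esub> (h f [^]\<^bsub>S\<^esub> k) = h a"
    and tors: "\<And>a. a \<in> carrier R \<Longrightarrow> h a = \<zero>\<^bsub>S\<^esub> \<Longrightarrow> \<exists>k::nat. (f [^]\<^bsub>R\<^esub> k) \<otimes>\<^bsub>R\<^esub> a \<in> I"
  shows "localization_away (R Quot I) (I +>\<^bsub>R\<^esub> f) S (lift_coset h)"
  unfolding localization_away_def
proof (intro conjI ballI impI)
  interpret R: cring R by fact
  note lc = lift_coset[OF R I S h ker]
  show "lift_coset h \<in> Ring.ring_hom (R Quot I) S" by (rule lift_coset_hom[OF R I S h ker])
  show "lift_coset h (I +>\<^bsub>R\<^esub> f) \<in> Units S" using f by (simp add: lc)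
  fix b assume "b \<in> carrier S"
  then obtain a k where "a \<in> carrier R" "b \<otimes>\<^bsub>S\<^esub> (h f [^]\<^bsub>S\<^esub> (k::nat)) = h a" using frac by blast
  then show "\<exists>a\<in>carrier (R Quot I). \<exists>k::nat.
      b \<otimes>\<^bsub>S\<^esub> lift_coset h (I +>\<^bsub>R\<^esub> f) [^]\<^bsub>S\<^esub> k = lift_coset h a"
    using f by (intro bexI[of _ "I +>\<^bsub>R\<^esub> a"] exI[of _ k]) (auto simp: lc carrier_Quot)
next
  interpret R: cring R by fact
  note lc = lift_coset[OF R I S h ker]
  fix x assume "x \<in> carrier (R Quot I)" "lift_coset h x = \<zero>\<^bsub>S\<^esub>"
  then obtain a where a: "x = I +>\<^bsub>R\<^esub> a" "a \<in> carrier R" "h a = \<zero>\<^bsub>S\<^esub>"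
    by (auto simp: carrier_Quot lc)
  from tors[OF a(2,3)] obtain k where "(f [^]\<^bsub>R\<^esub> (k::nat)) \<otimes>\<^bsub>R\<^esub> a \<in> I" by blast
  then show "\<exists>k::nat. (I +>\<^bsub>R\<^esub> f) [^]\<^bsub>R Quot I\<^esub> k \<otimes>\<^bsub>R Quot I\<^esub> x = \<zero>\<^bsub>R Quot I\<^esub>"
    using a f R I by (intro exI[of _ k]) (auto simp: Quot_pow Quot_ops Quot_eq_zero_iff)
qed

text \<open>Localising commutes with dividing by \<open>D\<close>: the localisation of the quotient
  is \<open>C\<close> modulo the ideal generated by the image of \<open>D\<close>. It will supply
  the charts of the divisors.\<close>

lemma localization_away_quotient:
  assumes A: "cring A" and D: "ideal D A" and f: "f \<in> carrier A"
    and loc: "localization_away A f C \<phi>" and C: "cring C" and C': "cring C'"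
    and \<tau>: "\<tau> \<in> Ring.ring_hom C C'" and surj: "\<tau> ` carrier C = carrier C'"
    and ker: "\<And>c. c \<in> carrier C \<Longrightarrow> \<tau> c = \<zero>\<^bsub>C'\<^esub> \<longleftrightarrow> c \<in> Idl\<^bsub>C\<^esub> (\<phi> ` D)"
  shows "localization_away (A Quot D) (D +>\<^bsub>A\<^esub> f) C' (lift_coset (\<tau> \<circ> \<phi>))"
proof -
  interpret A: cring A by fact
  interpret C: cring C by fact
  interpret D: ideal D A by fact
  have \<phi>: "\<phi> \<in> Ring.ring_hom A C" and unit: "\<phi> f \<in> Units C"
    and frac: "\<And>b. b \<in> carrier C \<Longrightarrow> \<exists>a\<in>carrier A. \<exists>k::nat. b \<otimes>\<^bsub>C\<^esub> (\<phi> f [^]\<^bsub>C\<^esub> k) = \<phi> a"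
    and tors: "\<And>a. a \<in> carrier A \<Longrightarrow> \<phi> a = \<zero>\<^bsub>C\<^esub> \<Longrightarrow> \<exists>k::nat. (f [^]\<^bsub>A\<^esub> k) \<otimes>\<^bsub>A\<^esub> a = \<zero>\<^bsub>A\<^esub>"
    using loc by (auto simp: localization_away_def)
  interpret \<phi>: ring_hom_cring A C \<phi> by (rule ring_hom_cringI'(1)[OF A C \<phi>])
  interpret \<tau>: ring_hom_cring C C' \<tau> by (rule ring_hom_cringI'(1)[OF C C' \<tau>])
  note pow = ring_hom_pow[OF A C \<phi> f, symmetric]
  \<comment> \<open>The fractions with numerator in \<open>D\<close>. They form an ideal containing
    the image of \<open>D\<close>, so every element of the generated ideal is such a
    fraction.\<close>
  define E where "E = {c \<in> carrier C. \<exists>k::nat. \<exists>e\<in>D. c \<otimes>\<^bsub>C\<^esub> (\<phi> f [^]\<^bsub>C\<^esub> k) = \<phi> e}"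
  have EI: "c \<in> E" if "c \<otimes>\<^bsub>C\<^esub> (\<phi> f [^]\<^bsub>C\<^esub> (k::nat)) = \<phi> e" "c \<in> carrier C" "e \<in> D" for c k e
    unfolding E_def using that by blast
  have fk: "f [^]\<^bsub>A\<^esub> (k::nat) \<in> carrier A" for k using f by simp
  have "ideal E C"
  proof (rule idealI[OF C.ring_axioms])
    show "x \<otimes>\<^bsub>C\<^esub> a \<in> E" if aE: "a \<in> E" and x: "x \<in> carrier C" for a x
    proof -
      obtain k e where k: "a \<in> carrier C" "e \<in> D" "a \<otimes>\<^bsub>C\<^esub> (\<phi> f [^]\<^bsub>C\<^esub> (k::nat)) = \<phi> e"
        using aE by (auto simp: E_def)
      obtain y l where l: "y \<in> carrier A" "x \<otimes>\<^bsub>C\<^esub> (\<phi> f [^]\<^bsub>C\<^esub> (l::nat)) = \<phi> y" using frac x by blast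
      have "(x \<otimes>\<^bsub>C\<^esub> a) \<otimes>\<^bsub>C\<^esub> (\<phi> f [^]\<^bsub>C\<^esub> (l + k))
        = (x \<otimes>\<^bsub>C\<^esub> (\<phi> f [^]\<^bsub>C\<^esub> l)) \<otimes>\<^bsub>C\<^esub> (a \<otimes>\<^bsub>C\<^esub> (\<phi> f [^]\<^bsub>C\<^esub> k))"
        using x k(1) f by (simp add: C.nat_pow_mult[symmetric] C.m_ac)
      also have "\<dots> = \<phi> (y \<otimes>\<^bsub>A\<^esub> e)" using k l by simp
      finally show ?thesis
        by (rule EI) (use x k(1,2) l(1) D.I_l_closed in auto)
    qed
    then show "a \<otimes>\<^bsub>C\<^esub> x \<in> E" if "a \<in> E" "x \<in> carrier C" for a x
      using C.m_comm[of a x] that by (simp add: E_def)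
    show "subgroup E (add_monoid C)"
    proof (rule C.add.subgroupI)
      show "E \<subseteq> carrier C" by (auto simp: E_def)
      have "\<zero>\<^bsub>C\<^esub> \<in> E"
        using f by (auto simp: E_def intro!: exI[of _ 0] bexI[of _ "\<zero>\<^bsub>A\<^esub>"])
      then show "E \<noteq> {}" by auto
      show "\<ominus>\<^bsub>C\<^esub> a \<in> E" if aE: "a \<in> E" for a
      proof -
        obtain k e where k: "a \<in> carrier C" "e \<in> D" "a \<otimes>\<^bsub>C\<^esub> (\<phi> f [^]\<^bsub>C\<^esub> (k::nat)) = \<phi> e"
          using aE by (auto simp: E_def)
        have "(\<ominus>\<^bsub>C\<^esub> a) \<otimes>\<^bsub>C\<^esub> (\<phi> f [^]\<^bsub>C\<^esub> k) = \<phi> (\<ominus>\<^bsub>A\<^esub> e)"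
          using k f by (simp add: C.l_minus)
        then show ?thesis by (rule EI) (use k(1,2) in auto)
      qed
      show "a \<oplus>\<^bsub>C\<^esub> b \<in> E" if ab: "a \<in> E" "b \<in> E" for a b
      proof -
        obtain k e where k: "a \<in> carrier C" "e \<in> D" "a \<otimes>\<^bsub>C\<^esub> (\<phi> f [^]\<^bsub>C\<^esub> (k::nat)) = \<phi> e"
          using ab by (auto simp: E_def)
        obtain l e' where l: "b \<in> carrier C" "e' \<in> D" "b \<otimes>\<^bsub>C\<^esub> (\<phi> f [^]\<^bsub>C\<^esub> (l::nat)) = \<phi> e'"
          using ab by (auto simp: E_def)
        have "(a \<oplus>\<^bsub>C\<^esub> b) \<otimes>\<^bsub>C\<^esub> (\<phi> f [^]\<^bsub>C\<^esub> (k + l))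
          = (a \<otimes>\<^bsub>C\<^esub> (\<phi> f [^]\<^bsub>C\<^esub> k)) \<otimes>\<^bsub>C\<^esub> (\<phi> f [^]\<^bsub>C\<^esub> l)
            \<oplus>\<^bsub>C\<^esub> (b \<otimes>\<^bsub>C\<^esub> (\<phi> f [^]\<^bsub>C\<^esub> l)) \<otimes>\<^bsub>C\<^esub> (\<phi> f [^]\<^bsub>C\<^esub> k)"
          using k(1) l(1) f by (simp add: C.nat_pow_mult[symmetric] C.l_distr C.m_ac)
        also have "\<dots> = \<phi> (e \<otimes>\<^bsub>A\<^esub> (f [^]\<^bsub>A\<^esub> l) \<oplus>\<^bsub>A\<^esub> e' \<otimes>\<^bsub>A\<^esub> (f [^]\<^bsub>A\<^esub> k))"
          using k l f fk by (simp add: pow)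
        finally show ?thesis
          by (rule EI) (use k(1,2) l(1,2) fk D.I_r_closed in auto)
      qed
    qed
  qed
  moreover have "\<phi> ` D \<subseteq> E"
    using f by (auto simp: E_def intro!: exI[of _ 0])
  ultimately have IE: "Idl\<^bsub>C\<^esub> (\<phi> ` D) \<subseteq> E" by (rule C.genideal_minimal)
  show ?thesis
  proof (rule localization_away_lift[OF A D C' _ _ f])
    show "\<tau> \<circ> \<phi> \<in> Ring.ring_hom A C'" by (rule ring_hom_trans[OF \<phi> \<tau>])
    have sub: "\<phi> ` D \<subseteq> carrier C" by auto
    have Dsub: "\<phi> ` D \<subseteq> Idl\<^bsub>C\<^esub> (\<phi> ` D)" by (rule C.genideal_self[OF sub])
    show "(\<tau> \<circ> \<phi>) a = \<zero>\<^bsub>C'\<^esub>" if "a \<in> D" for a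
      using ker[of "\<phi> a"] that Dsub by auto
    obtain v where v: "v \<in> carrier C" "\<phi> f \<otimes>\<^bsub>C\<^esub> v = \<one>\<^bsub>C\<^esub>" "v \<otimes>\<^bsub>C\<^esub> \<phi> f = \<one>\<^bsub>C\<^esub>"
      using unit by (auto simp: Units_def)
    have "\<tau> v \<otimes>\<^bsub>C'\<^esub> \<tau> (\<phi> f) = \<one>\<^bsub>C'\<^esub>" "\<tau> (\<phi> f) \<otimes>\<^bsub>C'\<^esub> \<tau> v = \<one>\<^bsub>C'\<^esub>"
      using v f by (simp_all add: \<tau>.hom_mult[symmetric] del: \<tau>.hom_mult)
    then show "(\<tau> \<circ> \<phi>) f \<in> Units C'"
      using v f by (auto simp: Units_def intro!: bexI[of _ "\<tau> v"])
    fix b assume "b \<in> carrier C'"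
    then obtain c where c: "c \<in> carrier C" "b = \<tau> c" using surj by auto
    from frac[OF c(1)] obtain a k where a: "a \<in> carrier A" "c \<otimes>\<^bsub>C\<^esub> (\<phi> f [^]\<^bsub>C\<^esub> (k::nat)) = \<phi> a"
      by blast
    have "b \<otimes>\<^bsub>C'\<^esub> ((\<tau> \<circ> \<phi>) f [^]\<^bsub>C'\<^esub> k) = \<tau> (c \<otimes>\<^bsub>C\<^esub> (\<phi> f [^]\<^bsub>C\<^esub> k))"
      using c f ring_hom_pow[OF C C' \<tau>, of "\<phi> f" k] by simp
    then show "\<exists>a\<in>carrier A. \<exists>k::nat. b \<otimes>\<^bsub>C'\<^esub> ((\<tau> \<circ> \<phi>) f [^]\<^bsub>C'\<^esub> k) = (\<tau> \<circ> \<phi>) a"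
      using a by auto
  next
    fix a assume a: "a \<in> carrier A" "(\<tau> \<circ> \<phi>) a = \<zero>\<^bsub>C'\<^esub>"
    then have "\<phi> a \<in> E" using ker[of "\<phi> a"] IE by auto
    then obtain k e where k: "e \<in> D" "\<phi> a \<otimes>\<^bsub>C\<^esub> (\<phi> f [^]\<^bsub>C\<^esub> (k::nat)) = \<phi> e" by (auto simp: E_def)
    \<comment> \<open>This difference vanishes in \<open>C\<close>, so some \<open>f ^ l\<close>
      kills it in \<open>A\<close>; multiplying by the same power moves \<open>a\<close> times a
      power of \<open>f\<close> into \<open>D\<close>.\<close>
    let ?x = "a \<otimes>\<^bsub>A\<^esub> (f [^]\<^bsub>A\<^esub> k) \<ominus>\<^bsub>A\<^esub> e"
    have e: "e \<in> carrier A" using k by simp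
    have x: "?x \<in> carrier A" using a e fk by simp
    have "\<phi> ?x = \<phi> (a \<otimes>\<^bsub>A\<^esub> (f [^]\<^bsub>A\<^esub> k)) \<ominus>\<^bsub>C\<^esub> \<phi> e"
      by (rule ring_hom_a_minus[OF A C \<phi>]) (use a e fk in auto)
    also have "\<phi> (a \<otimes>\<^bsub>A\<^esub> (f [^]\<^bsub>A\<^esub> k)) = \<phi> e" using a fk k by (simp add: pow)
    finally have "\<phi> ?x = \<zero>\<^bsub>C\<^esub>" using e by (simp add: C.r_neg a_minus_def)
    from tors[OF x this] obtain l where l: "(f [^]\<^bsub>A\<^esub> (l::nat)) \<otimes>\<^bsub>A\<^esub> ?x = \<zero>\<^bsub>A\<^esub>" by blast
    have "(f [^]\<^bsub>A\<^esub> (l + k)) \<otimes>\<^bsub>A\<^esub> a = (f [^]\<^bsub>A\<^esub> l) \<otimes>\<^bsub>A\<^esub> ?x \<oplus>\<^bsub>A\<^esub> (f [^]\<^bsub>A\<^esub> l) \<otimes>\<^bsub>A\<^esub> e"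
    proof -
      have "(f [^]\<^bsub>A\<^esub> (l + k)) \<otimes>\<^bsub>A\<^esub> a = (f [^]\<^bsub>A\<^esub> l) \<otimes>\<^bsub>A\<^esub> (a \<otimes>\<^bsub>A\<^esub> (f [^]\<^bsub>A\<^esub> k))"
        using a f by (simp add: A.nat_pow_mult[symmetric] A.m_ac)
      also have "a \<otimes>\<^bsub>A\<^esub> (f [^]\<^bsub>A\<^esub> k) = ?x \<oplus>\<^bsub>A\<^esub> e"
        using a e fk by (simp add: a_minus_def A.a_assoc A.l_neg)
      finally show ?thesis using x e fk by (simp add: A.r_distr)
    qed
    also have "\<dots> \<in> D" using l e fk k D.I_l_closed by simp
    finally show "\<exists>k::nat. (f [^]\<^bsub>A\<^esub> k) \<otimes>\<^bsub>A\<^esub> a \<in> D" by blast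
  qed
qed

lemma ideal_int_poly_ringD:
  assumes "ideal I (int_poly_ring V)"
  shows "0 \<in> I" "I \<subseteq> mpolys V" "a \<in> I \<Longrightarrow> b \<in> I \<Longrightarrow> a + b \<in> I" "a \<in> I \<Longrightarrow> r \<in> mpolys V \<Longrightarrow> r * a \<in> I"
    "a \<in> I \<Longrightarrow> b \<in> I \<Longrightarrow> a - b \<in> I" "1 \<in> I \<Longrightarrow> I = mpolys V"
proof -
  interpret ideal I "int_poly_ring V" by fact
  show sub: "I \<subseteq> mpolys V" using a_subset by simp
  show "0 \<in> I" using additive_subgroup.zero_closed[OF is_additive_subgroup] by simp
  show "a + b \<in> I" if "a \<in> I" "b \<in> I" using additive_subgroup.a_closed[OF is_additive_subgroup that] by simp
  show "r * a \<in> I" if "a \<in> I" "r \<in> mpolys V" using I_l_closed[OF that(1), of r] that(2) by simp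
  show "a - b \<in> I" if "a \<in> I" "b \<in> I"
  proof -
    have "b \<in> mpolys V" using that(2) sub by blast
    then have "- b \<in> I" using additive_subgroup.a_inv_closed[OF is_additive_subgroup that(2)] int_poly_ring_a_inv[of b V] by simp
    then show ?thesis using additive_subgroup.a_closed[OF is_additive_subgroup that(1), of "- b"] by simp
  qed
  show "I = mpolys V" if "1 \<in> I" using one_imp_carrier that by simp
qed

text \<open>Setting the variables outside \<open>V\<close> to zero retracts all polynomials onto
  those in \<open>V\<close>. The preimage of \<open>I\<close> is an ideal of the whole type and, by
  \<open>retract_id\<close>, meets \<open>mpolys V\<close> exactly in \<open>I\<close>.\<close>

lemma class_ideal_retract:
  assumes I: "ideal I (int_poly_ring V)"
  defines "ret \<equiv> meval (\<lambda>v. if v \<in> V then mvar v else 0)"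
  shows "class_ideal {p. ret p \<in> I}"
proof -
  note D = ideal_int_poly_ringD[OF I]
  have ret: "ret p \<in> mpolys V" for p
    unfolding ret_def
    by (rule meval_in_mpolys[of _ UNIV]) (auto simp: mpolys_def intro: mpolys_mvar)
  show ?thesis
    by unfold_locales (auto simp: ret_def meval_simps D(1,3) intro: D(4)[OF _ ret, unfolded ret_def])
qed

lemma retract_id:
  assumes "p \<in> mpolys V"
  shows "meval (\<lambda>v. if v \<in> V then mvar v else 0) p = p"
proof -
  have "meval (\<lambda>v. if v \<in> V then mvar v else 0) p = meval mvar p"
    by (rule meval_cong) (use assms in \<open>auto simp: mpolys_def\<close>)
  then show ?thesis by (simp add: meval_mvar_id)
qed

lemma is_hom_Fract: "is_hom (\<lambda>p::'a::idom. Fract p 1)"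
  by (simp add: is_hom_def One_fract_def)

section \<open>Principal open subsets of affine space\<close>

text \<open>This keeps \<open>d + 1\<close>, which occurs in the definition of the chart ring, from becoming \<open>Suc d\<close>.\<close>

declare One_nat_def [simp del]

text \<open>Here \<open>r = 1\<close>: the last variable is an inverse of \<open>F\<close>.\<close>

locale rabinowitsch =
  fixes d :: nat and F :: "nat int_mpoly"
  assumes F: "F \<in> mpolys {..<d}"
begin

definition rel :: "nat int_mpoly" where "rel = mvar d * F - 1"

abbreviation "g \<equiv> \<lambda>_::nat. rel"
abbreviation "B \<equiv> int_poly_ring {..<d + 1}"
abbreviation "CI \<equiv> chart_ideal d 1 g"
abbreviation "C \<equiv> chart_ring d 1 g"
abbreviation "cls \<equiv> chart_class d 1 g"

lemma sub: "p \<in> mpolys {..<d} \<Longrightarrow> p \<in> mpolys {..<d + 1}"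
  using mpolys_mono[of "{..<d}" "{..<d + 1}"] by auto

lemma mvar_d: "mvar d \<in> mpolys {..<d + 1}"
  by (rule mpolys_mvar) simp

lemma rel_carrier: "rel \<in> mpolys {..<d + 1}"
  unfolding rel_def by (intro mpolys_intros mvar_d sub[OF F])

lemma CI_eq: "CI = PIdl\<^bsub>B\<^esub> rel" "CI = Idl\<^bsub>B\<^esub> {rel}"
proof -
  have "g ` {..<1::nat} = {rel}" by auto
  then show "CI = Idl\<^bsub>B\<^esub> {rel}" by (simp only: chart_ideal_def)
  then show "CI = PIdl\<^bsub>B\<^esub> rel"
    using cring.cgenideal_eq_genideal[OF cring_int_poly_ring, of rel "{..<d + 1}"] rel_carrier by simp
qed

lemma CI_iff: "p \<in> CI \<longleftrightarrow> (\<exists>q\<in>mpolys {..<d + 1}. p = q * rel)"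
  by (auto simp: CI_eq(1) cgenideal_def)

lemma ideal_CI: "ideal CI B"
  unfolding CI_eq(1) by (rule cring.cgenideal_ideal[OF cring_int_poly_ring]) (simp add: rel_carrier)

lemmas CI_D = ideal_int_poly_ringD[OF ideal_CI]

lemma cring_C: "cring C"
  unfolding chart_ring_def by (rule ideal.quotient_is_cring[OF ideal_CI cring_int_poly_ring])

lemma cls_hom: "cls \<in> Ring.ring_hom B C"
proof -
  have "cls = (+>\<^bsub>B\<^esub>) CI" by (simp add: chart_class_def fun_eq_iff)
  then show ?thesis using ideal.rcos_ring_hom[OF ideal_CI] by (simp add: chart_ring_def)
qed

lemma carrier_C: "carrier C = cls ` mpolys {..<d + 1}"
  by (auto simp: chart_ring_def chart_class_def carrier_Quot)

lemma cls_simps: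
  assumes "p \<in> mpolys {..<d + 1}" "q \<in> mpolys {..<d + 1}"
  shows "cls p \<otimes>\<^bsub>C\<^esub> cls q = cls (p * q)" "cls p \<oplus>\<^bsub>C\<^esub> cls q = cls (p + q)"
    "cls p [^]\<^bsub>C\<^esub> (k::nat) = cls (p ^ k)" "cls p \<in> carrier C" "\<one>\<^bsub>C\<^esub> = cls 1"
    "cls p = cls q \<longleftrightarrow> p - q \<in> CI" "cls p = \<zero>\<^bsub>C\<^esub> \<longleftrightarrow> p \<in> CI"
proof -
  note h = ring_hom_memE[OF cls_hom]
  show "cls p \<otimes>\<^bsub>C\<^esub> cls q = cls (p * q)" "cls p \<oplus>\<^bsub>C\<^esub> cls q = cls (p + q)" "cls p \<in> carrier C"
    "\<one>\<^bsub>C\<^esub> = cls 1"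
    using h assms by simp_all
  show "cls p [^]\<^bsub>C\<^esub> (k::nat) = cls (p ^ k)"
    using ring_hom_pow[OF cring_int_poly_ring cring_C cls_hom, of p k] assms
    by (simp add: int_poly_ring_pow)
  show "cls p = cls q \<longleftrightarrow> p - q \<in> CI"
    using Quot_eq_iff[OF cring_int_poly_ring ideal_CI, of p q] assms
    by (simp add: chart_class_def int_poly_ring_minus)
  show "cls p = \<zero>\<^bsub>C\<^esub> \<longleftrightarrow> p \<in> CI"
    using Quot_eq_zero_iff[OF cring_int_poly_ring ideal_CI, of p] assms
    by (simp add: chart_class_def chart_ring_def)
qed

lemma cls_carrier: "p \<in> mpolys {..<d + 1} \<Longrightarrow> cls p \<in> carrier C"
  by (rule cls_simps(4))

lemma jacobian_unit: "cls (det (mat 1 1 (\<lambda>(i, j). mpderiv (d + j) (g i)))) \<in> Units C"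
proof -
  have "d \<notin> mvars F" using F by (auto simp: mpolys_def)
  then have "det (mat 1 1 (\<lambda>(i, j). mpderiv (d + j) (g i))) = F"
    by (subst det_single) (simp_all add: rel_def mpderiv_mvar_mult)
  moreover have "cls (mvar d) \<otimes>\<^bsub>C\<^esub> cls F = \<one>\<^bsub>C\<^esub>" "cls F \<otimes>\<^bsub>C\<^esub> cls (mvar d) = \<one>\<^bsub>C\<^esub>"
  proof -
    have "mvar d * F - 1 \<in> CI"
      using CI_iff[of rel] by (auto simp: rel_def intro!: bexI[of _ 1])
    then show "cls (mvar d) \<otimes>\<^bsub>C\<^esub> cls F = \<one>\<^bsub>C\<^esub>" "cls F \<otimes>\<^bsub>C\<^esub> cls (mvar d) = \<one>\<^bsub>C\<^esub>"
      using mvar_d sub[OF F] by (simp_all add: cls_simps mpolys_mult mult.commute)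
  qed
  moreover have "cls F \<in> carrier C" "cls (mvar d) \<in> carrier C"
    using mvar_d sub[OF F] by (simp_all add: cls_simps)
  ultimately show ?thesis by (auto simp: Units_def)
qed

lemma smooth_chartI:
  assumes "f \<in> carrier A - P" "localization_away A f C \<phi>"
  shows "smooth_chart_at A P d 1 g \<phi>"
  using assms jacobian_unit rel_carrier by (auto simp: smooth_chart_at_def)

end

section \<open>The chart ring inside a field of fractions\<close>

locale rabinowitsch_nz = rabinowitsch +
  assumes F_nz: "F \<noteq> 0"
begin

definition ev :: "nat int_mpoly \<Rightarrow> nat int_mpoly fract" where
  "ev = meval (\<lambda>i. if i < d then Fract (mvar i) 1 else inverse (Fract F 1))"

lemma is_hom_ev: "is_hom ev"
  unfolding ev_def by (rule is_hom_meval)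

lemmas ev_simps = is_hom_simps[OF is_hom_ev]

lemma ev_poly:
  assumes "p \<in> mpolys {..<d}"
  shows "ev p = Fract p 1"
proof -
  have "Fract p 1 = Fract (meval mvar p) 1" by (simp add: meval_mvar_id)
  also have "\<dots> = meval (\<lambda>v. Fract (mvar v) 1) p" by (rule is_hom_meval_comp[OF is_hom_Fract])
  also have "\<dots> = ev p"
    unfolding ev_def by (rule meval_cong) (use assms in \<open>auto simp: mpolys_def\<close>)
  finally show ?thesis by simp
qed

lemma ev_mvar_d: "ev (mvar d) = inverse (Fract F 1)"
  by (simp add: ev_def)

lemma Fract_F_nz: "Fract F 1 \<noteq> 0"
  using F_nz by (simp add: Zero_fract_def eq_fract)

lemma ev_rel: "ev rel = 0"
  using Fract_F_nz by (simp add: rel_def ev_simps ev_mvar_d ev_poly F del: inverse_fract)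

lemma ev_CI: "p \<in> CI \<Longrightarrow> ev p = 0"
  unfolding CI_iff by (elim bexE) (simp only: ev_simps(3) ev_rel mult_zero_right)

text \<open>Modulo \<open>CI\<close> the last variable is an inverse of \<open>F\<close>, so a power
  of \<open>F\<close> removes it.\<close>

lemma clear_denominator:
  assumes "p \<in> mpolys {..<d + 1}"
  shows "\<exists>k. \<exists>H\<in>mpolys {..<d}. F ^ k * p - H \<in> CI"
  using assms
proof (induction rule: mpolys_induct)
  case (int c)
  show ?case by (intro exI[of _ 0] bexI[of _ "of_int c"]) (simp_all add: CI_D mpolys_of_int)
next
  case (var v)
  show ?case
  proof (cases "v < d")
    case True
    then show ?thesis by (intro exI[of _ 0] bexI[of _ "mvar v"]) (simp_all add: CI_D mpolys_mvar)
  next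
    case False
    then have "v = d" using var by simp
    moreover have "F * mvar d - 1 \<in> CI"
      using CI_iff[of rel] by (auto simp: rel_def mult.commute intro!: bexI[of _ 1])
    ultimately show ?thesis by (intro exI[of _ 1] bexI[of _ 1]) simp_all
  qed
next
  case (add p q)
  then obtain k H l H' where H: "H \<in> mpolys {..<d}" "F ^ k * p - H \<in> CI"
    "H' \<in> mpolys {..<d}" "F ^ l * q - H' \<in> CI" by blast
  have mem: "F ^ l * (F ^ k * p - H) + F ^ k * (F ^ l * q - H') \<in> CI"
    using H by (intro CI_D(3,4) mpolys_power sub[OF F])
  have eq: "F ^ l * (F ^ k * p - H) + F ^ k * (F ^ l * q - H')
    = F ^ (k + l) * (p + q) - (F ^ l * H + F ^ k * H')"
    by (simp add: algebra_simps power_add)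
  show ?case
    using mem[unfolded eq] H
    by (intro exI[of _ "k + l"] bexI[of _ "F ^ l * H + F ^ k * H'"] mpolys_intros F)
next
  case (mult p q)
  then obtain k H l H' where H: "H \<in> mpolys {..<d}" "F ^ k * p - H \<in> CI"
    "H' \<in> mpolys {..<d}" "F ^ l * q - H' \<in> CI" by blast
  have mem: "(F ^ l * q) * (F ^ k * p - H) + H * (F ^ l * q - H') \<in> CI"
    by (intro CI_D(3,4) mpolys_mult mpolys_power sub[OF F] sub[OF H(1)] mult.hyps H(2,4))
  have eq: "(F ^ l * q) * (F ^ k * p - H) + H * (F ^ l * q - H')
    = F ^ (k + l) * (p * q) - H * H'"
    by (simp add: algebra_simps power_add)
  show ?case
    using mem[unfolded eq] H by (intro exI[of _ "k + l"] bexI[of _ "H * H'"] mpolys_intros F)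
qed

text \<open>If \<open>p\<close> vanishes in the field, so does the polynomial \<open>H\<close>
  congruent to \<open>F ^ k * p\<close>; polynomials embed in fractions, so \<open>H = 0\<close>.
  The factor \<open>F ^ k\<close> can then be removed because \<open>F\<close> is a unit modulo
  \<open>CI\<close>.\<close>

lemma ev_eq_0_iff:
  assumes p: "p \<in> mpolys {..<d + 1}"
  shows "ev p = 0 \<longleftrightarrow> p \<in> CI"
proof
  assume "p \<in> CI"
  then show "ev p = 0" by (rule ev_CI)
next
  assume ev: "ev p = 0"
  obtain k H where H: "H \<in> mpolys {..<d}" "F ^ k * p - H \<in> CI"
    using clear_denominator[OF p] by blast
  have "ev (F ^ k * p - H) = 0" using H(2) by (rule ev_CI)
  then have "ev H = 0" by (simp add: ev_simps ev)
  then have "H = 0" using ev_poly[OF H(1)] by (simp add: Zero_fract_def eq_fract)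
  then have Fp: "F ^ k * p \<in> CI" using H(2) by simp
  have "mvar d ^ k * F ^ k - 1 \<in> CI"
  proof (induction k)
    case 0
    then show ?case by (simp add: CI_D)
  next
    case (Suc k)
    have "rel \<in> CI" by (auto simp: CI_iff intro!: bexI[of _ 1])
    then have "(mvar d * F) * (mvar d ^ k * F ^ k - 1) + rel \<in> CI"
      using Suc by (intro CI_D(3,4) mpolys_intros sub[OF F] mvar_d)
    then show ?case by (simp add: rel_def algebra_simps)
  qed
  note inv = this
  have "mvar d ^ k * (F ^ k * p) - p * (mvar d ^ k * F ^ k - 1) \<in> CI"
    by (rule CI_D(5)[OF CI_D(4)[OF Fp] CI_D(4)[OF inv]]) (use p in \<open>simp_all add: mpolys_power mvar_d\<close>)
  then show "p \<in> CI" by (simp add: algebra_simps)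
qed

lemma eq_mod_CI:
  assumes "p \<in> mpolys {..<d + 1}" "q \<in> mpolys {..<d + 1}"
  shows "cls p = cls q \<longleftrightarrow> ev p = ev q"
  using cls_simps(6)[OF assms] ev_eq_0_iff[OF mpolys_diff[OF assms]] by (simp add: ev_simps)

text \<open>
  The map \<open>v \<mapsto> \<Phi> v\<close> identifies \<open>\<int>[V]/I\<close> localised at \<open>f\<close> with the chart ring; \<open>\<sigma>\<close> is its inverse on the
  coordinates. Both directions are controlled by evaluation in the field of fractions.
\<close>

lemma chart_localization:
  fixes \<Phi> :: "'v \<Rightarrow> nat int_mpoly" and \<sigma> :: "nat \<Rightarrow> 'v int_mpoly"
  assumes I: "ideal I (int_poly_ring V)"
    and \<Phi>: "\<And>v. v \<in> V \<Longrightarrow> \<Phi> v \<in> mpolys {..<d + 1}"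
    and kill: "\<And>p. p \<in> I \<Longrightarrow> ev (meval \<Phi> p) = 0"
    and f: "f \<in> mpolys V" and r: "r \<in> mpolys {..<d + 1}" "ev (meval \<Phi> f) * ev r = 1"
    and \<sigma>: "\<And>i. i < d \<Longrightarrow> \<sigma> i \<in> mpolys V" "\<And>i. i < d \<Longrightarrow> ev (meval \<Phi> (\<sigma> i)) = Fract (mvar i) 1"
    and b: "b \<in> mpolys V" "meval \<sigma> F * b - f ^ k \<in> I"
    and gen: "\<And>v. v \<in> V \<Longrightarrow> \<exists>G\<in>mpolys {..<d}. \<exists>H\<in>mpolys {..<d}. \<exists>b\<in>mpolys V. \<exists>k.
        mvar v * meval \<sigma> G - meval \<sigma> H \<in> I \<and> meval \<sigma> G * b - f ^ k \<in> I"
  shows "localization_away (int_poly_ring V Quot I) (I +>\<^bsub>int_poly_ring V\<^esub> f) C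
    (lift_coset (\<lambda>p. cls (meval \<Phi> p)))" (is "localization_away _ _ _ (lift_coset ?h)")
    and "p \<in> mpolys V \<Longrightarrow> lift_coset (\<lambda>p. cls (meval \<Phi> p)) (I +>\<^bsub>int_poly_ring V\<^esub> p) = cls (meval \<Phi> p)"
proof -
  note ID = ideal_int_poly_ringD[OF I]
  have m: "meval \<Phi> p \<in> mpolys {..<d + 1}" if "p \<in> mpolys V" for p
    using meval_in_mpolys[OF that] \<Phi> by blast
  have \<sigma>m: "meval \<sigma> p \<in> mpolys V" if "p \<in> mpolys {..<d}" for p
    using meval_in_mpolys[OF that] \<sigma>(1) by blast
  have hz: "?h p = \<zero>\<^bsub>C\<^esub> \<longleftrightarrow> ev (meval \<Phi> p) = 0" if "p \<in> mpolys V" for p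
    using cls_simps(7)[OF m m] ev_eq_0_iff[OF m] that by blast
  have h: "?h \<in> Ring.ring_hom (int_poly_ring V) C"
    by (rule ring_hom_memI)
      (simp_all add: m cls_simps(1,2) meval_simps cls_simps(5)[OF mpolys_0 mpolys_0] cls_carrier)
  have ker: "?h a = \<zero>\<^bsub>C\<^esub>" if "a \<in> I" for a
    using hz[of a] kill[OF that] ID(2) that by blast
  show "p \<in> mpolys V \<Longrightarrow> lift_coset ?h (I +>\<^bsub>int_poly_ring V\<^esub> p) = ?h p"
    using lift_coset[OF cring_int_poly_ring I cring_C h ker, of p] by simp
  have invert: "ev (meval \<Phi> (meval \<sigma> p)) = Fract p 1" if "p \<in> mpolys {..<d}" for p
  proof -
    have "ev (meval \<Phi> (meval \<sigma> p)) = meval (\<lambda>i. ev (meval \<Phi> (\<sigma> i))) p"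
      by (simp add: is_hom_meval_comp[OF is_hom_meval] is_hom_meval_comp[OF is_hom_ev])
    also have "\<dots> = meval (\<lambda>i. Fract (mvar i) 1) p"
      by (rule meval_cong) (use that \<sigma>(2) in \<open>auto simp: mpolys_def\<close>)
    also have "\<dots> = Fract (meval mvar p) 1"
      by (rule is_hom_meval_comp[OF is_hom_Fract, symmetric])
    finally show ?thesis by (simp add: meval_mvar_id)
  qed
  show "localization_away (int_poly_ring V Quot I) (I +>\<^bsub>int_poly_ring V\<^esub> f) C (lift_coset ?h)"
  proof (rule localization_away_lift[OF cring_int_poly_ring I cring_C h ker])
    show "f \<in> carrier (int_poly_ring V)" using f by simp
    have "cls (meval \<Phi> f * r) = cls 1"
      using r m[OF f] by (subst eq_mod_CI) (auto simp: ev_simps intro: mpolys_mult)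
    then have "cls (meval \<Phi> f) \<otimes>\<^bsub>C\<^esub> cls r = \<one>\<^bsub>C\<^esub>" "cls r \<otimes>\<^bsub>C\<^esub> cls (meval \<Phi> f) = \<one>\<^bsub>C\<^esub>"
      using cls_simps(1)[OF m[OF f] r(1)] cls_simps(1)[OF r(1) m[OF f]] cls_simps(5)[OF r(1) r(1)]
      by (simp_all add: mult.commute)
    then show "?h f \<in> Units C"
      using cls_carrier[OF m[OF f]] cls_carrier[OF r(1)] unfolding Units_def by blast
  next
    fix c assume "c \<in> carrier C"
    then obtain p where p: "c = cls p" "p \<in> mpolys {..<d + 1}" by (auto simp: carrier_C)
    have "\<exists>a\<in>mpolys V. \<exists>k. ev p * ev (meval \<Phi> f) ^ k = ev (meval \<Phi> a)"
      using p(2)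
    proof (induction rule: mpolys_induct)
      case (int c)
      show ?case by (intro bexI[of _ "of_int c"] exI[of _ 0]) (simp_all add: ev_simps meval_simps mpolys_of_int)
    next
      case (var v)
      show ?case
      proof (cases "v < d")
        case True
        have "ev (mvar v) = Fract (mvar v) 1" by (rule ev_poly) (simp add: True mpolys_mvar)
        then show ?thesis
          by (intro bexI[of _ "\<sigma> v"] exI[of _ 0]) (simp_all add: \<sigma>[OF True])
      next
        case False
        then have v: "v = d" using var by simp
        \<comment> \<open>Since \<open>F\<close>, expressed in \<open>V\<close>, divides
          \<open>f ^ k\<close> modulo \<open>I\<close>, the cofactor \<open>b\<close> is the
          numerator of its inverse over \<open>f ^ k\<close>.\<close>
        have "ev (meval \<Phi> (meval \<sigma> F * b - f ^ k)) = 0" by (rule kill[OF b(2)])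
        then have *: "ev (meval \<Phi> f) ^ k = Fract F 1 * ev (meval \<Phi> b)"
          by (simp add: meval_simps ev_simps invert F)
        have "ev (mvar v) * ev (meval \<Phi> f) ^ k = (inverse (Fract F 1) * Fract F 1) * ev (meval \<Phi> b)"
          unfolding v ev_mvar_d * by (simp only: mult.assoc)
        then have "ev (mvar v) * ev (meval \<Phi> f) ^ k = ev (meval \<Phi> b)"
          using left_inverse[OF Fract_F_nz] by (simp only: mult_1_left)
        then show ?thesis using b(1) by blast
      qed
    next
      case (add p q)
      then obtain a k a' k' where a: "a \<in> mpolys V" "ev p * ev (meval \<Phi> f) ^ k = ev (meval \<Phi> a)"
        "a' \<in> mpolys V" "ev q * ev (meval \<Phi> f) ^ k' = ev (meval \<Phi> a')" by blast
      have "ev (p + q) * ev (meval \<Phi> f) ^ (k + k') = ev (meval \<Phi> (a * f ^ k' + a' * f ^ k))"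
        by (simp add: ev_simps meval_simps a(2,4)[symmetric] power_add algebra_simps)
      then show ?case using a f by (blast intro: mpolys_intros)
    next
      case (mult p q)
      then obtain a k a' k' where a: "a \<in> mpolys V" "ev p * ev (meval \<Phi> f) ^ k = ev (meval \<Phi> a)"
        "a' \<in> mpolys V" "ev q * ev (meval \<Phi> f) ^ k' = ev (meval \<Phi> a')" by blast
      have "ev (p * q) * ev (meval \<Phi> f) ^ (k + k') = ev (meval \<Phi> (a * a'))"
        by (simp add: ev_simps meval_simps a(2,4)[symmetric] power_add algebra_simps)
      then show ?case using a by (blast intro: mpolys_intros)
    qed
    then obtain a k where a: "a \<in> mpolys V" "ev p * ev (meval \<Phi> f) ^ k = ev (meval \<Phi> a)" by blast
    have "cls (p * meval \<Phi> f ^ k) = cls (meval \<Phi> a)"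
      using a p m[OF f] m[OF a(1)] by (subst eq_mod_CI) (auto simp: ev_simps intro: mpolys_intros)
    then show "\<exists>a\<in>carrier (int_poly_ring V). \<exists>k::nat. c \<otimes>\<^bsub>C\<^esub> (?h f [^]\<^bsub>C\<^esub> k) = ?h a"
      using a p m[OF f] by (intro bexI[of _ a] exI[of _ k]) (auto simp: cls_simps mpolys_power)
  next
    fix a assume a: "a \<in> carrier (int_poly_ring V)" "?h a = \<zero>\<^bsub>C\<^esub>"
    then have ev0: "ev (meval \<Phi> a) = 0" using hz by simp
    have aV: "a \<in> mpolys V" using a by simp
    \<comment> \<open>Every polynomial in \<open>V\<close> is a fraction with numerator
      \<open>H\<close> and denominator \<open>G\<close> in the chart coordinates, and
      \<open>G\<close> divides a power of \<open>f\<close> modulo \<open>I\<close>. If its image is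
      zero, then \<open>H = 0\<close>, and the cofactor \<open>b\<close> turns \<open>G\<close> into
      that power.\<close>
    then have "\<exists>G\<in>mpolys {..<d}. \<exists>H\<in>mpolys {..<d}. \<exists>b\<in>mpolys V. \<exists>k.
        a * meval \<sigma> G - meval \<sigma> H \<in> I \<and> meval \<sigma> G * b - f ^ k \<in> I"
    proof (induction rule: mpolys_induct)
      case (int c)
      show ?case
        by (rule bexI[of _ 1], rule bexI[of _ "of_int c"], rule bexI[of _ 1], rule exI[of _ 0])
          (simp_all add: meval_simps ID mpolys_of_int)
    next
      case (var v)
      then show ?case by (rule gen)
    next
      case (add p q)
      then obtain G H b k G' H' b' k' where *: "G \<in> mpolys {..<d}" "H \<in> mpolys {..<d}" "b \<in> mpolys V"
        "p * meval \<sigma> G - meval \<sigma> H \<in> I" "meval \<sigma> G * b - f ^ k \<in> I"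
        "G' \<in> mpolys {..<d}" "H' \<in> mpolys {..<d}" "b' \<in> mpolys V"
        "q * meval \<sigma> G' - meval \<sigma> H' \<in> I" "meval \<sigma> G' * b' - f ^ k' \<in> I" by metis
      have "meval \<sigma> G' * (p * meval \<sigma> G - meval \<sigma> H) + meval \<sigma> G * (q * meval \<sigma> G' - meval \<sigma> H') \<in> I"
        using * by (intro ID(3,4) \<sigma>m)
      then have 1: "(p + q) * meval \<sigma> (G * G') - meval \<sigma> (H * G' + H' * G) \<in> I"
        by (simp add: meval_simps algebra_simps)
      have "(meval \<sigma> G' * b') * (meval \<sigma> G * b - f ^ k) + f ^ k * (meval \<sigma> G' * b' - f ^ k') \<in> I"
        using * by (intro ID(3,4) \<sigma>m mpolys_intros f)
      then have 2: "meval \<sigma> (G * G') * (b * b') - f ^ (k + k') \<in> I"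
        by (simp add: meval_simps algebra_simps power_add)
      show ?case
        by (rule bexI[of _ "G * G'"], rule bexI[of _ "H * G' + H' * G"], rule bexI[of _ "b * b'"],
            rule exI[of _ "k + k'"]) (use 1 2 * in \<open>auto intro!: mpolys_intros\<close>)
    next
      case (mult p q)
      then obtain G H b k G' H' b' k' where *: "G \<in> mpolys {..<d}" "H \<in> mpolys {..<d}" "b \<in> mpolys V"
        "p * meval \<sigma> G - meval \<sigma> H \<in> I" "meval \<sigma> G * b - f ^ k \<in> I"
        "G' \<in> mpolys {..<d}" "H' \<in> mpolys {..<d}" "b' \<in> mpolys V"
        "q * meval \<sigma> G' - meval \<sigma> H' \<in> I" "meval \<sigma> G' * b' - f ^ k' \<in> I" by metis
      have "(q * meval \<sigma> G') * (p * meval \<sigma> G - meval \<sigma> H) + meval \<sigma> H * (q * meval \<sigma> G' - meval \<sigma> H') \<in> I"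
        using * mult by (intro ID(3,4) \<sigma>m mpolys_intros)
      then have 1: "(p * q) * meval \<sigma> (G * G') - meval \<sigma> (H * H') \<in> I"
        by (simp add: meval_simps algebra_simps)
      have "(meval \<sigma> G' * b') * (meval \<sigma> G * b - f ^ k) + f ^ k * (meval \<sigma> G' * b' - f ^ k') \<in> I"
        using * by (intro ID(3,4) \<sigma>m mpolys_intros f)
      then have 2: "meval \<sigma> (G * G') * (b * b') - f ^ (k + k') \<in> I"
        by (simp add: meval_simps algebra_simps power_add)
      show ?case
        by (rule bexI[of _ "G * G'"], rule bexI[of _ "H * H'"], rule bexI[of _ "b * b'"],
            rule exI[of _ "k + k'"]) (use 1 2 * in \<open>auto intro!: mpolys_intros\<close>)
    qed
    then obtain G H b k where *: "G \<in> mpolys {..<d}" "H \<in> mpolys {..<d}" "b \<in> mpolys V"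
        "a * meval \<sigma> G - meval \<sigma> H \<in> I" "meval \<sigma> G * b - f ^ k \<in> I" by metis
    have "ev (meval \<Phi> (a * meval \<sigma> G - meval \<sigma> H)) = 0" by (rule kill[OF *(4)])
    then have "Fract H 1 = 0" using ev0 * invert[of G] invert[of H]
      by (simp add: meval_simps ev_simps del: minus_fract)
    then have "H = 0" by (simp add: Zero_fract_def eq_fract)
    then have "a * meval \<sigma> G \<in> I" using *(4) by (simp add: meval_simps)
    note aG = this
    have "b * (a * meval \<sigma> G) - a * (meval \<sigma> G * b - f ^ k) \<in> I"
      by (rule ID(5)[OF ID(4)[OF aG] ID(4)[OF *(5)]]) (use * aV in simp_all)
    then have "f ^ k * a \<in> I" by (simp add: algebra_simps)
    then show "\<exists>k::nat. (f [^]\<^bsub>int_poly_ring V\<^esub> k) \<otimes>\<^bsub>int_poly_ring V\<^esub> a \<in> I"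
      by (intro exI[of _ k]) (simp add: int_poly_ring_pow)
  qed
qed

end

section \<open>Restriction of a chart to a coordinate hyperplane\<close>

locale hyperplane_chart = rabinowitsch +
  fixes k :: nat
  assumes k: "k < d"
begin

text \<open>Sets variable \<open>k\<close> to zero and closes the gap in the numbering, so that the
  inverse variable \<open>d\<close> becomes \<open>d - 1\<close>, as the chart format requires;
  \<open>sec\<close> reopens the gap.\<close>

definition ren :: "nat \<Rightarrow> nat int_mpoly" where
  "ren i = (if i = k then 0 else if i < k then mvar i else mvar (i - 1))"

definition sec :: "nat \<Rightarrow> nat int_mpoly" where
  "sec i = (if i < k then mvar i else mvar (i + 1))"

definition F' :: "nat int_mpoly" where "F' = meval ren F"

lemma ren_mpolys: "p \<in> mpolys {..<j + 1} \<Longrightarrow> k \<le> j \<Longrightarrow> meval ren p \<in> mpolys {..<j}"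
  by (erule meval_in_mpolys) (auto simp: ren_def intro!: mpolys_mvar)

lemma sec_mpolys: "p \<in> mpolys {..<j} \<Longrightarrow> meval sec p \<in> mpolys {..<j + 1}"
  by (erule meval_in_mpolys) (auto simp: sec_def intro!: mpolys_mvar)

sublocale H: rabinowitsch "d - 1" F'
proof
  show "F' \<in> mpolys {..<d - 1}"
    unfolding F'_def by (rule ren_mpolys) (use F k in auto)
qed

lemma d1: "d - 1 + 1 = d" using k by simp

lemma ren_sec: "meval ren (meval sec p) = p"
proof -
  have "meval ren (meval sec p) = meval (\<lambda>i. meval ren (sec i)) p"
    by (rule is_hom_meval_comp[OF is_hom_meval])
  also have "(\<lambda>i. meval ren (sec i)) = mvar" by (auto simp: fun_eq_iff sec_def ren_def)
  finally show ?thesis by (simp add: meval_mvar_id)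
qed

lemma ren_rel: "meval ren rel = H.rel"
  using k unfolding rel_def H.rel_def by (simp add: meval_simps ren_def F'_def[symmetric])

lemma sec_ren:
  assumes "p \<in> mpolys {..<d + 1}"
  shows "\<exists>q\<in>mpolys {..<d + 1}. p - meval sec (meval ren p) = q * mvar k"
  using assms
proof (induction rule: mpolys_induct)
  case (int c)
  show ?case by (rule bexI[of _ 0]) (simp_all add: meval_simps)
next
  case (var v)
  show ?case
  proof (cases "v = k")
    case True
    then show ?thesis by (intro bexI[of _ 1]) (simp_all add: ren_def meval_simps)
  next
    case False
    then have "meval sec (meval ren (mvar v)) = mvar v" by (auto simp: ren_def sec_def)
    then show ?thesis by (intro bexI[of _ 0]) simp_all
  qed
next
  case (add p q)
  then obtain a b where ab: "a \<in> mpolys {..<d + 1}" "p - meval sec (meval ren p) = a * mvar k"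
    "b \<in> mpolys {..<d + 1}" "q - meval sec (meval ren q) = b * mvar k" by blast
  have "p + q - meval sec (meval ren (p + q))
    = (p - meval sec (meval ren p)) + (q - meval sec (meval ren q))"
    by (simp add: meval_simps)
  also have "\<dots> = (a + b) * mvar k" by (simp only: ab distrib_right)
  finally show ?case by (rule bexI) (intro mpolys_add ab)
next
  case (mult p q)
  then obtain a b where ab: "a \<in> mpolys {..<d + 1}" "p - meval sec (meval ren p) = a * mvar k"
    "b \<in> mpolys {..<d + 1}" "q - meval sec (meval ren q) = b * mvar k" by blast
  have "p * q - meval sec (meval ren (p * q))
    = (p - meval sec (meval ren p)) * q + meval sec (meval ren p) * (q - meval sec (meval ren q))"
    by (simp add: meval_simps algebra_simps)
  also have "\<dots> = (a * q + meval sec (meval ren p) * b) * mvar k"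
    by (simp only: ab) (simp add: algebra_simps)
  finally show ?case
    by (rule bexI)
      (use ab mult.hyps k sec_mpolys[OF ren_mpolys[of p d]] in \<open>auto intro!: mpolys_add mpolys_mult\<close>)
qed

lemma restrict_hom: "(\<lambda>p. H.cls (meval ren p)) \<in> Ring.ring_hom B H.C"
proof -
  have r: "meval ren p \<in> mpolys {..<d - 1 + 1}" if "p \<in> mpolys {..<d + 1}" for p
    using ren_mpolys[OF that] k d1 by simp
  show ?thesis
    by (rule ring_hom_memI)
      (simp_all add: H.cls_simps(1,2)[OF r r] H.cls_carrier[OF r] meval_simps H.cls_simps(5)[OF mpolys_0 mpolys_0])
qed

definition \<tau> :: "nat int_mpoly set \<Rightarrow> nat int_mpoly set" where
  "\<tau> = lift_coset (\<lambda>p. H.cls (meval ren p))"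

lemma restrict_ker:
  assumes "p \<in> CI"
  shows "H.cls (meval ren p) = \<zero>\<^bsub>H.C\<^esub>"
proof -
  obtain q where q: "q \<in> mpolys {..<d + 1}" "p = q * rel" using assms by (auto simp: CI_iff)
  then have "meval ren p = meval ren q * H.rel" by (simp add: meval_simps ren_rel)
  moreover have r: "meval ren q \<in> mpolys {..<d - 1 + 1}" using ren_mpolys[OF q(1)] k d1 by simp
  ultimately have "meval ren p \<in> H.CI" unfolding H.CI_iff by blast
  moreover from this have "meval ren p \<in> mpolys {..<d - 1 + 1}" using H.CI_D(2) by blast
  ultimately show ?thesis using H.cls_simps(7)[of "meval ren p" "meval ren p"] by simp
qed

lemma \<tau>_cls: "p \<in> mpolys {..<d + 1} \<Longrightarrow> \<tau> (cls p) = H.cls (meval ren p)"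
  unfolding \<tau>_def chart_class_def[of d]
  by (rule lift_coset[OF cring_int_poly_ring ideal_CI H.cring_C restrict_hom restrict_ker]) simp_all

lemma \<tau>_hom: "\<tau> \<in> Ring.ring_hom C H.C"
  unfolding \<tau>_def chart_ring_def[of d]
  by (rule lift_coset_hom[OF cring_int_poly_ring ideal_CI H.cring_C restrict_hom restrict_ker])

lemma mvar_k: "mvar k \<in> mpolys {..<d + 1}"
  using k by (intro mpolys_mvar) simp

lemma \<tau>_surj: "\<tau> ` carrier C = carrier H.C"
proof
  show "\<tau> ` carrier C \<subseteq> carrier H.C"
    by (rule image_subsetI) (rule ring_hom_closed[OF \<tau>_hom])
  show "carrier H.C \<subseteq> \<tau> ` carrier C"
  proof
    fix c assume "c \<in> carrier H.C"
    then obtain q where q: "c = H.cls q" "q \<in> mpolys {..<d - 1 + 1}" by (auto simp: H.carrier_C)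
    then have s: "meval sec q \<in> mpolys {..<d + 1}" using sec_mpolys[of q d] d1 by simp
    have "c = \<tau> (cls (meval sec q))" by (simp add: \<tau>_cls[OF s] ren_sec q)
    then show "c \<in> \<tau> ` carrier C" using cls_carrier[OF s] by blast
  qed
qed

lemma \<tau>_ker:
  assumes "c \<in> carrier C"
  shows "\<tau> c = \<zero>\<^bsub>H.C\<^esub> \<longleftrightarrow> c \<in> PIdl\<^bsub>C\<^esub> (cls (mvar k))"
proof -
  obtain p where p: "c = cls p" "p \<in> mpolys {..<d + 1}" using assms by (auto simp: carrier_C)
  have r: "meval ren p \<in> mpolys {..<d - 1 + 1}" using ren_mpolys[OF p(2)] k d1 by simp
  show ?thesis
  proof
    assume "\<tau> c = \<zero>\<^bsub>H.C\<^esub>"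
    then have "meval ren p \<in> H.CI" using H.cls_simps(7)[OF r r] by (simp add: p(1) \<tau>_cls[OF p(2)])
    then obtain q where q: "q \<in> mpolys {..<d - 1 + 1}" "meval ren p = q * H.rel"
      by (auto simp: H.CI_iff)
    have sq: "meval sec q \<in> mpolys {..<d + 1}" using q(1) sec_mpolys[of q d] d1 by simp
    \<comment> \<open>This correction makes the restriction vanish exactly, not only modulo the
      relation, so that \<open>sec_ren\<close> exhibits a multiple of \<open>mvar k\<close>.\<close>
    let ?p = "p - meval sec q * rel"
    have "meval ren ?p = 0" by (simp add: meval_simps ren_sec ren_rel q)
    moreover have "?p \<in> mpolys {..<d + 1}" using p(2) sq by (intro mpolys_intros rel_carrier)
    ultimately obtain a where a: "a \<in> mpolys {..<d + 1}" "?p = a * mvar k"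
      using sec_ren[of ?p] by (auto simp: meval_simps)
    have "p - a * mvar k \<in> CI"
      unfolding a(2)[symmetric] using sq by (auto simp: CI_iff)
    then have "c = cls (a * mvar k)"
      using cls_simps(6)[OF p(2) mpolys_mult[OF a(1) mvar_k]] p(1) by simp
    also have "\<dots> = cls a \<otimes>\<^bsub>C\<^esub> cls (mvar k)" using a(1) mvar_k by (simp only: cls_simps(1))
    finally show "c \<in> PIdl\<^bsub>C\<^esub> (cls (mvar k))"
      using cls_carrier[OF a(1)] by (auto simp: cgenideal_def)
  next
    assume "c \<in> PIdl\<^bsub>C\<^esub> (cls (mvar k))"
    then obtain a where a: "a \<in> mpolys {..<d + 1}" "c = cls a \<otimes>\<^bsub>C\<^esub> cls (mvar k)"
      by (auto simp: cgenideal_def carrier_C)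
    then have "c = cls (a * mvar k)" using mvar_k by (simp only: cls_simps(1))
    then have "\<tau> c = H.cls 0"
      using \<tau>_cls[OF mpolys_mult[OF a(1) mvar_k]] by (simp add: meval_simps ren_def)
    then show "\<tau> c = \<zero>\<^bsub>H.C\<^esub>"
      using H.cls_simps(7)[OF mpolys_0 mpolys_0] H.CI_D(1) by simp
  qed
qed

lemma smooth_chart_quotient:
  assumes A: "cring A" and D: "ideal D A" and f: "f \<in> carrier A"
    and loc: "localization_away A f C \<phi>"
    and D_eq: "Idl\<^bsub>C\<^esub> (\<phi> ` D) = PIdl\<^bsub>C\<^esub> (cls (mvar k))"
    and P: "D +>\<^bsub>A\<^esub> f \<notin> P"
  shows "smooth_chart_at (A Quot D) P (d - 1) 1 H.g (lift_coset (\<tau> \<circ> \<phi>))"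
proof (rule H.smooth_chartI)
  show "D +>\<^bsub>A\<^esub> f \<in> carrier (A Quot D) - P" using f P by (auto simp: carrier_Quot)
  show "localization_away (A Quot D) (D +>\<^bsub>A\<^esub> f) H.C (lift_coset (\<tau> \<circ> \<phi>))"
    by (rule localization_away_quotient[OF A D f loc cring_C H.cring_C \<tau>_hom \<tau>_surj])
      (simp only: \<tau>_ker D_eq)
qed

end

section \<open>The chart of a triangulation\<close>

lemma ideal_hom_kernel:
  assumes "is_hom h"
  shows "ideal {p \<in> mpolys V. h p = 0} (int_poly_ring V)"
proof (rule idealI[OF ring_int_poly_ring])
  interpret cring "int_poly_ring V" by (rule cring_int_poly_ring)
  note h = is_hom_simps[OF assms]
  show "subgroup {p \<in> mpolys V. h p = 0} (add_monoid (int_poly_ring V))"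
  proof (rule add.subgroupI)
    show "{p \<in> mpolys V. h p = 0} \<noteq> {}" using h(4) mpolys_0 by blast
    show "\<ominus>\<^bsub>int_poly_ring V\<^esub> a \<in> {p \<in> mpolys V. h p = 0}" if "a \<in> {p \<in> mpolys V. h p = 0}" for a
      using that by (simp add: int_poly_ring_a_inv mpolys_uminus h)
  qed (auto simp: h intro: mpolys_add)
qed (auto simp: is_hom_simps[OF assms] intro: mpolys_mult)

lemma hom_kills_Idl:
  assumes "is_hom h" "S \<subseteq> mpolys V" "\<And>s. s \<in> S \<Longrightarrow> h s = 0" "p \<in> Idl\<^bsub>int_poly_ring V\<^esub> S"
  shows "h p = 0"
  using ring.genideal_minimal[OF ring_int_poly_ring ideal_hom_kernel[OF assms(1)], of S V] assms(2-4)
  by blast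

text \<open>The elements \<open>\<phi> a\<close> and \<open>z\<close> differ by the unit
  \<open>w\<close> and thus generate the same ideal.\<close>

lemma Idl_image_PIdl:
  assumes A: "cring A" and C: "cring C" and \<phi>: "\<phi> \<in> Ring.ring_hom A C" and a: "a \<in> carrier A"
    and zw: "z \<in> carrier C" "w \<in> carrier C" "w' \<in> carrier C" "w \<otimes>\<^bsub>C\<^esub> w' = \<one>\<^bsub>C\<^esub>" "\<phi> a = z \<otimes>\<^bsub>C\<^esub> w"
  shows "Idl\<^bsub>C\<^esub> (\<phi> ` (PIdl\<^bsub>A\<^esub> a)) = PIdl\<^bsub>C\<^esub> z"
proof
  interpret A: cring A by fact
  interpret C: cring C by fact
  interpret \<phi>: ring_hom_cring A C \<phi> by (rule ring_hom_cringI'(1)[OF A C \<phi>])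
  have iz: "ideal (PIdl\<^bsub>C\<^esub> z) C" by (rule C.cgenideal_ideal[OF zw(1)])
  show "Idl\<^bsub>C\<^esub> (\<phi> ` (PIdl\<^bsub>A\<^esub> a)) \<subseteq> PIdl\<^bsub>C\<^esub> z"
  proof (rule C.genideal_minimal[OF iz], rule image_subsetI)
    fix y assume "y \<in> PIdl\<^bsub>A\<^esub> a"
    then obtain x where x: "x \<in> carrier A" "y = x \<otimes>\<^bsub>A\<^esub> a" by (auto simp: cgenideal_def)
    then have "\<phi> y = (\<phi> x \<otimes>\<^bsub>C\<^esub> w) \<otimes>\<^bsub>C\<^esub> z"
      using zw a by (simp add: C.m_ac)
    then show "\<phi> y \<in> PIdl\<^bsub>C\<^esub> z" using x zw by (auto simp: cgenideal_def)
  qed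
  have sub: "\<phi> ` (PIdl\<^bsub>A\<^esub> a) \<subseteq> carrier C"
    using a by (auto simp: cgenideal_def)
  have idl: "ideal (Idl\<^bsub>C\<^esub> (\<phi> ` (PIdl\<^bsub>A\<^esub> a))) C" by (rule C.genideal_ideal[OF sub])
  have "\<phi> a \<in> Idl\<^bsub>C\<^esub> (\<phi> ` (PIdl\<^bsub>A\<^esub> a))"
    using C.genideal_self[OF sub] A.cgenideal_self[OF a] by blast
  then have "\<phi> a \<otimes>\<^bsub>C\<^esub> w' \<in> Idl\<^bsub>C\<^esub> (\<phi> ` (PIdl\<^bsub>A\<^esub> a))"
    using ideal.I_r_closed[OF idl] zw(3) by blast
  moreover have "\<phi> a \<otimes>\<^bsub>C\<^esub> w' = z"
    unfolding zw(5) using zw(1-4) by (simp add: C.m_assoc)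
  ultimately have "z \<in> Idl\<^bsub>C\<^esub> (\<phi> ` (PIdl\<^bsub>A\<^esub> a))" by simp
  then show "PIdl\<^bsub>C\<^esub> z \<subseteq> Idl\<^bsub>C\<^esub> (\<phi> ` (PIdl\<^bsub>A\<^esub> a))"
    by (rule C.cgenideal_minimal[OF idl])
qed

context heights
begin

lemma xx_cong:
  assumes "\<And>c. c \<in> T \<Longrightarrow> x c = y c" "0 < m" "m < N"
  shows "xx x (lo m) m = xx y (lo m) m" "xx x m (hi m) = xx y m (hi m)"
proof -
  note lh = lo_hi[OF assms(2,3)]
  have "(lo m, m) \<in> T" if "lo m + 2 \<le> m"
    using that lh assms(3) lh(7) by (auto simp: T_def Ch_def intro: less_trans)
  then show "xx x (lo m) m = xx y (lo m) m" using assms(1) by (simp add: xx_def)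
  have "(m, hi m) \<in> T" if "m + 2 \<le> hi m"
    using that lh assms(2) lh(7) by (auto simp: T_def Ch_def intro: less_trans)
  then show "xx x m (hi m) = xx y m (hi m)" using assms(1) by (simp add: xx_def)
qed

text \<open>The sides of the triangle at an inner vertex are sides of the polygon, chords of
  \<open>T\<close> or \<open>(0, N)\<close>, so \<open>Sf\<close> involves no value of
  \<open>x\<close> outside \<open>T\<close>.\<close>

lemma Pf_cong:
  assumes "\<And>c. c \<in> T \<Longrightarrow> x c = y c" "j \<le> Suc N"
  shows "Pf x i j = Pf y i j"
proof -
  have "Sf x m = Sf y m" if "0 < m" "m < N" for m
    unfolding Sf_def using xx_cong[of x y m] assms(1) that by simp
  then show ?thesis
    using assms unfolding Pf_def by (auto intro!: sum.cong arg_cong2[where f = "(*)"] prod.cong)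
qed

lemma hom_Pf:
  assumes "is_hom h"
  shows "h (Pf x i j) = Pf (\<lambda>c. h (x c)) i j"
proof -
  have "h (xx x p q) = xx (\<lambda>c. h (x c)) p q" for p q
    by (simp add: xx_def is_hom_simps[OF assms])
  then show ?thesis by (simp add: Pf_def Sf_def is_hom_simps[OF assms])
qed

lemma hom_xi:
  assumes "is_hom h"
  shows "h (xi u c) = xi (\<lambda>c. h (u c)) c"
  by (simp add: xi_def is_hom_simps[OF assms])

text \<open>A vertex \<open>m\<close> other than the highest one has the chord
  \<open>(lo m, hi m)\<close> of \<open>T\<close> above it, which does not contain the highest
  vertex. Its summand has a factor zero, and only the summand \<open>1\<close> of the highest vertex
  survives.\<close>

lemma Pf_zero:
  assumes "0 < i" "i < j" "j \<le> N"
  shows "Pf (\<lambda>_. 0) i j = (1 :: 'a::comm_ring_1)"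
proof -
  note t = top[OF assms(2)]
  let ?t = "top i j"
  have "Sf (\<lambda>_. 0 :: 'a) m * (\<Prod>c\<in>{c\<in>T. ins m c \<and> \<not> ins ?t c}. 0) = (if m = ?t then 1 else 0)"
    if m: "m \<in> {i..<j}" for m
  proof (cases "m = ?t")
    case True
    then show ?thesis by (simp add: Sf_def xx_def)
  next
    case False
    have mN: "0 < m" "m < N" using m assms by auto
    note lh = lo_hi[OF mN]
    have tN: "?t \<le> N" using t(2) assms by simp
    have "pr m < pr ?t" using t(3)[of m] m False pr_eq_iff[of m ?t] mN tN by fastforce
    then have out: "\<not> ins ?t (lo m, hi m)" using lh(6)[of ?t] by (auto simp: ins_def)
    then have "(lo m, hi m) \<in> T"
      using t assms by (intro node_in_T mN) (auto simp: ins_def)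
    moreover have "ins m (lo m, hi m)" using lh by (simp add: ins_def)
    ultimately have "(lo m, hi m) \<in> {c\<in>T. ins m c \<and> \<not> ins ?t c}" using out by simp
    then have "{c\<in>T. ins m c \<and> \<not> ins ?t c} \<noteq> {}" by blast
    then have "(\<Prod>c\<in>{c\<in>T. ins m c \<and> \<not> ins ?t c}. 0 :: 'a) = 0"
      by (intro prod_zero) auto
    then show ?thesis using False by simp
  qed
  then show ?thesis using assms t by (simp add: Pf_def)
qed

end

locale dihedral_chart = heights +
  fixes \<kappa> :: "nat \<times> nat \<Rightarrow> 'v" and V :: "'v set" and h :: "nat \<times> nat \<Rightarrow> nat" and d :: nat
  assumes \<kappa>: "bij_betw \<kappa> Ch V" and h: "bij_betw h T {..<d}"
begin

definition u :: "nat \<times> nat \<Rightarrow> 'v int_mpoly" where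
  "u c = mvar (\<kappa> c)"

definition relP :: "nat \<Rightarrow> nat \<Rightarrow> nat \<Rightarrow> nat \<Rightarrow> 'v int_mpoly" where
  "relP i j k l = (\<Prod>p\<in>{i..<j}. \<Prod>q\<in>{k..<l}. u (p, q))
    + (\<Prod>p\<in>{j..<k}. \<Prod>q\<in>{l..<Suc N}. u (p, q)) * (\<Prod>p\<in>{0..<i}. \<Prod>q\<in>{j..<k}. u (p, q)) - 1"

definition Rels :: "'v int_mpoly set" where
  "Rels = {relP i j k l | i j k l. i < j \<and> j < k \<and> k < l \<and> l \<le> N}"

definition I :: "'v int_mpoly set" where
  "I = Idl\<^bsub>int_poly_ring V\<^esub> Rels"

definition X :: "nat \<times> nat \<Rightarrow> nat int_mpoly" where "X c = mvar (h c)"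

definition pairs :: "(nat \<times> nat) set" where
  "pairs = {(i, j). 0 < i \<and> i < j \<and> j \<le> N}"

definition FF :: "nat int_mpoly" where
  "FF = (\<Prod>(i, j)\<in>pairs. Pf X i j)"

lemma finite_pairs: "finite pairs"
  by (rule finite_subset[of _ "{..N} \<times> {..N}"]) (auto simp: pairs_def)

lemma u_carrier: "c \<in> Ch \<Longrightarrow> u c \<in> mpolys V"
  unfolding u_def using \<kappa> by (intro mpolys_mvar) (auto simp: bij_betw_def)

lemma relP_carrier:
  assumes "i < j" "j < k" "k < l" "l \<le> N"
  shows "relP i j k l \<in> mpolys V"
  unfolding relP_def using assms
  by (intro mpolys_intros u_carrier) (auto simp: Ch_def)

lemma Rels_carrier: "Rels \<subseteq> mpolys V"
  using relP_carrier by (auto simp: Rels_def)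

lemma ideal_I: "ideal I (int_poly_ring V)"
  unfolding I_def using Rels_carrier by (intro ring.genideal_ideal[OF ring_int_poly_ring]) simp

lemma Rels_I: "Rels \<subseteq> I"
  unfolding I_def using Rels_carrier by (intro ring.genideal_self[OF ring_int_poly_ring]) simp

lemma X_carrier: "c \<in> T \<Longrightarrow> X c \<in> mpolys {..<d}"
  unfolding X_def using h by (intro mpolys_mvar) (auto simp: bij_betw_def)

lemma Pf_X_carrier:
  assumes "j \<le> Suc N"
  shows "Pf X i j \<in> mpolys {..<d}"
proof -
  define Y where "Y c = (if c \<in> T then X c else 0)" for c
  have Y: "Y c \<in> mpolys {..<d}" for c using X_carrier by (auto simp: Y_def)
  have "Pf X i j = Pf Y i j" by (rule Pf_cong) (use assms in \<open>auto simp: Y_def\<close>)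
  also have "\<dots> \<in> mpolys {..<d}"
    unfolding Pf_def Sf_def xx_def using Y by (auto intro!: mpolys_intros)
  finally show ?thesis .
qed

lemma Pf_X_nz:
  assumes "0 < i" "i < j" "j \<le> N"
  shows "Pf X i j \<noteq> 0"
proof
  assume "Pf X i j = 0"
  then have "meval (\<lambda>_. 0 :: int) (Pf X i j) = 0" by (simp add: meval_simps)
  then show False using Pf_zero[OF assms, where ?'a = int] by (simp add: hom_Pf[OF is_hom_meval] X_def)
qed

sublocale R: rabinowitsch_nz d FF
proof
  show "FF \<in> mpolys {..<d}"
    unfolding FF_def by (rule mpolys_prod) (auto simp: pairs_def intro!: Pf_X_carrier)
  show "FF \<noteq> 0"
    unfolding FF_def using finite_pairs Pf_X_nz by (auto simp: pairs_def)
qed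

definition xf :: "nat \<times> nat \<Rightarrow> nat int_mpoly fract" where
  "xf c = Fract (X c) 1"

lemma Pf_xf: "Pf xf i j = Fract (Pf X i j) 1"
  unfolding xf_def by (rule hom_Pf[OF is_hom_Fract, symmetric])

sublocale Q: heights_field N pr xf
proof
  fix c
  have "mvar i \<noteq> (0 :: nat int_mpoly)" for i
  proof
    assume "mvar i = (0 :: nat int_mpoly)"
    then have "meval (\<lambda>_. 1 :: int) (mvar i) = 0" by (simp add: meval_simps)
    then show False by simp
  qed
  then show "xf c \<noteq> 0" by (simp add: xf_def X_def Zero_fract_def eq_fract)
next
  fix i j assume "0 < i" "i < j" "j \<le> N"
  then show "Pf xf i j \<noteq> 0" using Pf_X_nz by (simp add: Pf_xf Zero_fract_def eq_fract)
qed

text \<open>The image of the chart ring in the field of rational functions.\<close>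

definition Loc :: "nat int_mpoly fract set" where
  "Loc = R.ev ` mpolys {..<d + 1}"

lemma Loc_mult: "a \<in> Loc \<Longrightarrow> b \<in> Loc \<Longrightarrow> a * b \<in> Loc"
  by (auto simp: Loc_def R.ev_simps(3)[symmetric] intro: mpolys_mult)

lemma Loc_1: "1 \<in> Loc"
  unfolding Loc_def by (rule image_eqI[of _ _ 1]) (simp_all add: R.ev_simps)

lemma Loc_prod: "(\<And>a. a \<in> A \<Longrightarrow> g a \<in> Loc) \<Longrightarrow> prod g A \<in> Loc"
  by (induction A rule: infinite_finite_induct) (auto intro: Loc_1 Loc_mult)

lemma Loc_poly: "p \<in> mpolys {..<d} \<Longrightarrow> Fract p 1 \<in> Loc"
  unfolding Loc_def by (rule image_eqI[of _ _ p]) (simp_all add: R.ev_poly R.sub)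

lemma Loc_Pf: "j \<le> Suc N \<Longrightarrow> Pf xf i j \<in> Loc"
  unfolding Pf_xf by (intro Loc_poly Pf_X_carrier)

lemma Loc_xf: "c \<in> T \<Longrightarrow> xf c \<in> Loc"
  unfolding xf_def by (intro Loc_poly X_carrier)

lemma Loc_inverse_Pf:
  assumes "i < j" "j \<le> Suc N"
  shows "inverse (Pf xf i j) \<in> Loc"
proof (cases "i = 0 \<or> j = Suc N")
  case True
  then show ?thesis by (auto simp: Pf_def Loc_1)
next
  case False
  then have ij: "(i, j) \<in> pairs" using assms by (auto simp: pairs_def)
  \<comment> \<open>The inverse of one factor of \<open>FF\<close> is the inverse of
    \<open>FF\<close> times the remaining factors.\<close>
  let ?rest = "\<Prod>(i, j)\<in>pairs - {(i, j)}. Pf X i j"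
  have rest: "?rest \<in> mpolys {..<d}"
    by (rule mpolys_prod) (auto simp: pairs_def intro!: Pf_X_carrier)
  have "FF = Pf X i j * ?rest"
    unfolding FF_def by (subst prod.remove[OF finite_pairs ij]) simp
  then have "Fract FF 1 = Pf xf i j * Fract ?rest 1" by (simp add: Pf_xf)
  then have "Pf xf i j * (inverse (Fract FF 1) * Fract ?rest 1) = inverse (Fract FF 1) * Fract FF 1"
    by (simp only: ac_simps)
  also have "\<dots> = 1" by (rule left_inverse[OF R.Fract_F_nz])
  finally have "inverse (Pf xf i j) = inverse (Fract FF 1) * Fract ?rest 1"
    by (rule inverse_unique)
  moreover have "inverse (Fract FF 1) \<in> Loc"
    unfolding Loc_def R.ev_mvar_d[symmetric] using R.mvar_d by blast
  ultimately show ?thesis using Loc_mult Loc_poly[OF rest] by (simp only:)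
qed

definition Wu :: "nat \<times> nat \<Rightarrow> nat int_mpoly fract" where
  "Wu c = Pf xf (Suc (fst c)) (snd c) * Pf xf (fst c) (Suc (snd c))
    * inverse (Pf xf (fst c) (snd c)) * inverse (Pf xf (Suc (fst c)) (Suc (snd c)))"

lemma Wu:
  assumes "c \<in> Ch"
  shows "Wu c \<in> Loc" "inverse (Wu c) \<in> Loc" "Wu c \<noteq> 0" "Uf xf c = (if c \<in> T then xf c else 1) * Wu c"
proof -
  have c: "fst c + 2 \<le> snd c" "snd c \<le> N" using assms by (auto simp: Ch_def)
  show "Wu c \<in> Loc" unfolding Wu_def using c by (intro Loc_mult Loc_Pf Loc_inverse_Pf) auto
  show "inverse (Wu c) \<in> Loc"
    unfolding Wu_def inverse_mult_distrib inverse_inverse_eq using c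
    by (intro Loc_mult Loc_Pf Loc_inverse_Pf) auto
  show "Wu c \<noteq> 0" unfolding Wu_def using c Q.Pf_nz by auto
  show "Uf xf c = (if c \<in> T then xf c else 1) * Wu c"
    by (simp add: Uf_def Wu_def divide_inverse ac_simps)
qed

lemma Uf_Loc: "c \<in> Ch \<Longrightarrow> Uf xf c \<in> Loc"
  using Wu[of c] Loc_xf[of c] Loc_1 Loc_mult by auto

text \<open>Some polynomial in the chart variables representing the cross-ratio, which exists by
  \<open>Uf_Loc\<close>; by \<open>R.eq_mod_CI\<close> any other choice has the same class in the
  chart ring.\<close>

definition \<Phi> :: "'v \<Rightarrow> nat int_mpoly" where
  "\<Phi> v = (SOME p. p \<in> mpolys {..<d + 1} \<and> R.ev p = Uf xf (inv_into Ch \<kappa> v))"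

lemma \<Phi>:
  assumes "c \<in> Ch"
  shows "\<Phi> (\<kappa> c) \<in> mpolys {..<d + 1}" "R.ev (\<Phi> (\<kappa> c)) = Uf xf c"
proof -
  have inv: "inv_into Ch \<kappa> (\<kappa> c) = c"
    using \<kappa> assms by (intro inv_into_f_f) (auto simp: bij_betw_def)
  have "\<exists>p. p \<in> mpolys {..<d + 1} \<and> R.ev p = Uf xf c"
    using Uf_Loc[OF assms] by (auto simp: Loc_def)
  from someI_ex[OF this] show "\<Phi> (\<kappa> c) \<in> mpolys {..<d + 1}" "R.ev (\<Phi> (\<kappa> c)) = Uf xf c"
    unfolding \<Phi>_def inv by auto
qed

definition toQ :: "'v int_mpoly \<Rightarrow> nat int_mpoly fract" where
  "toQ p = R.ev (meval \<Phi> p)"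

lemma is_hom_toQ: "is_hom toQ"
  unfolding toQ_def by (rule is_hom_comp[OF R.is_hom_ev is_hom_meval])

lemmas toQ_simps = is_hom_simps[OF is_hom_toQ]

lemma toQ_u: "c \<in> Ch \<Longrightarrow> toQ (u c) = Uf xf c"
  by (simp add: toQ_def u_def \<Phi>)

lemma toQ_I:
  assumes "p \<in> I"
  shows "toQ p = 0"
proof (rule hom_kills_Idl[OF is_hom_toQ Rels_carrier _ assms[unfolded I_def]])
  fix s assume "s \<in> Rels"
  then obtain i j k l where s: "s = relP i j k l" and *: "i < j" "j < k" "k < l" "l \<le> N"
    by (auto simp: Rels_def)
  have "toQ s = (\<Prod>p\<in>{i..<j}. \<Prod>q\<in>{k..<l}. Uf xf (p, q))
    + (\<Prod>p\<in>{j..<k}. \<Prod>q\<in>{l..<Suc N}. Uf xf (p, q)) * (\<Prod>p\<in>{0..<i}. \<Prod>q\<in>{j..<k}. Uf xf (p, q)) - 1"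
    unfolding s relP_def toQ_simps using *
    by (intro arg_cong2[where f = "(-)"] arg_cong2[where f = "(+)"] arg_cong2[where f = "(*)"]
        prod.cong refl toQ_u) (auto simp: Ch_def)
  then show "toQ s = 0" using Q.Uf_relation[OF *] by simp
qed

definition \<sigma> :: "nat \<Rightarrow> 'v int_mpoly" where
  "\<sigma> i = xi u (inv_into T h i)"

lemma \<sigma>_h: "c \<in> T \<Longrightarrow> \<sigma> (h c) = xi u c"
  unfolding \<sigma>_def using h by (subst inv_into_f_f) (auto simp: bij_betw_def)

lemma xi_carrier: "xi u c \<in> mpolys V"
  unfolding xi_def by (intro mpolys_prod u_carrier) auto

lemma obtain_T: assumes "i < d" obtains c where "c \<in> T" "h c = i"
proof -
  have "i \<in> h ` T" using h assms by (simp add: bij_betw_def)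
  then show ?thesis using that by blast
qed

lemma toQ_\<sigma>:
  assumes "i < d"
  shows "toQ (\<sigma> i) = Fract (mvar i) 1"
proof -
  obtain c where c: "c \<in> T" "h c = i" using obtain_T[OF assms] .
  have "toQ (\<sigma> i) = xi (\<lambda>c. toQ (u c)) c"
    using \<sigma>_h[OF c(1)] c(2) by (simp add: hom_xi[OF is_hom_toQ])
  also have "\<dots> = xi (Uf xf) c" unfolding xi_def by (intro prod.cong) (auto simp: toQ_u)
  also have "\<dots> = xf c" by (rule Q.xi_Uf[OF c(1)])
  finally show ?thesis by (simp add: xf_def X_def c(2))
qed

definition f :: "'v int_mpoly" where
  "f = (\<Prod>c\<in>Ch - T. u c)"

lemma f_carrier: "f \<in> mpolys V"
  unfolding f_def by (intro mpolys_prod u_carrier) auto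

definition J :: "'v int_mpoly set" where
  "J = {p. meval (\<lambda>v. if v \<in> V then mvar v else 0) p \<in> I}"

lemma J_I: "p \<in> mpolys V \<Longrightarrow> p \<in> J \<longleftrightarrow> p \<in> I"
  by (simp add: J_def retract_id)

sublocale K: heights_rel N pr J u
proof (intro heights_rel.intro heights_axioms heights_rel_axioms.intro)
  show "class_ideal J" unfolding J_def by (rule class_ideal_retract[OF ideal_I])
  fix i j k assume *: "0 < i" "i < j" "j < k" "k \<le> N"
  \<comment> \<open>With the first cut at \<open>0\<close> the third product in \<open>relP\<close>
    is empty.\<close>
  have "relP 0 i j k \<in> Rels" using * by (force simp: Rels_def)
  then have "relP 0 i j k \<in> J" using J_I Rels_carrier Rels_I by blast
  then show "(\<Prod>p\<in>{0..<i}. \<Prod>q\<in>{j..<k}. u (p, q)) + (\<Prod>p\<in>{i..<j}. \<Prod>q\<in>{k..<Suc N}. u (p, q)) - 1 \<in> J"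
    by (simp add: relP_def)
qed

lemma meval_\<sigma>_Pf:
  assumes "j \<le> Suc N"
  shows "meval \<sigma> (Pf X i j) = Pf (xi u) i j"
proof -
  have "meval \<sigma> (Pf X i j) = Pf (\<lambda>c. \<sigma> (h c)) i j"
    by (simp add: hom_Pf[OF is_hom_meval] X_def)
  also have "\<dots> = Pf (xi u) i j" by (rule Pf_cong) (use assms \<sigma>_h in auto)
  finally show ?thesis .
qed

definition comp :: "nat \<Rightarrow> nat \<Rightarrow> 'v int_mpoly" where
  "comp i j = (\<Prod>c\<in>(Ch - T) - {d\<in>Ch. fst d < i \<and> j \<le> snd d \<and> \<not> cov d (top i j)}. u c)"

lemma comp_carrier: "comp i j \<in> mpolys V"
  unfolding comp_def by (intro mpolys_prod u_carrier) auto

text \<open>A chord of \<open>T\<close> around the range contains its highest vertex and hence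
  covers it, so \<open>Mon\<close> has no factor from \<open>T\<close> and divides
  \<open>f\<close>.\<close>

lemma Mon_comp:
  assumes "i < j"
  shows "Mon u i j * comp i j = f"
proof -
  have "{d\<in>Ch. fst d < i \<and> j \<le> snd d \<and> \<not> cov d (top i j)} \<subseteq> Ch - T"
    using top(1,2)[OF assms] by (auto simp: cov_T ins_def)
  then show ?thesis
    unfolding Mon_def comp_def f_def using prod.subset_diff[of _ "Ch - T" u] by (simp add: mult.commute)
qed

lemma Pf_comp:
  assumes "i < j" "j \<le> Suc N"
  shows "K.eqJ (meval \<sigma> (Pf X i j) * comp i j) f"
  unfolding meval_\<sigma>_Pf[OF assms(2)] Mon_comp[OF assms(1), symmetric]
  by (intro K.eqJ_mult K.eqJ_refl K.Pf_xi assms)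

lemma eqJ_prod: "(\<And>x. x \<in> A \<Longrightarrow> K.eqJ (a x) (b x)) \<Longrightarrow> K.eqJ (prod a A) (prod b A)"
  by (induction A rule: infinite_finite_induct) (auto intro: K.eqJ_mult)

lemma meval_\<sigma>_carrier: "p \<in> mpolys {..<d} \<Longrightarrow> meval \<sigma> p \<in> mpolys V"
  by (erule meval_in_mpolys) (simp add: \<sigma>_def xi_carrier)

lemma eqJ_I: "K.eqJ a b \<Longrightarrow> a \<in> mpolys V \<Longrightarrow> b \<in> mpolys V \<Longrightarrow> a - b \<in> I"
  using J_I[OF mpolys_diff] by (simp add: K.eqJ_def)

text \<open>Each \<open>Pf\<close> divides \<open>f\<close> modulo \<open>I\<close>, so
  \<open>FF\<close> divides a power of \<open>f\<close>: the inverse of \<open>FF\<close> is a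
  function wherever \<open>f\<close> is invertible.\<close>

lemma FF_comp:
  "meval \<sigma> FF * (\<Prod>(i, j)\<in>pairs. comp i j) - f ^ card pairs \<in> I"
proof (rule eqJ_I)
  have "K.eqJ (\<Prod>x\<in>pairs. meval \<sigma> (Pf X (fst x) (snd x)) * comp (fst x) (snd x)) (\<Prod>x\<in>pairs. f)"
    by (intro eqJ_prod Pf_comp) (auto simp: pairs_def)
  then show "K.eqJ (meval \<sigma> FF * (\<Prod>(i, j)\<in>pairs. comp i j)) (f ^ card pairs)"
    by (simp add: FF_def meval_simps case_prod_unfold prod.distrib)
  show "meval \<sigma> FF * (\<Prod>(i, j)\<in>pairs. comp i j) \<in> mpolys V"
    by (intro mpolys_mult meval_\<sigma>_carrier R.F mpolys_prod) (auto intro: comp_carrier)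
  show "f ^ card pairs \<in> mpolys V" by (intro mpolys_power f_carrier)
qed

lemma u_fraction:
  assumes "c \<in> Ch"
  shows "\<exists>G\<in>mpolys {..<d}. \<exists>H\<in>mpolys {..<d}. \<exists>b\<in>mpolys V. \<exists>k.
      mvar (\<kappa> c) * meval \<sigma> G - meval \<sigma> H \<in> I \<and> meval \<sigma> G * b - f ^ k \<in> I"
proof -
  obtain p q where pq: "c = (p, q)" by force
  have le: "p + 2 \<le> q" "q \<le> N" using assms by (auto simp: pq Ch_def)
  let ?G = "Pf X p q * Pf X (Suc p) (Suc q)"
  let ?H = "(if (p, q) \<in> T then X (p, q) else 1) * (Pf X (Suc p) q * Pf X p (Suc q))"
  let ?b = "comp p q * comp (Suc p) (Suc q)"
  have G: "?G \<in> mpolys {..<d}" using le by (intro mpolys_mult Pf_X_carrier) auto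
  have H: "?H \<in> mpolys {..<d}"
    using le X_carrier by (auto intro!: mpolys_mult Pf_X_carrier)
  have b: "?b \<in> mpolys V" by (intro mpolys_mult comp_carrier)
  have "K.eqJ (u (p, q) * meval \<sigma> ?G) (meval \<sigma> ?H)"
    using K.u_Pf_relation[of p q] assms le
    by (simp add: pq meval_simps meval_\<sigma>_Pf X_def \<sigma>_h split: if_splits)
  then have 1: "mvar (\<kappa> c) * meval \<sigma> ?G - meval \<sigma> ?H \<in> I"
    unfolding pq u_def[symmetric] using assms
    by (intro eqJ_I mpolys_mult meval_\<sigma>_carrier G H u_carrier) (simp_all add: pq)
  have "K.eqJ ((meval \<sigma> (Pf X p q) * comp p q) * (meval \<sigma> (Pf X (Suc p) (Suc q)) * comp (Suc p) (Suc q))) (f * f)"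
    using le by (intro K.eqJ_mult Pf_comp) auto
  then have "K.eqJ (meval \<sigma> ?G * ?b) (f ^ 2)"
    by (simp add: meval_simps power2_eq_square ac_simps)
  then have 2: "meval \<sigma> ?G * ?b - f ^ 2 \<in> I"
    by (intro eqJ_I mpolys_mult meval_\<sigma>_carrier[OF G] b mpolys_power f_carrier)
  show ?thesis using G H b 1 2 by blast
qed

abbreviation "Aring \<equiv> int_poly_ring V Quot I"
abbreviation "coset p \<equiv> I +>\<^bsub>int_poly_ring V\<^esub> p"

definition \<phi> :: "'v int_mpoly set \<Rightarrow> nat int_mpoly set" where
  "\<phi> = lift_coset (\<lambda>p. R.cls (meval \<Phi> p))"

lemma \<Phi>_carrier: "v \<in> V \<Longrightarrow> \<Phi> v \<in> mpolys {..<d + 1}"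
  using \<kappa> \<Phi>(1) by (auto simp: bij_betw_def)

lemma localization: "localization_away Aring (coset f) R.C \<phi>"
  and \<phi>_coset: "p \<in> mpolys V \<Longrightarrow> \<phi> (coset p) = R.cls (meval \<Phi> p)"
proof -
  \<comment> \<open>Off \<open>T\<close> a cross-ratio equals its unit part \<open>Wu\<close>, so
    this represents the inverse of the image of \<open>f\<close>.\<close>
  have "(\<Prod>c\<in>Ch - T. inverse (Wu c)) \<in> Loc" by (intro Loc_prod Wu) auto
  then obtain r where r: "r \<in> mpolys {..<d + 1}" "R.ev r = (\<Prod>c\<in>Ch - T. inverse (Wu c))"
    by (auto simp: Loc_def)
  have "toQ f = (\<Prod>c\<in>Ch - T. Wu c)"
    unfolding f_def toQ_simps by (intro prod.cong) (auto simp: toQ_u Wu)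
  then have "R.ev (meval \<Phi> f) * R.ev r = (\<Prod>c\<in>Ch - T. Wu c * inverse (Wu c))"
    by (simp add: toQ_def r(2) prod.distrib)
  also have "\<dots> = 1" by (intro prod.neutral) (auto simp: Wu)
  finally have fr: "R.ev (meval \<Phi> f) * R.ev r = 1" .
  have b: "(\<Prod>(i, j)\<in>pairs. comp i j) \<in> mpolys V"
    by (intro mpolys_prod) (auto intro: comp_carrier)
  have \<sigma>: "\<sigma> i \<in> mpolys V" for i by (simp add: \<sigma>_def xi_carrier)
  have gen: "\<exists>G\<in>mpolys {..<d}. \<exists>H\<in>mpolys {..<d}. \<exists>b\<in>mpolys V. \<exists>k.
      mvar v * meval \<sigma> G - meval \<sigma> H \<in> I \<and> meval \<sigma> G * b - f ^ k \<in> I" if "v \<in> V" for v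
    using u_fraction \<kappa> that by (auto simp: bij_betw_def)
  note L = R.chart_localization[OF ideal_I \<Phi>_carrier toQ_I[unfolded toQ_def] f_carrier r(1) fr \<sigma>
      toQ_\<sigma>[unfolded toQ_def] b FF_comp gen]
  show "localization_away Aring (coset f) R.C \<phi>" unfolding \<phi>_def by (rule L(1))
  show "p \<in> mpolys V \<Longrightarrow> \<phi> (coset p) = R.cls (meval \<Phi> p)" unfolding \<phi>_def by (rule L(2))
qed

lemma cring_A: "cring Aring"
  by (rule ideal.quotient_is_cring[OF ideal_I cring_int_poly_ring])

lemma coset_carrier: "p \<in> mpolys V \<Longrightarrow> coset p \<in> carrier Aring"
  by (auto simp: carrier_Quot)

text \<open>In the chart \<open>u c\<close> becomes the coordinate \<open>x c\<close> times
  \<open>Wu c\<close>, which is a unit there, so both have the same zero scheme.\<close>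

lemma divisor_eq:
  assumes c: "c \<in> T"
  shows "Idl\<^bsub>R.C\<^esub> (\<phi> ` (PIdl\<^bsub>Aring\<^esub> (coset (u c)))) = PIdl\<^bsub>R.C\<^esub> (R.cls (mvar (h c)))"
proof -
  have cCh: "c \<in> Ch" using c T_subset_Ch by auto
  obtain w where w: "w \<in> mpolys {..<d + 1}" "R.ev w = Wu c"
    using Wu(1)[OF cCh] by (auto simp: Loc_def)
  obtain w' where w': "w' \<in> mpolys {..<d + 1}" "R.ev w' = inverse (Wu c)"
    using Wu(2)[OF cCh] by (auto simp: Loc_def)
  have z: "mvar (h c) \<in> mpolys {..<d}" using X_carrier[OF c] by (simp add: X_def)
  have \<phi>hom: "\<phi> \<in> Ring.ring_hom Aring R.C"
    using localization by (simp add: localization_away_def)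
  have "R.cls (w * w') = R.cls 1"
    using w w' Wu(3)[OF cCh] by (subst R.eq_mod_CI) (auto simp: R.ev_simps intro: mpolys_mult)
  then have ww: "R.cls w \<otimes>\<^bsub>R.C\<^esub> R.cls w' = \<one>\<^bsub>R.C\<^esub>"
    using w(1) w'(1) by (simp add: R.cls_simps(1) R.cls_simps(5)[OF w(1) w(1)])
  have m: "meval \<Phi> (u c) = \<Phi> (\<kappa> c)" by (simp add: u_def)
  have "R.cls (\<Phi> (\<kappa> c)) = R.cls (mvar (h c) * w)"
    using w c z Wu(4)[OF cCh] R.ev_poly[OF z]
    by (subst R.eq_mod_CI) (auto simp: R.ev_simps \<Phi>[OF cCh] xf_def X_def intro: mpolys_mult R.sub)
  then have "\<phi> (coset (u c)) = R.cls (mvar (h c)) \<otimes>\<^bsub>R.C\<^esub> R.cls w"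
    using R.sub[OF z] w(1) \<phi>_coset[OF u_carrier[OF cCh]] by (simp add: m R.cls_simps(1))
  then show ?thesis
    by (rule Idl_image_PIdl[OF cring_A R.cring_C \<phi>hom coset_carrier[OF u_carrier[OF cCh]]
          R.cls_carrier[OF R.sub[OF z]] R.cls_carrier[OF w(1)] R.cls_carrier[OF w'(1)] ww])
qed

end

declare One_nat_def [simp]

section \<open>Chords of a labelled polygon\<close>

definition polygon_chords :: "nat \<Rightarrow> (nat \<times> nat) set" where
  "polygon_chords N = {c. fst c + 2 \<le> snd c \<and> snd c \<le> N \<and> c \<noteq> (0, N)}"

lemma (in heights) Ch_eq: "Ch = polygon_chords N"
  by (simp add: Ch_def polygon_chords_def)

text \<open>
  The height of an interior vertex is the length of the shortest chord of \<open>K\<close> that separates it from the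
  side \<open>(0, N)\<close>; the position of the vertex breaks ties.
\<close>

lemma exists_heights:
  fixes K :: "(nat \<times> nat) set"
  assumes N: "3 \<le> N" and K: "K \<subseteq> polygon_chords N"
    and noncross: "\<And>p q p' q'. (p, q) \<in> K \<Longrightarrow> (p', q') \<in> K \<Longrightarrow> p < p' \<Longrightarrow> p' < q \<Longrightarrow> q < q' \<Longrightarrow> False"
  obtains pr where "heights N pr" "K \<subseteq> heights.T N pr"
proof -
  \<comment> \<open>With the side \<open>(0, N)\<close> added, every inner vertex has some chord
    above it and the minimum exists.\<close>
  define K' where "K' = insert (0, N) K"
  define w where "w m = (LEAST s. \<exists>p q. (p, q) \<in> K' \<and> p < m \<and> m < q \<and> s = q - p)" for m
  \<comment> \<open>As \<open>M\<close> exceeds every position, \<open>w m * M + m\<close> compares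
    first by \<open>w\<close> and then by position, and it stays below \<open>M * M\<close>, the
    height of \<open>N\<close>.\<close>
  define M where "M = N + 1"
  have lessM: "m < M \<longleftrightarrow> m \<le> N" for m by (auto simp: M_def)
  have MM: "M * M = N * M + M" by (simp add: M_def)
  define pr where "pr m = (if m = 0 then M * M + 1 else if m = N then M * M
    else w m * M + m)" for m
  have w_ex: "\<exists>p q. (p, q) \<in> K' \<and> p < m \<and> m < q \<and> w m = q - p" if "0 < m" "m < N" for m
    unfolding w_def
    by (rule LeastI[of _ "N - 0"]) (use that in \<open>intro exI[of _ 0] exI[of _ N]; simp add: K'_def\<close>)
  have w_le: "w m \<le> q - p" if "(p, q) \<in> K'" "p < m" "m < q" for m p q
    unfolding w_def by (rule Least_le) (use that in blast)
  have K'_le: "q \<le> N" if "(p, q) \<in> K'" for p q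
    using that K N by (auto simp: K'_def polygon_chords_def)
  have wN: "w m \<le> N" if "0 < m" "m < N" for m
    using w_le[of 0 N m] that by (auto simp: K'_def)
  have prm: "pr m < M * M" if "0 < m" "m < N" for m
  proof -
    have "w m * M \<le> N * M" using wN[OF that] by (rule mult_le_mono1)
    moreover have "m < M" using that by (simp add: lessM)
    moreover have "pr m = w m * M + m" using that by (simp add: pr_def)
    ultimately show ?thesis using MM by linarith
  qed
  have H: "heights N pr"
  proof
    show "3 \<le> N" by fact
    show "pr m < pr 0" if "0 < m" "m < N" for m using prm[OF that] by (simp add: pr_def[of 0])
    show "pr m < pr N" if "0 < m" "m < N" for m using prm[OF that] N by (simp add: pr_def[of N])
    show "inj_on pr {..N}"
    proof (rule inj_onI)
      fix a b assume ab: "a \<in> {..N}" "b \<in> {..N}" "pr a = pr b"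
      have cases: "c = 0 \<or> c = N \<or> 0 < c \<and> c < N" if "c \<in> {..N}" for c using that by auto
      have inner: "a = b" if "0 < a" "a < N" "0 < b" "b < N"
      proof -
        have "(w a * M + a) mod M = (w b * M + b) mod M"
          using ab(3) that by (simp add: pr_def)
        then show ?thesis using that lessM[of a] lessM[of b] by (simp only: mod_mult_self3) simp
      qed
      have ends: "pr 0 = M * M + 1" "pr N = M * M" using N by (simp_all add: pr_def)
      from cases[OF ab(1)] cases[OF ab(2)] show "a = b"
        by (elim disjE) (use prm[of a] prm[of b] ab(3) inner ends in auto)
    qed
  qed
  interpret heights N pr by (rule H)
  have "c \<in> T" if cK: "c \<in> K" for c
  proof -
    obtain p q where c: "c = (p, q)" by force
    have pq: "p + 2 \<le> q" "q \<le> N" "p \<noteq> 0 \<or> q \<noteq> N" using K cK by (auto simp: c polygon_chords_def)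
    have bound: "pr m < pr p \<and> pr m < pr q" if m: "p < m" "m < q" for m
    proof -
      have mN: "0 < m" "m < N" using m pq by auto
      have wm: "w m \<le> q - p" using w_le[of p q m] m cK by (simp add: c K'_def)
      have step: "pr m < pr r" if wr: "0 < r \<Longrightarrow> r < N \<Longrightarrow> q - p < w r" and r: "r \<le> N" for r
      proof (cases "0 < r \<and> r < N")
        case True
        then have "Suc (w m) \<le> w r" using wr wm by simp
        then have "Suc (w m) * M \<le> w r * M" by (rule mult_le_mono1)
        moreover have "pr m = w m * M + m" "pr r = w r * M + r" using True mN by (simp_all add: pr_def)
        moreover have "m < M" using mN by (simp add: lessM)
        moreover have "Suc (w m) * M = w m * M + M" by simp
        ultimately show ?thesis by linarith
      next
        case False
        then have "r = 0 \<or> r = N" using r by auto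
        then show ?thesis using left_high[OF mN] right_high[OF mN] by auto
      qed
      have "pr m < pr p"
      proof (rule step)
        assume "0 < p" "p < N"
        then obtain a b where ab: "(a, b) \<in> K'" "a < p" "p < b" "w p = b - a" using w_ex by blast
        \<comment> \<open>A chord around the end \<open>p\<close> must not cross
          \<open>(p, q)\<close>; it therefore extends at least to \<open>q\<close> and is strictly
          longer.\<close>
        have "q \<le> b"
          using noncross[of a b p q] ab cK pq K'_le[OF ab(1)] unfolding c K'_def by force
        then show "q - p < w p" using ab pq by linarith
      qed (use pq in simp)
      moreover have "pr m < pr q"
      proof (rule step)
        assume "0 < q" "q < N"
        then obtain a b where ab: "(a, b) \<in> K'" "a < q" "q < b" "w q = b - a" using w_ex by blast
        have "a \<le> p"
          using noncross[of p q a b] ab cK pq unfolding c K'_def by force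
        then show "q - p < w q" using ab pq by linarith
      qed (use pq in simp)
      ultimately show ?thesis by simp
    qed
    then show ?thesis using K cK by (auto simp: T_def Ch_eq c)
  qed
  then show thesis using that H by blast
qed

section \<open>From integer labellings to pairs of vertices\<close>

locale labelled_polygon =
  fixes S :: "'s set" and e0 :: "int \<Rightarrow> 's" and N :: nat and \<delta> :: "(int \<Rightarrow> 's) set"
  assumes lab: "edge_labelling S e0" and cardS: "card S = Suc N" and N3: "3 \<le> N"
    and \<delta>: "\<delta> = dihedral_class e0"
begin

definition n :: int where "n = int (Suc N)"

lemma n_ge: "4 \<le> n" "0 < n"
  using N3 by (simp_all add: n_def)

lemma int_less_n: "int p < n \<longleftrightarrow> p \<le> N"
  by (auto simp: n_def)

lemma int_card: "int (card S) = n"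
  by (simp add: cardS n_def)

lemma e0_eq_iff: "e0 i = e0 j \<longleftrightarrow> i mod n = j mod n"
  using lab by (simp add: edge_labelling_def int_card)

lemma cong_iff: "i mod n = j mod n \<longleftrightarrow> n dvd i - j"
  by (rule mod_eq_dvd_iff)

lemma dvd_small: "n dvd x \<Longrightarrow> - n < x \<Longrightarrow> x < n \<Longrightarrow> x = 0"
  using zdvd_not_zless[of x n] zdvd_not_zless[of "- x" n] by force

lemma vertex_eq_iff: "vertex e0 i = vertex e0 j \<longleftrightarrow> i mod n = j mod n"
proof
  assume "i mod n = j mod n"
  moreover from this have "(i + 1) mod n = (j + 1) mod n" by (metis mod_add_left_eq)
  ultimately show "vertex e0 i = vertex e0 j"
    using e0_eq_iff[of i j] e0_eq_iff[of "i + 1" "j + 1"] by (simp add: vertex_def)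
next
  assume "vertex e0 i = vertex e0 j"
  then consider "e0 i = e0 j" | "e0 i = e0 (j + 1)" "e0 (i + 1) = e0 j"
    by (auto simp: vertex_def doubleton_eq_iff)
  then show "i mod n = j mod n"
  proof cases
    case 2
    \<comment> \<open>Two vertices could share their edges in exchanged order only if
      \<open>n\<close> divided \<open>2\<close>.\<close>
    then have "n dvd i - (j + 1)" "n dvd (i + 1) - j" by (simp_all add: e0_eq_iff cong_iff)
    then have "n dvd ((i + 1) - j) - (i - (j + 1))" by (rule dvd_diff[rotated])
    then have "n dvd 2" by simp
    then show ?thesis using dvd_small[of 2] n_ge by simp
  qed (simp add: e0_eq_iff)
qed

lemma chord_eq_iff: "chord e0 i j = chord e0 i' j' \<longleftrightarrow>
    i mod n = i' mod n \<and> j mod n = j' mod n \<or> i mod n = j' mod n \<and> j mod n = i' mod n"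
  by (simp add: chord_def doubleton_eq_iff vertex_eq_iff)

lemma chord_sym: "chord e i j = chord e j i"
  by (simp add: chord_def insert_commute)

lemma chord_shift: "chord e0 (i + n * t) (j + n * s) = chord e0 i j"
  by (simp add: chord_eq_iff)

lemma chord_mod: "chord e0 (i mod n) (j mod n) = chord e0 i j"
  by (simp add: chord_eq_iff)

lemma e0_\<delta>: "e0 \<in> \<delta>"
proof -
  have "e0 = (\<lambda>i. e0 (0 + i))" by simp
  then show ?thesis unfolding \<delta> dihedral_class_def by blast
qed

text \<open>A reflection sends the edges \<open>i\<close> and \<open>i + 1\<close> to
  \<open>k - i\<close> and \<open>k - i - 1\<close>, hence vertex \<open>i\<close> to vertex
  \<open>k - 1 - i\<close>.\<close>

lemma \<delta>_cases:
  assumes "e \<in> \<delta>"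
  obtains (rot) k where "\<And>i. e i = e0 (k + i)" "\<And>i j. chord e i j = chord e0 (k + i) (k + j)"
  | (flip) k where "\<And>i. e i = e0 (k - i)" "\<And>i j. chord e i j = chord e0 (k - 1 - i) (k - 1 - j)"
proof -
  from assms obtain k where "e = (\<lambda>i. e0 (k + i)) \<or> e = (\<lambda>i. e0 (k - i))"
    by (auto simp: \<delta> dihedral_class_def)
  then show thesis
  proof
    assume e: "e = (\<lambda>i. e0 (k + i))"
    have "chord e i j = chord e0 (k + i) (k + j)" for i j
      by (simp add: e chord_def vertex_def add.assoc)
    then show thesis using rot[of k] e by simp
  next
    assume e: "e = (\<lambda>i. e0 (k - i))"
    have "vertex e i = vertex e0 (k - 1 - i)" for i
      by (auto simp: e vertex_def algebra_simps)
    then have "chord e i j = chord e0 (k - 1 - i) (k - 1 - j)" for i j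
      by (simp add: chord_def)
    then show thesis using flip[of k] e by simp
  qed
qed

definition \<kappa> :: "nat \<times> nat \<Rightarrow> 's set set" where
  "\<kappa> c = chord e0 (int (fst c)) (int (snd c))"

lemma inj_\<kappa>: "inj_on \<kappa> (polygon_chords N)"
proof (rule inj_onI)
  fix c c' assume c: "c \<in> polygon_chords N" "c' \<in> polygon_chords N" "\<kappa> c = \<kappa> c'"
  obtain p q p' q' where pq: "c = (p, q)" "c' = (p', q')" by (cases c, cases c')
  have le: "p < q" "q \<le> N" "p' < q'" "q' \<le> N" using c by (auto simp: pq polygon_chords_def)
  have m: "int r mod n = int r" if "r \<le> N" for r using that by (simp add: int_less_n)
  have "p = p' \<and> q = q' \<or> p = q' \<and> q = p'"
    using c(3) le unfolding \<kappa>_def chord_eq_iff pq by (simp add: m)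
  then show "c = c'" using le by (auto simp: pq)
qed

lemma distinct_iff: "distinct [e0 i, e0 (i + 1), e0 j, e0 (j + 1)] \<longleftrightarrow>
    \<not> n dvd i - j \<and> \<not> n dvd i - j - 1 \<and> \<not> n dvd i - j + 1"
proof -
  have "\<not> n dvd 1" "\<not> n dvd -1" using dvd_small[of 1] dvd_small[of "-1"] n_ge by auto
  then show ?thesis by (auto simp: e0_eq_iff cong_iff algebra_simps)
qed

lemma chords_eq: "chords \<delta> = \<kappa> ` polygon_chords N"
proof
  show "chords \<delta> \<subseteq> \<kappa> ` polygon_chords N"
  proof
    fix a assume "a \<in> chords \<delta>"
    then obtain e i j where e: "e \<in> \<delta>" "a = chord e i j" "distinct [e i, e (i + 1), e j, e (j + 1)]"
      by (auto simp: chords_def)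
    from e(1) obtain i' j' where ij: "a = chord e0 i' j'"
      and d: "\<not> n dvd i' - j'" "\<not> n dvd i' - j' - 1" "\<not> n dvd i' - j' + 1"
    proof (cases rule: \<delta>_cases)
      case (rot k)
      then have "distinct [e0 (k + i), e0 (k + i + 1), e0 (k + j), e0 (k + j + 1)]"
        using e(3) by (simp only: rot(1) add.assoc)
      then show ?thesis using that[of "k + i" "k + j"] e(2) rot(2) unfolding distinct_iff by simp
    next
      case (flip k)
      have "distinct [e0 (k - 1 - i), e0 (k - 1 - i + 1), e0 (k - 1 - j), e0 (k - 1 - j + 1)]"
        using e(3) by (auto simp: flip(1) diff_diff_eq add.commute)
      then show ?thesis using that[of "k - 1 - i" "k - 1 - j"] e(2) flip(2) unfolding distinct_iff by simp
    qed
    define p q where "p = i' mod n" and "q = j' mod n"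
    have pq: "0 \<le> p" "p < n" "0 \<le> q" "q < n" using n_ge by (simp_all add: p_def q_def)
    have apq: "a = chord e0 p q" by (simp add: ij p_def q_def chord_mod)
    have "n dvd (i' - j') - (p - q)"
    proof -
      have "n dvd i' - p" "n dvd j' - q" by (simp_all add: p_def q_def)
      then have "n dvd (i' - p) - (j' - q)" by (rule dvd_diff)
      then show ?thesis by (simp add: algebra_simps)
    qed
    note D = this
    have tr: "n dvd i' - j' + x \<longleftrightarrow> n dvd p - q + x" for x
    proof -
      have "i' - j' + x = ((i' - j') - (p - q)) + (p - q + x)" by simp
      then show ?thesis using dvd_add_right_iff[OF D, of "p - q + x"] by (simp only:)
    qed
    have d': "\<not> n dvd p - q" "\<not> n dvd p - q - 1" "\<not> n dvd p - q + 1"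
      using d tr[of 0] tr[of "-1"] tr[of 1] by simp_all
    have nd: "p \<noteq> q" "p \<noteq> q + 1" "q \<noteq> p + 1" "p - q \<noteq> n - 1" "q - p \<noteq> n - 1"
    proof -
      show "p \<noteq> q" "p \<noteq> q + 1" "q \<noteq> p + 1" using d' by auto
      show "p - q \<noteq> n - 1" using d'(3) by auto
      show "q - p \<noteq> n - 1"
      proof
        assume "q - p = n - 1"
        then have "p - q - 1 = - n" by simp
        then show False using d'(2) by (simp only: dvd_minus_iff) simp
      qed
    qed
    show "a \<in> \<kappa> ` polygon_chords N"
    proof (cases "p < q")
      case True
      then have "(nat p, nat q) \<in> polygon_chords N"
        using pq nd by (auto simp: polygon_chords_def n_def)
      moreover have "a = \<kappa> (nat p, nat q)" using pq by (simp add: \<kappa>_def apq)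
      ultimately show ?thesis by blast
    next
      case False
      then have "(nat q, nat p) \<in> polygon_chords N"
        using pq nd by (auto simp: polygon_chords_def n_def)
      moreover have "a = \<kappa> (nat q, nat p)" using pq chord_sym by (simp add: \<kappa>_def apq)
      ultimately show ?thesis by blast
    qed
  qed
  show "\<kappa> ` polygon_chords N \<subseteq> chords \<delta>"
  proof (rule image_subsetI)
    fix c assume c: "c \<in> polygon_chords N"
    obtain p q where pq: "c = (p, q)" by force
    have le: "p + 2 \<le> q" "q \<le> N" "p \<noteq> 0 \<or> q \<noteq> N" using c by (auto simp: pq polygon_chords_def)
    have "distinct [e0 (int p), e0 (int p + 1), e0 (int q), e0 (int q + 1)]"
      unfolding distinct_iff using le dvd_small[of "int p - int q"]
        dvd_small[of "int p - int q - 1"] dvd_small[of "int p - int q + 1"] by (auto simp: n_def)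
    then show "\<kappa> c \<in> chords \<delta>"
      using e0_\<delta> unfolding chords_def \<kappa>_def pq fst_conv snd_conv by blast
  qed
qed

text \<open>
  The two sides of a relation, for four cuts made before the vertices \<open>i < j < k < l\<close> of \<open>{0..N}\<close>. The
  last arc passes through the side \<open>(0, N)\<close>, which splits the chords in \<open>B0\<close> into two families.
\<close>

definition A0 :: "nat \<Rightarrow> nat \<Rightarrow> nat \<Rightarrow> nat \<Rightarrow> (nat \<times> nat) set" where
  "A0 i j k l = {i..<j} \<times> {k..<l}"

definition B0 :: "nat \<Rightarrow> nat \<Rightarrow> nat \<Rightarrow> nat \<Rightarrow> (nat \<times> nat) set" where
  "B0 i j k l = {j..<k} \<times> {l..<Suc N} \<union> {0..<i} \<times> {j..<k}"

lemma A0_B0_polygon: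
  assumes "i < j" "j < k" "k < l" "l \<le> N"
  shows "A0 i j k l \<subseteq> polygon_chords N" "B0 i j k l \<subseteq> polygon_chords N"
  using assms by (auto simp: A0_def B0_def polygon_chords_def)

section \<open>Four arcs in normal position\<close>

definition arcs :: "int \<Rightarrow> int \<Rightarrow> int \<Rightarrow> int \<Rightarrow> 's set set set" where
  "arcs i j k l = {chord e0 p q | p q. p \<in> {i..<j} \<and> q \<in> {k..<l}}"

lemma arcs_image: "arcs i j k l = (\<lambda>(p, q). chord e0 p q) ` ({i..<j} \<times> {k..<l})"
  unfolding arcs_def by auto blast

lemma arcs_sym: "arcs i j k l = arcs k l i j"
  unfolding arcs_def using chord_sym by blast

lemma arcs_shift: "arcs (i + n * t) (j + n * t) (k + n * s) (l + n * s) = arcs i j k l"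
proof -
  have sub: "arcs (i + n * t) (j + n * t) (k + n * s) (l + n * s) \<subseteq> arcs i j k l" for i j k l s t
  proof
    fix a assume "a \<in> arcs (i + n * t) (j + n * t) (k + n * s) (l + n * s)"
    then obtain p q where "a = chord e0 p q" "p \<in> {i + n * t..<j + n * t}" "q \<in> {k + n * s..<l + n * s}"
      by (auto simp: arcs_def)
    then have "a = chord e0 (p - n * t) (q - n * s)" "p - n * t \<in> {i..<j}" "q - n * s \<in> {k..<l}"
      using chord_shift[of "p - n * t" t "q - n * s" s] by auto
    then show "a \<in> arcs i j k l" unfolding arcs_def by blast
  qed
  show ?thesis
    using sub[of i t j k s l] sub[of "i + n * t" "- t" "j + n * t" "k + n * s" "- s" "l + n * s"] by simp
qed

lemma arcs_nat:
  assumes "i < j" "j < k" "k < l" "l \<le> N"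
  shows "arcs (int i) (int j) (int k) (int l) = \<kappa> ` A0 i j k l"
    "arcs (int j) (int k) (int l) (int i + n) = \<kappa> ` B0 i j k l"
proof -
  have nat_arcs: "arcs (int a) (int b) (int c) (int d) = \<kappa> ` ({a..<b} \<times> {c..<d})" for a b c d
  proof
    show "arcs (int a) (int b) (int c) (int d) \<subseteq> \<kappa> ` ({a..<b} \<times> {c..<d})"
    proof
      fix x assume "x \<in> arcs (int a) (int b) (int c) (int d)"
      then obtain p q where pq: "x = chord e0 p q" "p \<in> {int a..<int b}" "q \<in> {int c..<int d}"
        by (auto simp: arcs_def)
      then have "x = \<kappa> (nat p, nat q)" "(nat p, nat q) \<in> {a..<b} \<times> {c..<d}"
        by (auto simp: \<kappa>_def)
      then show "x \<in> \<kappa> ` ({a..<b} \<times> {c..<d})" by blast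
    qed
    show "\<kappa> ` ({a..<b} \<times> {c..<d}) \<subseteq> arcs (int a) (int b) (int c) (int d)"
      unfolding arcs_def \<kappa>_def by force
  qed
  show "arcs (int i) (int j) (int k) (int l) = \<kappa> ` A0 i j k l"
    by (simp add: nat_arcs A0_def)
  have split: "{int l..<int i + n} = {int l..<n} \<union> {n..<int i + n}" using assms by (auto simp: n_def)
  have "arcs (int j) (int k) (int l) (int i + n) = arcs (int j) (int k) (int l) (int (Suc N)) \<union> arcs (int j) (int k) n (int i + n)"
    unfolding arcs_image split n_def[symmetric] Sigma_Un_distrib2 image_Un by (rule refl)
  also have "arcs (int j) (int k) n (int i + n) = arcs (int 0) (int i) (int j) (int k)"
    using arcs_shift[of "int j" 0 "int k" 0 1 "int i"] arcs_sym[of "int j" "int k" 0 "int i"] by simp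
  finally show "arcs (int j) (int k) (int l) (int i + n) = \<kappa> ` B0 i j k l"
    unfolding nat_arcs by (simp add: B0_def image_Un)
qed

text \<open>As long as the last cut lies beyond the side \<open>(0, N)\<close>, it is moved to the
  front as \<open>l - n\<close>. This rotation of the cuts exchanges the two families, whence the
  disjunction, and it decreases the last cut.\<close>

lemma arcs_normal_form:
  assumes "0 \<le> i" "i < j" "j < k" "k < l" "l < i + n"
  shows "\<exists>i' j' k' l'. i' < j' \<and> j' < k' \<and> k' < l' \<and> l' \<le> N \<and>
    (arcs i j k l = \<kappa> ` A0 i' j' k' l' \<and> arcs j k l (i + n) = \<kappa> ` B0 i' j' k' l' \<or>
     arcs i j k l = \<kappa> ` B0 i' j' k' l' \<and> arcs j k l (i + n) = \<kappa> ` A0 i' j' k' l')"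
  using assms
proof (induction "nat l" arbitrary: i j k l rule: less_induct)
  case less
  show ?case
  proof (cases "l < n")
    case True
    obtain i' j' k' l' where ijkl: "i = int i'" "j = int j'" "k = int k'" "l = int l'"
      using less.prems by (metis nonneg_int_cases order.trans less_imp_le)
    have lt: "i' < j'" "j' < k'" "k' < l'" "l' \<le> N"
      using less.prems True by (simp_all add: ijkl int_less_n)
    show ?thesis using lt arcs_nat[OF lt] unfolding ijkl by blast
  next
    case False
    have 1: "arcs (l - n) i j k = arcs j k l (i + n)"
        using arcs_shift[of j 0 k "l - n" 1 i] arcs_sym[of "l - n" i j k] by simp
    have 2: "arcs i j k l = arcs i j k (l - n + n)" by simp
    have IH: "\<exists>i' j' k' l'. i' < j' \<and> j' < k' \<and> k' < l' \<and> l' \<le> N \<and>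
      (arcs (l - n) i j k = \<kappa> ` A0 i' j' k' l' \<and> arcs i j k (l - n + n) = \<kappa> ` B0 i' j' k' l' \<or>
       arcs (l - n) i j k = \<kappa> ` B0 i' j' k' l' \<and> arcs i j k (l - n + n) = \<kappa> ` A0 i' j' k' l')"
      by (rule less.hyps) (use less.prems False in auto)
    have swap: "X1 \<and> Y1 \<or> X2 \<and> Y2" if "Y2 \<and> X2 \<or> Y1 \<and> X1" for X1 X2 Y1 Y2
      using that by blast
    from IH show ?thesis
      unfolding 1 2[symmetric] by (elim exE conjE) (intro exI conjI, assumption+, erule swap)
  qed
qed

lemma join_opposite_arcs_normal_form:
  assumes "join_opposite_arcs S \<delta> A B"
  obtains i j k l where "i < j" "j < k" "k < l" "l \<le> N"
    "A = \<kappa> ` A0 i j k l \<and> B = \<kappa> ` B0 i j k l \<or> A = \<kappa> ` B0 i j k l \<and> B = \<kappa> ` A0 i j k l"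
proof -
  obtain e i j k l where e: "e \<in> \<delta>" and *: "i < j" "j < k" "k < l" "l < i + n"
    and A: "A = {chord e p q | p q. p \<in> {i..<j} \<and> q \<in> {k..<l}}"
    and B: "B = {chord e p q | p q. p \<in> {j..<k} \<and> q \<in> {l..<i + n}}"
    using assms unfolding join_opposite_arcs_def int_card by blast
  obtain i' j' k' l' where **: "i' < j'" "j' < k'" "k' < l'" "l' < i' + n"
    "A = arcs i' j' k' l'" "B = arcs j' k' l' (i' + n)"
    using e
  proof (cases rule: \<delta>_cases)
    case (rot m)
    have shift: "{chord e p q | p q. p \<in> {a..<b} \<and> q \<in> {c..<d}} = arcs (m + a) (m + b) (m + c) (m + d)" for a b c d
    proof
      show "{chord e p q | p q. p \<in> {a..<b} \<and> q \<in> {c..<d}} \<subseteq> arcs (m + a) (m + b) (m + c) (m + d)"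
        unfolding arcs_def rot(2) by force
      show "arcs (m + a) (m + b) (m + c) (m + d) \<subseteq> {chord e p q | p q. p \<in> {a..<b} \<and> q \<in> {c..<d}}"
      proof
        fix x assume "x \<in> arcs (m + a) (m + b) (m + c) (m + d)"
        then obtain p q where "x = chord e0 p q" "p \<in> {m + a..<m + b}" "q \<in> {m + c..<m + d}"
          by (auto simp: arcs_def)
        then have "x = chord e (p - m) (q - m)" "p - m \<in> {a..<b}" "q - m \<in> {c..<d}"
          by (auto simp: rot(2))
        then show "x \<in> {chord e p q | p q. p \<in> {a..<b} \<and> q \<in> {c..<d}}" by blast
      qed
    qed
    have "A = arcs (m + i) (m + j) (m + k) (m + l)" by (simp only: A shift)
    moreover have "B = arcs (m + j) (m + k) (m + l) (m + i + n)" by (simp only: B shift add.assoc)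
    ultimately show ?thesis by (rule that[rotated 4]) (use * in simp_all)
  next
    case (flip m)
    have flipped: "{chord e p q | p q. p \<in> {a..<b} \<and> q \<in> {c..<d}} = arcs (m - b) (m - a) (m - d) (m - c)" for a b c d
    proof
      show "{chord e p q | p q. p \<in> {a..<b} \<and> q \<in> {c..<d}} \<subseteq> arcs (m - b) (m - a) (m - d) (m - c)"
        unfolding arcs_def flip(2) by force
      show "arcs (m - b) (m - a) (m - d) (m - c) \<subseteq> {chord e p q | p q. p \<in> {a..<b} \<and> q \<in> {c..<d}}"
      proof
        fix x assume "x \<in> arcs (m - b) (m - a) (m - d) (m - c)"
        then obtain p q where "x = chord e0 p q" "p \<in> {m - b..<m - a}" "q \<in> {m - d..<m - c}"
          by (auto simp: arcs_def)
        then have "x = chord e (m - 1 - p) (m - 1 - q)" "m - 1 - p \<in> {a..<b}" "m - 1 - q \<in> {c..<d}"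
          by (auto simp: flip(2))
        then show "x \<in> {chord e p q | p q. p \<in> {a..<b} \<and> q \<in> {c..<d}}" by blast
      qed
    qed
    \<comment> \<open>After the reflection the arc through the end of the period comes first; a
      translation by \<open>n\<close> puts it last again.\<close>
    have "arcs (m - k) (m - j) (m - (i + n)) (m - l) = arcs (m - k) (m - j) (m - i) (m - l + n)"
      using arcs_shift[of "m - k" 0 "m - j" "m - (i + n)" 1 "m - l"] by (simp add: algebra_simps)
    then have "B = arcs (m - k) (m - j) (m - i) (m - l + n)" by (simp only: B flipped)
    moreover have "A = arcs (m - l) (m - k) (m - j) (m - i)"
      by (simp only: A flipped arcs_sym[of "m - l" "m - k"])
    ultimately show ?thesis by (intro that[of "m - l" "m - k" "m - j" "m - i"]) (use * in simp_all)
  qed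
  define t where "t = i' div n"
  have i0: "0 \<le> i' - n * t" using n_ge by (simp add: t_def minus_mult_div_eq_mod)
  have A': "A = arcs (i' - n * t) (j' - n * t) (k' - n * t) (l' - n * t)"
    using arcs_shift[of i' "-t" j' k' "-t" l'] **(5) by simp
  have B': "B = arcs (j' - n * t) (k' - n * t) (l' - n * t) (i' - n * t + n)"
    using arcs_shift[of j' "-t" k' l' "-t" "i' + n"] **(6) by (simp add: algebra_simps)
  show thesis
    using arcs_normal_form[of "i' - n * t" "j' - n * t" "k' - n * t" "l' - n * t"] i0 ** that
    unfolding A'[symmetric] B'[symmetric] by auto
qed

definition crossing :: "nat \<times> nat \<Rightarrow> nat \<times> nat \<Rightarrow> bool" where
  "crossing c d \<longleftrightarrow> fst c < fst d \<and> fst d < snd c \<and> snd c < snd d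
     \<or> fst d < fst c \<and> fst c < snd d \<and> snd d < snd c"

text \<open>The normal form of arcs also handles single chords: when the ends of two crossing chords
  serve as cuts, the chords fall into opposite families, and in normal position these visibly
  cross.\<close>

lemma chords_cross_iff:
  assumes c: "c \<in> polygon_chords N" and d: "d \<in> polygon_chords N"
  shows "chords_cross S \<delta> (\<kappa> c) (\<kappa> d) \<longleftrightarrow> crossing c d"
proof
  assume "chords_cross S \<delta> (\<kappa> c) (\<kappa> d)"
  then obtain e i j k l where e: "e \<in> \<delta>" and *: "i < j" "j < k" "k < l" "l < i + n"
    and a: "\<kappa> c = chord e i k" and b: "\<kappa> d = chord e j l"
    unfolding chords_cross_def int_card by blast
  let ?A = "{chord e p q | p q. p \<in> {i..<j} \<and> q \<in> {k..<l}}"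
  let ?B = "{chord e p q | p q. p \<in> {j..<k} \<and> q \<in> {l..<i + n}}"
  have "join_opposite_arcs S \<delta> ?A ?B"
    unfolding join_opposite_arcs_def int_card using e * by blast
  then obtain i' j' k' l' where **: "i' < j'" "j' < k'" "k' < l'" "l' \<le> N"
    and AB: "?A = \<kappa> ` A0 i' j' k' l' \<and> ?B = \<kappa> ` B0 i' j' k' l' \<or> ?A = \<kappa> ` B0 i' j' k' l' \<and> ?B = \<kappa> ` A0 i' j' k' l'"
    by (rule join_opposite_arcs_normal_form)
  have cA: "\<kappa> c \<in> ?A" by (intro CollectI exI[of _ i] exI[of _ k]) (use a * in simp)
  have dB: "\<kappa> d \<in> ?B" by (intro CollectI exI[of _ j] exI[of _ l]) (use b * in simp)
  note mem = inj_on_image_mem_iff[OF inj_\<kappa> _ A0_B0_polygon(1)[OF **]]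
    inj_on_image_mem_iff[OF inj_\<kappa> _ A0_B0_polygon(2)[OF **]]
  have "c \<in> A0 i' j' k' l' \<and> d \<in> B0 i' j' k' l' \<or> c \<in> B0 i' j' k' l' \<and> d \<in> A0 i' j' k' l'"
    using AB
  proof (elim disjE conjE)
    assume "?A = \<kappa> ` A0 i' j' k' l'" "?B = \<kappa> ` B0 i' j' k' l'"
    then show ?thesis using cA dB mem(1)[OF c] mem(2)[OF d] by simp
  next
    assume "?A = \<kappa> ` B0 i' j' k' l'" "?B = \<kappa> ` A0 i' j' k' l'"
    then show ?thesis using cA dB mem(2)[OF c] mem(1)[OF d] by simp
  qed
  then show "crossing c d" using ** by (auto simp: A0_def B0_def crossing_def)
next
  assume X: "crossing c d"
  obtain p q p' q' where pq: "c = (p, q)" "d = (p', q')" by (cases c, cases d)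
  have le: "q \<le> N" "q' \<le> N" using c d by (auto simp: pq polygon_chords_def)
  show "chords_cross S \<delta> (\<kappa> c) (\<kappa> d)"
  proof (cases "p < p'")
    case True
    then have "int p < int p'" "int p' < int q" "int q < int q'" "int q' < int p + n"
      using X le by (auto simp: crossing_def pq n_def)
    then show ?thesis
      unfolding chords_cross_def int_card \<kappa>_def pq fst_conv snd_conv
      using e0_\<delta> by blast
  next
    case False
    \<comment> \<open>Here \<open>d\<close> starts before \<open>c\<close>; its first vertex is
      taken one period later, so that the ends alternate starting from \<open>p\<close>.\<close>
    then have "int p < int q'" "int q' < int q" "int q < int p' + n" "int p' + n < int p + n"
      using X le by (auto simp: crossing_def pq n_def)
    moreover have "\<kappa> d = chord e0 (int q') (int p' + n)"
      using chord_shift[of "int q'" 0 "int p'" 1] chord_sym by (simp add: \<kappa>_def pq)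
    moreover have "\<kappa> c = chord e0 (int p) (int q)" by (simp add: \<kappa>_def pq)
    ultimately show ?thesis
      unfolding chords_cross_def int_card using e0_\<delta> by blast
  qed
qed

text \<open>A few extreme members of one family confine a chord crossing all of them to the other
  family. Hence families that join opposite arcs cross completely.\<close>

lemma A0_B0_crossing:
  assumes "i < j" "j < k" "k < l" "l \<le> N" "c \<in> polygon_chords N"
  shows "c \<in> A0 i j k l \<longleftrightarrow> (\<forall>d\<in>B0 i j k l. crossing c d)"
    "c \<in> B0 i j k l \<longleftrightarrow> (\<forall>d\<in>A0 i j k l. crossing c d)"
proof -
  obtain p q where pq: "c = (p, q)" by force
  have le: "p < q" "q \<le> N" using assms by (auto simp: pq polygon_chords_def)
  have AB: "crossing a b" "crossing b a" if "a \<in> A0 i j k l" "b \<in> B0 i j k l" for a b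
    using that assms(1-4) by (auto simp: A0_def B0_def crossing_def)
  show "c \<in> A0 i j k l \<longleftrightarrow> (\<forall>d\<in>B0 i j k l. crossing c d)"
  proof
    assume all: "\<forall>d\<in>B0 i j k l. crossing c d"
    have "(j, N) \<in> B0 i j k l" "(j, l) \<in> B0 i j k l" "(k - 1, l) \<in> B0 i j k l"
      "0 < i \<Longrightarrow> (i - 1, j) \<in> B0 i j k l"
      using assms by (auto simp: B0_def)
    then have "crossing c (j, N)" "crossing c (j, l)" "crossing c (k - 1, l)"
      "0 < i \<Longrightarrow> crossing c (i - 1, j)" using all by auto
    then show "c \<in> A0 i j k l"
      using assms(1-4) le unfolding crossing_def A0_def pq by (cases "i = 0") (auto simp: mem_Times_iff)
  qed (use AB in blast)
  show "c \<in> B0 i j k l \<longleftrightarrow> (\<forall>d\<in>A0 i j k l. crossing c d)"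
  proof
    assume all: "\<forall>d\<in>A0 i j k l. crossing c d"
    have "(i, k) \<in> A0 i j k l" "(j - 1, k) \<in> A0 i j k l" "(i, l - 1) \<in> A0 i j k l"
      using assms by (auto simp: A0_def)
    then have "crossing c (i, k)" "crossing c (j - 1, k)" "crossing c (i, l - 1)" using all by auto
    then show "c \<in> B0 i j k l"
      using assms(1-4) le unfolding crossing_def B0_def pq by (auto simp: mem_Times_iff)
  qed (use AB in blast)
qed

lemma standard_arcs:
  assumes "i < j" "j < k" "k < l" "l \<le> N"
  shows "cross_completely S \<delta> (\<kappa> ` A0 i j k l) (\<kappa> ` B0 i j k l)"
    "join_opposite_arcs S \<delta> (\<kappa> ` A0 i j k l) (\<kappa> ` B0 i j k l)"
proof -
  have complete: "\<kappa> ` X = {a \<in> chords \<delta>. \<forall>b\<in>\<kappa> ` Y. chords_cross S \<delta> a b}"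
    if X: "X \<subseteq> polygon_chords N" and Y: "Y \<subseteq> polygon_chords N"
      and XY: "\<And>c. c \<in> polygon_chords N \<Longrightarrow> c \<in> X \<longleftrightarrow> (\<forall>d\<in>Y. crossing c d)" for X Y
  proof -
    have "(\<forall>d\<in>Y. chords_cross S \<delta> (\<kappa> c) (\<kappa> d)) \<longleftrightarrow> (\<forall>d\<in>Y. crossing c d)" if "c \<in> polygon_chords N" for c
      using chords_cross_iff[OF that] Y by blast
    then have "{c \<in> polygon_chords N. \<forall>d\<in>Y. chords_cross S \<delta> (\<kappa> c) (\<kappa> d)} = {c \<in> polygon_chords N. c \<in> X}"
      using XY by (intro Collect_cong conj_cong refl) simp
    also have "\<dots> = X" using X by blast
    finally have "\<kappa> ` X = \<kappa> ` {c \<in> polygon_chords N. \<forall>d\<in>Y. chords_cross S \<delta> (\<kappa> c) (\<kappa> d)}" by simp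
    also have "\<dots> = {a \<in> chords \<delta>. \<forall>b\<in>\<kappa> ` Y. chords_cross S \<delta> a b}"
      unfolding chords_eq by blast
    finally show ?thesis .
  qed
  note sub = A0_B0_polygon[OF assms]
  show "cross_completely S \<delta> (\<kappa> ` A0 i j k l) (\<kappa> ` B0 i j k l)"
    unfolding cross_completely_def
  proof (intro conjI)
    show "\<kappa> ` A0 i j k l = {a \<in> chords \<delta>. \<forall>b\<in>\<kappa> ` B0 i j k l. chords_cross S \<delta> a b}"
      by (rule complete[OF sub A0_B0_crossing(1)[OF assms]])
    have sym: "chords_cross S \<delta> a b \<longleftrightarrow> chords_cross S \<delta> b a" if "a \<in> chords \<delta>" "b \<in> chords \<delta>" for a b
    proof -
      obtain c d where cd: "c \<in> polygon_chords N" "d \<in> polygon_chords N" "a = \<kappa> c" "b = \<kappa> d"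
        using \<open>a \<in> chords \<delta>\<close> \<open>b \<in> chords \<delta>\<close> unfolding chords_eq by blast
      show ?thesis
        unfolding cd(3,4) chords_cross_iff[OF cd(1,2)] chords_cross_iff[OF cd(2,1)]
        by (auto simp: crossing_def)
    qed
    have "\<kappa> ` A0 i j k l \<subseteq> chords \<delta>" using sub(1) unfolding chords_eq by blast
    then have "{b \<in> chords \<delta>. \<forall>a\<in>\<kappa> ` A0 i j k l. chords_cross S \<delta> a b}
        = {b \<in> chords \<delta>. \<forall>a\<in>\<kappa> ` A0 i j k l. chords_cross S \<delta> b a}"
      using sym by (intro Collect_cong conj_cong ball_cong refl) blast
    then show "\<kappa> ` B0 i j k l = {b \<in> chords \<delta>. \<forall>a\<in>\<kappa> ` A0 i j k l. chords_cross S \<delta> a b}"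
      using complete[OF sub(2,1) A0_B0_crossing(2)[OF assms]] by simp
  qed (use sub in \<open>auto simp: chords_eq\<close>)
  show "join_opposite_arcs S \<delta> (\<kappa> ` A0 i j k l) (\<kappa> ` B0 i j k l)"
    unfolding join_opposite_arcs_def int_card arcs_nat[OF assms, symmetric] arcs_def
    using e0_\<delta> assms
    by (intro bexI[of _ e0] exI[of _ "int i"] exI[of _ "int j"] exI[of _ "int k"] exI[of _ "int l"])
      (auto simp: n_def)
qed

end

section \<open>Smoothness and normal crossings\<close>

context labelled_polygon
begin

abbreviation "R \<equiv> int_poly_ring (chords \<delta>)"
abbreviation "A \<equiv> dihedral_ring S \<delta>"
abbreviation "D \<equiv> boundary_divisor S \<delta>"

text \<open>All triangulations give charts of the same ring. A generator is symmetric in its two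
  products, so the order in which the normal form returns them is immaterial.\<close>

lemma dihedral_ideal_eq:
  assumes "dihedral_chart N pr \<kappa> (chords \<delta>) h d"
  shows "dihedral_chart.I N \<kappa> (chords \<delta>) = dihedral_ideal S \<delta>"
proof -
  interpret C: dihedral_chart N pr \<kappa> "chords \<delta>" h d by fact
  have image: "(\<Prod>a\<in>\<kappa> ` X. mvar a) = (\<Prod>c\<in>X. C.u c)" if "X \<subseteq> polygon_chords N" for X
    using inj_on_subset[OF inj_\<kappa> that] by (simp add: prod.reindex C.u_def)
  have rect: "(\<Prod>c\<in>X \<times> Y. C.u c) = (\<Prod>p\<in>X. \<Prod>q\<in>Y. C.u (p, q))" for X Y
    using prod.cartesian_product[of "\<lambda>p q. C.u (p, q)" Y X] by (simp add: case_prod_eta)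
  have relP: "C.relP i j k l = (\<Prod>a\<in>\<kappa> ` A0 i j k l. mvar a) + (\<Prod>b\<in>\<kappa> ` B0 i j k l. mvar b) - 1"
    if *: "i < j" "j < k" "k < l" "l \<le> N" for i j k l
  proof -
    have disj: "({j..<k} \<times> {l..<Suc N}) \<inter> ({0..<i} \<times> {j..<k}) = {}" using * by auto
    have "(\<Prod>c\<in>B0 i j k l. C.u c)
      = (\<Prod>c\<in>{j..<k} \<times> {l..<Suc N}. C.u c) * (\<Prod>c\<in>{0..<i} \<times> {j..<k}. C.u c)"
      unfolding B0_def by (rule prod.union_disjoint[OF _ _ disj]) auto
    then show ?thesis
      using image[OF A0_B0_polygon(1)[OF *]] image[OF A0_B0_polygon(2)[OF *]]
      unfolding C.relP_def by (simp only: rect A0_def)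
  qed
  have "C.Rels = {(\<Prod>a\<in>A. mvar a) + (\<Prod>b\<in>B. mvar b) - 1 | A B.
      cross_completely S \<delta> A B \<and> join_opposite_arcs S \<delta> A B}" (is "_ = ?G")
  proof
    show "C.Rels \<subseteq> ?G"
    proof
      fix r assume "r \<in> C.Rels"
      then obtain i j k l where *: "i < j" "j < k" "k < l" "l \<le> N" and r: "r = C.relP i j k l"
        by (auto simp: C.Rels_def)
      show "r \<in> ?G" unfolding r relP[OF *] using standard_arcs[OF *] by blast
    qed
    show "?G \<subseteq> C.Rels"
    proof
      fix r assume "r \<in> ?G"
      then obtain X Y where r: "r = (\<Prod>a\<in>X. mvar a) + (\<Prod>b\<in>Y. mvar b) - 1"
        and join: "join_opposite_arcs S \<delta> X Y" by blast
      from join obtain i j k l where *: "i < j" "j < k" "k < l" "l \<le> N"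
        and XY: "X = \<kappa> ` A0 i j k l \<and> Y = \<kappa> ` B0 i j k l \<or> X = \<kappa> ` B0 i j k l \<and> Y = \<kappa> ` A0 i j k l"
        by (rule join_opposite_arcs_normal_form)
      have "r = C.relP i j k l"
        using XY by (elim disjE conjE) (simp_all only: r relP[OF *] add.commute)
      then show "r \<in> C.Rels" unfolding C.Rels_def using * by blast
    qed
  qed
  then show ?thesis by (simp add: C.I_def dihedral_ideal_def)
qed

lemma dihedral_chart_ex:
  assumes "heights N pr"
  obtains h d where "dihedral_chart N pr \<kappa> (chords \<delta>) h d"
proof -
  interpret heights N pr by fact
  obtain h where h: "bij_betw h T {0..<card T}"
    using ex_bij_betw_finite_nat[OF finite_T] by blast
  have "dihedral_chart N pr \<kappa> (chords \<delta>) h (card T)"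
  proof
    show "bij_betw \<kappa> Ch (chords \<delta>)" using inj_\<kappa> by (simp add: bij_betw_def chords_eq Ch_eq)
    show "bij_betw h T {..<card T}" using h by (simp add: atLeast0LessThan)
  qed
  then show thesis by (rule that)
qed

lemma ideal_dihedral: "ideal (dihedral_ideal S \<delta>) R"
  and cring_dihedral: "cring A"
proof -
  \<comment> \<open>The empty set of chords yields some triangulation, and any chart serves to
    transfer these facts.\<close>
  obtain pr where pr: "heights N pr"
    using exists_heights[OF N3, of "{}"] by auto
  obtain h d where "dihedral_chart N pr \<kappa> (chords \<delta>) h d" using dihedral_chart_ex[OF pr] .
  then interpret C: dihedral_chart N pr \<kappa> "chords \<delta>" h d .
  note eq = dihedral_ideal_eq[OF C.dihedral_chart_axioms]
  show "ideal (dihedral_ideal S \<delta>) R" using C.ideal_I by (simp add: eq)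
  show "cring A" using C.cring_A by (simp add: eq dihedral_ring_def)
qed

lemma dihedral_coord_carrier: "c \<in> chords \<delta> \<Longrightarrow> dihedral_coord S \<delta> c \<in> carrier A"
  by (auto simp: dihedral_coord_def dihedral_ring_def carrier_Quot intro: mpolys_mvar)

lemma boundary_divisor_subset_iff:
  assumes "ideal P A" "c \<in> chords \<delta>"
  shows "D c \<subseteq> P \<longleftrightarrow> dihedral_coord S \<delta> c \<in> P"
proof -
  interpret cring A by (rule cring_dihedral)
  show ?thesis
    unfolding boundary_divisor_def
    using cgenideal_self[OF dihedral_coord_carrier[OF assms(2)]] cgenideal_minimal[OF assms(1)] by blast
qed

lemma ideal_boundary_divisor: "c \<in> chords \<delta> \<Longrightarrow> ideal (D c) A"
  unfolding boundary_divisor_def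
  by (rule cring.cgenideal_ideal[OF cring_dihedral dihedral_coord_carrier])

text \<open>The chords whose coordinate vanishes at a point do not cross, since they occur in the two products of
  a common relation.\<close>

lemma heights_at_prime:
  assumes P: "primeideal P A"
  obtains pr h d where "dihedral_chart N pr \<kappa> (chords \<delta>) h d"
    "\<And>c. c \<in> polygon_chords N \<Longrightarrow> dihedral_coord S \<delta> (\<kappa> c) \<in> P \<Longrightarrow> c \<in> heights.T N pr"
    "dihedral_ideal S \<delta> +>\<^bsub>R\<^esub> dihedral_chart.f N pr \<kappa> \<notin> P"
proof -
  define P0 where "P0 = {p \<in> carrier R. dihedral_ideal S \<delta> +>\<^bsub>R\<^esub> p \<in> P}"
  interpret I: ideal "dihedral_ideal S \<delta>" R by (rule ideal_dihedral)
  have "primeideal P0 R"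
    unfolding P0_def
    by (rule ring_hom_ring.primeideal_vimage[OF I.rcos_ring_hom_ring cring_int_poly_ring P[unfolded dihedral_ring_def]])
  then interpret P0: primeideal P0 R .
  note P0_D = ideal_int_poly_ringD[OF P0.is_ideal]
  have P0_prime: "a \<in> P0 \<or> b \<in> P0" if "a \<in> mpolys (chords \<delta>)" "b \<in> mpolys (chords \<delta>)" "a * b \<in> P0" for a b
    using P0.I_prime[of a b] that by simp
  have one: "1 \<notin> P0" using P0_D(6) P0.I_notcarr by auto
  have prod: "\<exists>x\<in>X. g x \<in> P0" if "finite X" "\<And>x. x \<in> X \<Longrightarrow> g x \<in> mpolys (chords \<delta>)" "prod g X \<in> P0"
    for g :: "nat \<times> nat \<Rightarrow> _" and X
    using that
  proof (induction X rule: finite_induct)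
    case (insert x X)
    have "g x \<in> P0 \<or> prod g X \<in> P0"
      using insert by (intro P0_prime mpolys_prod) auto
    then show ?case using insert by auto
  qed (use one in auto)
  have IP: "dihedral_ideal S \<delta> \<subseteq> P0"
  proof
    fix p assume p: "p \<in> dihedral_ideal S \<delta>"
    interpret P: primeideal P A by fact
    have "dihedral_ideal S \<delta> +>\<^bsub>R\<^esub> p = \<zero>\<^bsub>A\<^esub>"
      using Quot_eq_zero_iff[OF cring_int_poly_ring ideal_dihedral I.Icarr[OF p]] p
      by (simp add: dihedral_ring_def)
    then show "p \<in> P0"
      using additive_subgroup.zero_closed[OF P.is_additive_subgroup] I.Icarr[OF p] by (simp add: P0_def)
  qed
  define K where "K = {c \<in> polygon_chords N. mvar (\<kappa> c) \<in> P0}"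
  have coord: "dihedral_coord S \<delta> (\<kappa> c) \<in> P \<longleftrightarrow> mvar (\<kappa> c) \<in> P0" if "c \<in> polygon_chords N" for c
    using that by (auto simp: P0_def dihedral_coord_def chords_eq intro: mpolys_mvar)
  \<comment> \<open>An auxiliary chart, used for its relations; the triangulation adapted to
    \<open>P\<close> is available only once \<open>K\<close> is known not to cross itself.\<close>
  obtain pr0 where pr0: "heights N pr0"
    using exists_heights[OF N3, of "{}"] by auto
  obtain h0 d0 where "dihedral_chart N pr0 \<kappa> (chords \<delta>) h0 d0" using dihedral_chart_ex[OF pr0] .
  then interpret C0: dihedral_chart N pr0 \<kappa> "chords \<delta>" h0 d0 .
  have noncross: False if c: "(p, q) \<in> K" "(p', q') \<in> K" and less: "p < p'" "p' < q" "q < q'" for p q p' q'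
  proof -
    have q': "q' \<le> N" using c by (auto simp: K_def polygon_chords_def)
    have u: "C0.u (p, q) \<in> P0" "C0.u (p', q') \<in> P0" using c by (auto simp: K_def C0.u_def)
    have carr: "C0.u c \<in> mpolys (chords \<delta>)" if "c \<in> polygon_chords N" for c
      using C0.u_carrier that by (simp add: C0.Ch_eq)
    have mem: "prod C0.u X \<in> P0" if "finite X" "X \<subseteq> polygon_chords N" "x \<in> X" "C0.u x \<in> P0" for X x
    proof -
      have "prod C0.u X = prod C0.u (X - {x}) * C0.u x"
        using prod.remove[OF that(1,3)] by (simp add: mult.commute)
      moreover have "prod C0.u (X - {x}) \<in> mpolys (chords \<delta>)"
        using that(2) carr by (intro mpolys_prod) auto
      ultimately show ?thesis using P0_D(4)[OF that(4)] by simp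
    qed
    have rect: "(\<Prod>p\<in>X. \<Prod>q\<in>Y. C0.u (p, q)) = prod C0.u (X \<times> Y)" for X Y
      using prod.cartesian_product[of "\<lambda>p q. C0.u (p, q)" Y X] by (simp add: case_prod_eta)
    \<comment> \<open>Cutting before the four ends puts \<open>(p, q)\<close> into the first product
      and \<open>(p', q')\<close> into the second; both products then lie in \<open>P0\<close>, and
      so does \<open>1\<close>.\<close>
    have r: "C0.relP p p' q q' \<in> P0"
    proof -
      have "C0.relP p p' q q' \<in> C0.Rels" unfolding C0.Rels_def using less q' by blast
      then show ?thesis
        using C0.Rels_I IP unfolding dihedral_ideal_eq[OF C0.dihedral_chart_axioms] by blast
    qed
    have a: "prod C0.u ({p..<p'} \<times> {q..<q'}) \<in> P0"
      by (rule mem[of _ "(p, q)"]) (use less q' u in \<open>auto simp: polygon_chords_def\<close>)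
    have "prod C0.u ({p'..<q} \<times> {q'..<Suc N}) \<in> P0"
      by (rule mem[of _ "(p', q')"]) (use less q' u in \<open>auto simp: polygon_chords_def\<close>)
    moreover have "prod C0.u ({0..<p} \<times> {p'..<q}) \<in> mpolys (chords \<delta>)"
      by (intro mpolys_prod carr) (use less q' in \<open>auto simp: polygon_chords_def\<close>)
    ultimately have b: "prod C0.u ({p'..<q} \<times> {q'..<Suc N}) * prod C0.u ({0..<p} \<times> {p'..<q}) \<in> P0"
      using P0_D(4) by (subst mult.commute) blast
    have "1 = (prod C0.u ({p..<p'} \<times> {q..<q'}) + prod C0.u ({p'..<q} \<times> {q'..<Suc N}) * prod C0.u ({0..<p} \<times> {p'..<q}))
        - C0.relP p p' q q'"
      unfolding C0.relP_def rect by simp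
    then have "1 \<in> P0" using P0_D(5)[OF P0_D(3)[OF a b] r] by simp
    then show False using one by simp
  qed
  have Ksub: "K \<subseteq> polygon_chords N" by (auto simp: K_def)
  obtain pr where pr: "heights N pr" "K \<subseteq> heights.T N pr"
    by (rule exists_heights[OF N3 Ksub]) (erule (4) noncross)
  obtain h d where ch: "dihedral_chart N pr \<kappa> (chords \<delta>) h d" using dihedral_chart_ex[OF pr(1)] .
  then interpret C: dihedral_chart N pr \<kappa> "chords \<delta>" h d .
  show thesis
  proof (rule that[OF ch])
    show "c \<in> C.T" if "c \<in> polygon_chords N" "dihedral_coord S \<delta> (\<kappa> c) \<in> P" for c
      using that coord[OF that(1)] pr(2) by (auto simp: K_def)
    show "dihedral_ideal S \<delta> +>\<^bsub>R\<^esub> C.f \<notin> P"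
    proof
      assume "dihedral_ideal S \<delta> +>\<^bsub>R\<^esub> C.f \<in> P"
      then have "C.f \<in> P0" using C.f_carrier by (simp add: P0_def)
      then obtain c where c: "c \<in> C.Ch - C.T" "C.u c \<in> P0"
        unfolding C.f_def using prod[of "C.Ch - C.T" C.u] C.u_carrier by auto
      then have "c \<in> K" by (simp add: K_def C.u_def C.Ch_eq)
      then show False using pr(2) c by auto
    qed
  qed
qed

definition hyperplanes where
  "hyperplanes P d F \<phi> k \<longleftrightarrow> (\<forall>c\<in>chords \<delta>. D c \<subseteq> P \<longrightarrow> k c < d \<and>
     Idl\<^bsub>chart_ring d 1 (\<lambda>_. rabinowitsch.rel d F)\<^esub> (\<phi> ` D c) =
     PIdl\<^bsub>chart_ring d 1 (\<lambda>_. rabinowitsch.rel d F)\<^esub>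
       (chart_class d 1 (\<lambda>_. rabinowitsch.rel d F) (mvar (k c))))"

text \<open>One chart at each point yields all three claims: it is smooth, the divisors through the
  point are coordinate hyperplanes in it, and setting such a coordinate to zero gives a chart of the
  divisor.\<close>

lemma local_charts:
  assumes P: "primeideal P A"
  obtains d F f \<phi> k where "rabinowitsch d F" "f \<in> carrier A - P"
    "localization_away A f (chart_ring d 1 (\<lambda>_. rabinowitsch.rel d F)) \<phi>"
    "inj_on k {c \<in> chords \<delta>. D c \<subseteq> P}"
    "hyperplanes P d F \<phi> k"
proof -
  obtain pr h d where ch: "dihedral_chart N pr \<kappa> (chords \<delta>) h d"
    and T: "\<And>c. c \<in> polygon_chords N \<Longrightarrow> dihedral_coord S \<delta> (\<kappa> c) \<in> P \<Longrightarrow> c \<in> heights.T N pr"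
    and f: "dihedral_ideal S \<delta> +>\<^bsub>R\<^esub> dihedral_chart.f N pr \<kappa> \<notin> P"
    using heights_at_prime[OF P] by blast
  interpret C: dihedral_chart N pr \<kappa> "chords \<delta>" h d by fact
  note eq = dihedral_ideal_eq[OF ch]
  have A: "C.Aring = A" by (simp add: eq dihedral_ring_def)
  have idP: "ideal P A" using P by (simp add: primeideal_def)
  define k where "k c = h (inv_into C.Ch \<kappa> c)" for c
  have k\<kappa>: "k (\<kappa> c) = h c" if "c \<in> C.T" for c
  proof -
    have "c \<in> C.Ch" using that C.T_subset_Ch by blast
    then have "inv_into C.Ch \<kappa> (\<kappa> c) = c"
      using C.\<kappa> by (intro inv_into_f_f) (auto simp: bij_betw_def)
    then show ?thesis by (simp add: k_def)
  qed
  have div: "\<exists>c'\<in>C.T. c = \<kappa> c'" if c: "c \<in> chords \<delta>" "D c \<subseteq> P" for c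
  proof -
    obtain c' where c': "c' \<in> polygon_chords N" "c = \<kappa> c'" using c(1) chords_eq by auto
    then show ?thesis using T[of c'] boundary_divisor_subset_iff[OF idP c(1)] c(2) by auto
  qed
  show thesis
  proof (rule that)
    show "rabinowitsch d C.FF" by (rule C.R.rabinowitsch_axioms)
    show "C.coset C.f \<in> carrier A - P"
      using f C.coset_carrier[OF C.f_carrier] by (simp add: eq A[symmetric])
    show "localization_away A (C.coset C.f) C.R.C C.\<phi>"
      using C.localization by (simp only: A)
    show "inj_on k {c \<in> chords \<delta>. D c \<subseteq> P}"
    proof (rule inj_onI)
      fix a b assume ab: "a \<in> {c \<in> chords \<delta>. D c \<subseteq> P}" "b \<in> {c \<in> chords \<delta>. D c \<subseteq> P}" "k a = k b"
      obtain a' b' where *: "a' \<in> C.T" "a = \<kappa> a'" "b' \<in> C.T" "b = \<kappa> b'" using div ab(1,2) by blast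
      then have "h a' = h b'" using ab(3) k\<kappa> by simp
      then have "a' = b'" using C.h *(1,3) unfolding bij_betw_def by (blast dest: inj_onD)
      then show "a = b" using * by simp
    qed
    show "hyperplanes P d C.FF C.\<phi> k"
      unfolding hyperplanes_def
    proof (intro ballI impI)
      fix c assume c: "c \<in> chords \<delta>" "D c \<subseteq> P"
      obtain c' where c': "c' \<in> C.T" "c = \<kappa> c'" using div[OF c] by blast
      have kc: "k c = h c'" using k\<kappa> c' by simp
      have Dc: "D c = PIdl\<^bsub>C.Aring\<^esub> (C.coset (C.u c'))"
        by (simp only: boundary_divisor_def dihedral_coord_def A[symmetric] eq C.u_def c'(2))
      show "k c < d \<and> Idl\<^bsub>C.R.C\<^esub> (C.\<phi> ` D c) = PIdl\<^bsub>C.R.C\<^esub> (C.R.cls (mvar (k c)))"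
      proof
        show "k c < d" using C.h c'(1) unfolding kc bij_betw_def by blast
        show "Idl\<^bsub>C.R.C\<^esub> (C.\<phi> ` D c) = PIdl\<^bsub>C.R.C\<^esub> (C.R.cls (mvar (k c)))"
          unfolding kc Dc by (rule C.divisor_eq[OF c'(1)])
      qed
    qed
  qed
qed

lemma normal_crossing_dihedral: "normal_crossing A (chords \<delta>) D"
  unfolding normal_crossing_def
proof (intro allI impI)
  fix P assume P: "primeideal P A"
  obtain d F f \<phi> k where *: "rabinowitsch d F" "f \<in> carrier A - P"
    "localization_away A f (chart_ring d 1 (\<lambda>_. rabinowitsch.rel d F)) \<phi>"
    "inj_on k {c \<in> chords \<delta>. D c \<subseteq> P}"
    "hyperplanes P d F \<phi> k"
    by (rule local_charts[OF P]) (erule (4) that)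
  have "smooth_chart_at A P d 1 (\<lambda>_. rabinowitsch.rel d F) \<phi>"
    by (rule rabinowitsch.smooth_chartI[OF *(1-3)])
  with *(4,5)[unfolded hyperplanes_def] show "\<exists>d r g \<phi> k. smooth_chart_at A P d r g \<phi> \<and>
      inj_on k {c \<in> chords \<delta>. D c \<subseteq> P} \<and>
      (\<forall>c\<in>chords \<delta>. D c \<subseteq> P \<longrightarrow> k c < d \<and>
        Idl\<^bsub>chart_ring d r g\<^esub> (\<phi> ` D c) = PIdl\<^bsub>chart_ring d r g\<^esub> (chart_class d r g (mvar (k c))))"
    by blast
qed

lemma smooth_dihedral: "smooth_over_int A"
  using normal_crossing_dihedral unfolding normal_crossing_def smooth_over_int_def by blast

lemma smooth_boundary_divisor:
  assumes c: "c \<in> chords \<delta>"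
  shows "smooth_over_int (A Quot D c)"
  unfolding smooth_over_int_def
proof (intro allI impI)
  fix P' assume P': "primeideal P' (A Quot D c)"
  note idD = ideal_boundary_divisor[OF c]
  \<comment> \<open>The point of the divisor regarded as a point of the ambient scheme. The divisor
    passes through it and is thus a hyperplane of the chart there.\<close>
  define P where "P = {a \<in> carrier A. D c +>\<^bsub>A\<^esub> a \<in> P'}"
  have P: "primeideal P A"
    unfolding P_def
    by (rule ring_hom_ring.primeideal_vimage[OF ideal.rcos_ring_hom_ring[OF idD] cring_dihedral P'])
  have idP: "ideal P A" using P by (simp add: primeideal_def)
  have "D c \<subseteq> P"
  proof
    fix a assume a: "a \<in> D c"
    then have aA: "a \<in> carrier A" by (rule ideal.Icarr[OF idD])
    interpret P': primeideal P' "A Quot D c" by fact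
    have "D c +>\<^bsub>A\<^esub> a = \<zero>\<^bsub>A Quot D c\<^esub>"
      using Quot_eq_zero_iff[OF cring_dihedral idD aA] a by simp
    then show "a \<in> P"
      using additive_subgroup.zero_closed[OF P'.is_additive_subgroup] aA by (simp add: P_def)
  qed
  obtain d F f \<phi> k where *: "rabinowitsch d F" "f \<in> carrier A - P"
    "localization_away A f (chart_ring d 1 (\<lambda>_. rabinowitsch.rel d F)) \<phi>"
    "inj_on k {c \<in> chords \<delta>. D c \<subseteq> P}"
    and k: "hyperplanes P d F \<phi> k"
    by (rule local_charts[OF P]) (erule (4) that)
  note kc = k[unfolded hyperplanes_def, rule_format, OF c \<open>D c \<subseteq> P\<close>]
  interpret H: hyperplane_chart d F "k c"
    using *(1) kc by (simp add: hyperplane_chart_def hyperplane_chart_axioms_def)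
  have "D c +>\<^bsub>A\<^esub> f \<notin> P'" "f \<in> carrier A" using *(2) by (auto simp: P_def)
  then show "\<exists>d r g \<phi>. smooth_chart_at (A Quot D c) P' d r g \<phi>"
    using H.smooth_chart_quotient[OF cring_dihedral idD _ *(3)] kc by blast
qed

end

theorem theorem2p21:
  fixes S :: "'s set" and \<delta> :: "(int \<Rightarrow> 's) set" and n l :: nat
  assumes "card S = n" and "n = l + 3" and "n \<ge> 4"
    and "dihedral_structure S \<delta>"
  shows "smooth_over_int (dihedral_ring S \<delta>)
    \<and> (\<forall>c \<in> chords \<delta>. smooth_over_int (dihedral_ring S \<delta> Quot boundary_divisor S \<delta> c))
    \<and> normal_crossing (dihedral_ring S \<delta>) (chords \<delta>) (boundary_divisor S \<delta>)"
proof -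
  obtain e where e: "edge_labelling S e" "\<delta> = dihedral_class e"
    using assms(4) by (auto simp: dihedral_structure_def)
  \<comment> \<open>The vertices are numbered from \<open>0\<close> to \<open>N\<close>, so
    \<open>N = n - 1\<close>, and \<open>n \<ge> 4\<close> becomes \<open>3 \<le> N\<close>.\<close>
  interpret labelled_polygon S e "n - 1" \<delta>
    by unfold_locales (use assms e in auto)
  show ?thesis
    using smooth_dihedral smooth_boundary_divisor normal_crossing_dihedral by blast
qed

end
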